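(* Let $p$ be a prime and let $(R, R^{+})$ be an analytic perfectoid pair in characteristic $p$, let $\overline{x}_0,\dots,\overline{x}_m\in R^+$ be generators of an ideal of definition of $R^+$, and let $\rho\in(0,1)$. Then the weighted Gauss norm \[ \Big|\sum_{n=0}^{\infty}p^{n}[\overline{y}_{n}] \Big|_{\rho} = \sup_{n\ge 0} \{ \rho^{n}|\overline{y}_{n}| \} \] on $W(R^{+})$ defines the $(p, [\overline{x}_{0}],\dots,[\overline{x}_{m}])$-adic topology.
   Context: A Huber ring is a complete topological ring $A$ with an open subring $A_0$ carrying the $I$-adic topology for a finitely generated ideal $I\subset A_0$. A uniform (power-bounded elements form a bounded set) analytic (topologically nilpotent elements generate the unit ideal) Huber pair $(A,A^+)$ is an analytic perfectoid pair if there is an ideal of definition $I\subset A^+$ with $p\in I^p$ and Frobenius $A^+/I\to A^+/I^p$ surjective. $R$ is perfect of characteristic $p$; it is regarded as a Banach ring with a power-multiplicative norm $|\cdot|$ defining its topology. $[\cdot]$ denotes the Teichmüller lift, and each element of $W(R^+)$ is uniquely $\sum_n p^n[\overline{y}_n]$ with $\overline{y}_n\in R^+$. *)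

theory Defs
  imports "HOL-Analysis.Analysis" "HOL-Library.Poly_Mapping" "HOL-Algebra.Algebra"
begin

section \<open>Topological rings and adic topologies\<close>

definition topological_cring :: "('a, 'm) ring_scheme \<Rightarrow> 'a topology \<Rightarrow> bool" where
  "topological_cring A T \<longleftrightarrow>
     cring A \<and> topspace T = carrier A \<and>
     continuous_map (prod_topology T T) T (\<lambda>(x, y). x \<oplus>\<^bsub>A\<^esub> y) \<and>
     continuous_map T T (\<lambda>x. \<ominus>\<^bsub>A\<^esub> x) \<and>
     continuous_map (prod_topology T T) T (\<lambda>(x, y). x \<otimes>\<^bsub>A\<^esub> y)"

definition cauchy_filter_on :: "('a, 'm) ring_scheme \<Rightarrow> 'a topology \<Rightarrow> 'a filter \<Rightarrow> bool" where
  "cauchy_filter_on A T F \<longleftrightarrow>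
     F \<noteq> bot \<and> F \<le> principal (carrier A) \<and>
     (\<forall>U. openin T U \<and> \<zero>\<^bsub>A\<^esub> \<in> U \<longrightarrow>
        (\<exists>S \<subseteq> carrier A. (\<forall>\<^sub>F x in F. x \<in> S) \<and> (\<forall>x\<in>S. \<forall>y\<in>S. x \<ominus>\<^bsub>A\<^esub> y \<in> U)))"

text \<open>As usual for Huber rings, completeness includes separatedness.\<close>

definition complete_topological_cring :: "('a, 'm) ring_scheme \<Rightarrow> 'a topology \<Rightarrow> bool" where
  "complete_topological_cring A T \<longleftrightarrow>
     topological_cring A T \<and> Hausdorff_space T \<and>
     (\<forall>F. cauchy_filter_on A T F \<longrightarrow> (\<exists>l. limitin T (\<lambda>x. x) l F))"

text \<open>Powers of an ideal are taken in the monoid \<^const>\<open>ideals_set\<close>;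
  the zeroth power is the whole ring.\<close>

definition adic_topology :: "('a, 'm) ring_scheme \<Rightarrow> 'a set \<Rightarrow> 'a topology" where
  "adic_topology A I =
     topology (\<lambda>U. U \<subseteq> carrier A \<and>
                   (\<forall>x\<in>U. \<exists>n::nat. x <+\<^bsub>A\<^esub> (I [^]\<^bsub>ideals_set A\<^esub> n) \<subseteq> U))"

definition fg_ideal :: "('a, 'm) ring_scheme \<Rightarrow> 'a set \<Rightarrow> bool" where
  "fg_ideal A I \<longleftrightarrow> (\<exists>S. finite S \<and> S \<subseteq> carrier A \<and> I = Idl\<^bsub>A\<^esub> S)"

abbreviation restrict_ring :: "('a, 'm) ring_scheme \<Rightarrow> 'a set \<Rightarrow> ('a, 'm) ring_scheme" where
  "restrict_ring A A0 \<equiv> A\<lparr>carrier := A0\<rparr>"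

definition ideal_of_definition ::
  "('a, 'm) ring_scheme \<Rightarrow> 'a topology \<Rightarrow> 'a set \<Rightarrow> 'a set \<Rightarrow> bool" where
  "ideal_of_definition A T A0 I \<longleftrightarrow>
     fg_ideal (restrict_ring A A0) I \<and>
     subtopology T A0 = adic_topology (restrict_ring A A0) I"

section \<open>Huber rings and perfectoid pairs\<close>

definition huber_ring :: "('a, 'm) ring_scheme \<Rightarrow> 'a topology \<Rightarrow> bool" where
  "huber_ring A T \<longleftrightarrow>
     complete_topological_cring A T \<and>
     (\<exists>A0 I. subring A0 A \<and> openin T A0 \<and> ideal_of_definition A T A0 I)"

definition bounded_in :: "('a, 'm) ring_scheme \<Rightarrow> 'a topology \<Rightarrow> 'a set \<Rightarrow> bool" where
  "bounded_in A T S \<longleftrightarrow>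
     S \<subseteq> carrier A \<and>
     (\<forall>U. openin T U \<and> \<zero>\<^bsub>A\<^esub> \<in> U \<longrightarrow>
        (\<exists>V. openin T V \<and> \<zero>\<^bsub>A\<^esub> \<in> V \<and> (\<forall>v\<in>V. \<forall>s\<in>S. v \<otimes>\<^bsub>A\<^esub> s \<in> U)))"

definition power_bounded_elements :: "('a, 'm) ring_scheme \<Rightarrow> 'a topology \<Rightarrow> 'a set" where
  "power_bounded_elements A T =
     {a \<in> carrier A. bounded_in A T (range (\<lambda>n::nat. a [^]\<^bsub>A\<^esub> n))}"

definition topologically_nilpotent_elements :: "('a, 'm) ring_scheme \<Rightarrow> 'a topology \<Rightarrow> 'a set" where
  "topologically_nilpotent_elements A T =
     {a \<in> carrier A. limitin T (\<lambda>n::nat. a [^]\<^bsub>A\<^esub> n) \<zero>\<^bsub>A\<^esub> sequentially}"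

definition uniform_ring :: "('a, 'm) ring_scheme \<Rightarrow> 'a topology \<Rightarrow> bool" where
  "uniform_ring A T \<longleftrightarrow> bounded_in A T (power_bounded_elements A T)"

definition analytic_ring :: "('a, 'm) ring_scheme \<Rightarrow> 'a topology \<Rightarrow> bool" where
  "analytic_ring A T \<longleftrightarrow> Idl\<^bsub>A\<^esub> (topologically_nilpotent_elements A T) = carrier A"

definition integral_over :: "('a, 'm) ring_scheme \<Rightarrow> 'a set \<Rightarrow> 'a \<Rightarrow> bool" where
  "integral_over A B x \<longleftrightarrow>
     (\<exists>(n::nat) c. (\<forall>i<n. c i \<in> B) \<and>
        x [^]\<^bsub>A\<^esub> n \<oplus>\<^bsub>A\<^esub> (\<Oplus>\<^bsub>A\<^esub>i\<in>{..<n}. c i \<otimes>\<^bsub>A\<^esub> x [^]\<^bsub>A\<^esub> i) = \<zero>\<^bsub>A\<^esub>)"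

definition huber_pair :: "('a, 'm) ring_scheme \<Rightarrow> 'a topology \<Rightarrow> 'a set \<Rightarrow> bool" where
  "huber_pair A T Aplus \<longleftrightarrow>
     huber_ring A T \<and> subring Aplus A \<and> openin T Aplus \<and>
     Aplus \<subseteq> power_bounded_elements A T \<and>
     (\<forall>x\<in>carrier A. integral_over A Aplus x \<longrightarrow> x \<in> Aplus)"

text \<open>The map \<open>B/I \<rightarrow> B/I\<^sup>p\<close> induced by \<open>z \<mapsto> z\<^sup>p\<close>. If \<open>p \<in> I\<^sup>p\<close>, the cosets in the
  union all coincide.\<close>

definition frobenius_mod :: "nat \<Rightarrow> ('a, 'm) ring_scheme \<Rightarrow> 'a set \<Rightarrow> 'a set \<Rightarrow> 'a set" where
  "frobenius_mod p B I C = (\<Union>z\<in>C. (I [^]\<^bsub>ideals_set B\<^esub> p) +>\<^bsub>B\<^esub> (z [^]\<^bsub>B\<^esub> p))"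

definition analytic_perfectoid_pair ::
  "nat \<Rightarrow> ('a, 'm) ring_scheme \<Rightarrow> 'a topology \<Rightarrow> 'a set \<Rightarrow> bool" where
  "analytic_perfectoid_pair p A T Aplus \<longleftrightarrow>
     huber_pair A T Aplus \<and> uniform_ring A T \<and> analytic_ring A T \<and>
     (\<exists>I. ideal_of_definition A T Aplus I \<and>
        (let B = restrict_ring A Aplus; Ip = I [^]\<^bsub>ideals_set B\<^esub> p in
           add_pow B p \<one>\<^bsub>B\<^esub> \<in> Ip \<and>
           frobenius_mod p B I ` carrier (B Quot I) = carrier (B Quot Ip)))"

section \<open>Norms\<close>

text \<open>The value outside the carrier is irrelevant; it is set to \<open>0\<close> because the locale
  \<^const>\<open>Metric_space\<close> requires symmetry and nonnegativity on the whole type.\<close>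

definition norm_dist :: "('a, 'm) ring_scheme \<Rightarrow> ('a \<Rightarrow> real) \<Rightarrow> 'a \<Rightarrow> 'a \<Rightarrow> real" where
  "norm_dist A N x y = (if x \<in> carrier A \<and> y \<in> carrier A then N (x \<ominus>\<^bsub>A\<^esub> y) else 0)"

definition norm_topology :: "('a, 'm) ring_scheme \<Rightarrow> ('a \<Rightarrow> real) \<Rightarrow> 'a topology" where
  "norm_topology A N = Metric_space.mtopology (carrier A) (norm_dist A N)"

definition banach_ring_norm :: "('a, 'm) ring_scheme \<Rightarrow> ('a \<Rightarrow> real) \<Rightarrow> bool" where
  "banach_ring_norm A N \<longleftrightarrow>
     (\<forall>x\<in>carrier A. 0 \<le> N x \<and> (N x = 0 \<longleftrightarrow> x = \<zero>\<^bsub>A\<^esub>)) \<and>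
     (\<forall>x\<in>carrier A. \<forall>y\<in>carrier A. N (x \<ominus>\<^bsub>A\<^esub> y) \<le> max (N x) (N y)) \<and>
     (\<forall>x\<in>carrier A. \<forall>y\<in>carrier A. N (x \<otimes>\<^bsub>A\<^esub> y) \<le> N x * N y) \<and>
     Metric_space.mcomplete (carrier A) (norm_dist A N)"

definition power_multiplicative_norm :: "('a, 'm) ring_scheme \<Rightarrow> ('a \<Rightarrow> real) \<Rightarrow> bool" where
  "power_multiplicative_norm A N \<longleftrightarrow>
     (\<forall>x\<in>carrier A. \<forall>n::nat. n > 0 \<longrightarrow> N (x [^]\<^bsub>A\<^esub> n) = N x ^ n)"

section \<open>Witt vectors\<close>

text \<open>Integer polynomials in two families of variables \<open>X\<^sub>i\<close> (index \<^term>\<open>Inl i\<close>) and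
  \<open>Y\<^sub>i\<close> (index \<^term>\<open>Inr i\<close>).\<close>

type_synonym witt_poly = "((nat + nat) \<Rightarrow>\<^sub>0 nat) \<Rightarrow>\<^sub>0 int"

definition witt_var :: "nat + nat \<Rightarrow> witt_poly" where
  "witt_var v = Poly_Mapping.single (Poly_Mapping.single v 1) 1"

definition ghost :: "nat \<Rightarrow> (nat \<Rightarrow> witt_poly) \<Rightarrow> nat \<Rightarrow> witt_poly" where
  "ghost p S n = (\<Sum>i\<le>n. of_nat (p ^ i) * S i ^ (p ^ (n - i)))"

text \<open>The universal polynomials describing addition and multiplication of \<open>p\<close>-typical Witt
  vectors: the unique integral polynomials for which the ghost components are additive,
  respectively multiplicative.\<close>

definition witt_add_poly :: "nat \<Rightarrow> nat \<Rightarrow> witt_poly" where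
  "witt_add_poly p = (THE S. \<forall>n. ghost p S n =
     ghost p (\<lambda>i. witt_var (Inl i)) n + ghost p (\<lambda>i. witt_var (Inr i)) n)"

definition witt_mult_poly :: "nat \<Rightarrow> nat \<Rightarrow> witt_poly" where
  "witt_mult_poly p = (THE S. \<forall>n. ghost p S n =
     ghost p (\<lambda>i. witt_var (Inl i)) n * ghost p (\<lambda>i. witt_var (Inr i)) n)"

definition eval_witt_poly :: "('a, 'm) ring_scheme \<Rightarrow> (nat + nat \<Rightarrow> 'a) \<Rightarrow> witt_poly \<Rightarrow> 'a" where
  "eval_witt_poly A f P =
     (\<Oplus>\<^bsub>A\<^esub>m\<in>Poly_Mapping.keys P. add_pow A (Poly_Mapping.lookup P m)
        (\<Otimes>\<^bsub>A\<^esub>v\<in>Poly_Mapping.keys m. f v [^]\<^bsub>A\<^esub> Poly_Mapping.lookup m v))"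

definition teichmuller :: "('a, 'm) ring_scheme \<Rightarrow> 'a \<Rightarrow> nat \<Rightarrow> 'a" where
  "teichmuller A x = (\<lambda>n. if n = 0 then x else \<zero>\<^bsub>A\<^esub>)"

definition witt_ring :: "nat \<Rightarrow> ('a, 'm) ring_scheme \<Rightarrow> (nat \<Rightarrow> 'a) ring" where
  "witt_ring p A =
     \<lparr>carrier = {a. \<forall>n. a n \<in> carrier A},
      mult = (\<lambda>a b n. eval_witt_poly A (case_sum a b) (witt_mult_poly p n)),
      one = teichmuller A \<one>\<^bsub>A\<^esub>,
      ring.zero = (\<lambda>_. \<zero>\<^bsub>A\<^esub>),
      add = (\<lambda>a b n. eval_witt_poly A (case_sum a b) (witt_add_poly p n))\<rparr>"

text \<open>\<open>w = \<Sum>\<^sub>n p\<^sup>n [y\<^sub>n]\<close>, the sum being \<open>p\<close>-adically convergent. The \<open>y\<^sub>n\<close> differ from the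
  Witt components \<open>w n\<close> by \<open>p\<^sup>n\<close>-th powers.\<close>

definition teichmuller_expansion ::
  "nat \<Rightarrow> ('a, 'm) ring_scheme \<Rightarrow> (nat \<Rightarrow> 'a) \<Rightarrow> (nat \<Rightarrow> 'a) \<Rightarrow> bool" where
  "teichmuller_expansion p A w y \<longleftrightarrow>
     (\<forall>n. y n \<in> carrier A) \<and>
     (let W = witt_ring p A in
        limitin (adic_topology W (Idl\<^bsub>W\<^esub> {add_pow W p \<one>\<^bsub>W\<^esub>}))
          (\<lambda>k. \<Oplus>\<^bsub>W\<^esub>n\<in>{..<k}. add_pow W (p ^ n) (teichmuller A (y n))) w sequentially)"

definition gauss_norm ::
  "nat \<Rightarrow> ('a, 'm) ring_scheme \<Rightarrow> ('a \<Rightarrow> real) \<Rightarrow> real \<Rightarrow> (nat \<Rightarrow> 'a) \<Rightarrow> real" where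
  "gauss_norm p A N \<rho> w =
     (let y = (THE y. teichmuller_expansion p A w y) in (SUP n. \<rho> ^ n * N (y n)))"

end

theory Submission
  imports Defs
begin

text \<open>
  Identities in \<open>W(R\<^sup>+)\<close> are checked on ghost components after lifting to Witt vectors over the
  torsion-free ring \<open>\<int>[X\<^sub>b | b \<in> R\<^sup>+]\<close>, where congruent ghost components have congruent
  Witt components. The Witt addition polynomials are isobaric, which makes the Gauss norm
  ultrametric; submultiplicativity follows from \<open>a b = [a\<^sub>0] b + p (a' b)\<close> for
  \<open>a = [a\<^sub>0] + p a'\<close>.

  Let \<open>J = (p, [x\<^sub>0], \<dots>, [x\<^sub>m])\<close>. The generators have Gauss norm at most some \<open>c < 1\<close>, so
  \<open>J\<^sup>k\<close> lies in the ball of radius \<open>c\<^sup>k\<close>. Conversely, if \<open>y \<in> R\<^sup>+\<close> is small, then so is its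
  root \<open>z\<close> of order \<open>q = p\<^sup>k\<close>; hence \<open>z \<in> (x\<^sub>0, \<dots>, x\<^sub>m)\<close>, \<open>[z] \<in> J\<close>, and
  \<open>[y] = [z]\<^sup>q \<in> J\<^sup>k\<close>. Applied to the first \<open>k\<close> Teichmueller coefficients of \<open>w\<close>, this puts every
  \<open>w\<close> of small Gauss norm into \<open>J\<^sup>k\<close>.

  That \<open>R\<^sup>+\<close> is perfect follows from the surjectivity of Frobenius modulo \<open>I\<^sup>p\<close> by successive
  approximation.
\<close>

subsection \<open>Congruences between ghost components\<close>

text \<open>The coefficients \<open>y n\<close> are roots of order \<open>p ^ n\<close> of the Witt
  components, so Gauss norm at most \<open>c\<close> means
  \<open>N (w n) \<le> (c / \<rho> ^ n) ^ (p ^ n)\<close> for all \<open>n\<close>. This dictates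
  the weights: with weight \<open>p ^ i\<close> for both variables of index \<open>i\<close>, the
  n-th addition polynomial is isobaric of weight \<open>p ^ n\<close>, and \<open>\<rho> < 1\<close>
  makes \<open>c / \<rho> ^ n\<close> a common bound for all indices up to \<open>n\<close>.

  Extracting roots and comparing norms presupposes that R+ is perfect and that the norm is at most 1
  on it; both have to be derived. A topologically nilpotent unit need not exist, so the norm bound
  does not come from rescaling by one; it uses an ideal that contains all topologically nilpotent
  elements. Frobenius is surjective only modulo \<open>I ^ p\<close>, and the approximation is
  improved by one power of \<open>I\<close> at a time.

  The Teichmueller map is not additive, but \<open>[a] + [b]\<close> and \<open>[a + b]\<close>
  differ by a multiple of \<open>p\<close>, which lies in \<open>J\<close>. Hence the elements
  \<open>z\<close> with \<open>[z]\<close> in \<open>J\<close> form an ideal of R+.\<close>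

lemma prime_dvd_power_add:
  fixes x y :: "'r::comm_ring_1"
  assumes p: "Factorial_Ring.prime (p::nat)"
  shows "of_nat p dvd (x + y) ^ p - (x ^ p + y ^ p)"
proof -
  have p0: "p > 0" using p by (simp add: prime_gt_0_nat)
  let ?f = "\<lambda>k. of_nat (p choose k) * x ^ k * y ^ (p - k)"
  have "{..p} = insert 0 (insert p {0<..<p})" using p0 by auto
  then have "(x + y) ^ p = ?f 0 + (?f p + (\<Sum>k\<in>{0<..<p}. ?f k))"
    using p0 by (simp add: binomial_ring)
  then have eq: "(x + y) ^ p - (x ^ p + y ^ p) = (\<Sum>k\<in>{0<..<p}. ?f k)"
    by simp
  have "of_nat p dvd ?f k" if "k \<in> {0<..<p}" for k
  proof -
    have "p dvd (p choose k)" using that p by (intro dvd_choose_prime) auto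
    then have "(of_nat p :: 'r) dvd of_nat (p choose k)" by (metis dvdE dvd_triv_left of_nat_mult)
    then show ?thesis by (simp add: dvd_mult2)
  qed
  then show ?thesis unfolding eq by (intro dvd_sum) auto
qed

text \<open>\<open>x ^ p - y ^ p\<close> is \<open>x - y\<close> times a sum of \<open>p\<close>
  monomials. Modulo \<open>p\<close> all of these equal \<open>y ^ (p - 1)\<close>, so
  \<open>p\<close> divides the sum, which is the additional factor.\<close>

lemma power_diff_dvd_step:
  fixes x y :: "'r::comm_ring_1"
  assumes "of_nat p ^ Suc j dvd x - y"
  shows "of_nat p ^ Suc (Suc j) dvd x ^ p - y ^ p"
proof -
  let ?s = "\<Sum>i<p. y ^ (p - Suc i) * x ^ i"
  have px: "of_nat p dvd x - y" using assms by (meson dvd_trans dvd_power zero_less_Suc)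
  have "of_nat p dvd ?s - (\<Sum>i<p. y ^ (p - Suc i) * y ^ i)"
    unfolding sum_subtractf[symmetric]
  proof (intro dvd_sum)
    fix i
    have "x - y dvd x ^ i - y ^ i" by (metis dvd_triv_left power_diff_sumr2)
    then have "of_nat p dvd x ^ i - y ^ i" using px dvd_trans by blast
    then show "of_nat p dvd y ^ (p - Suc i) * x ^ i - y ^ (p - Suc i) * y ^ i"
      by (metis dvd_mult right_diff_distrib)
  qed
  moreover have "(\<Sum>i<p. y ^ (p - Suc i) * y ^ i) = (\<Sum>i<p. y ^ (p - 1))"
    by (intro sum.cong) (auto simp flip: power_add)
  ultimately have "of_nat p dvd ?s"
    by (simp add: dvd_diff_right_iff dvd_diff_left_iff)
  then have "of_nat p ^ Suc j * of_nat p dvd (x - y) * ?s" using assms by (intro mult_dvd_mono)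
  then show ?thesis by (simp add: power_diff_sumr2 mult.commute)
qed

lemma power_prime_power_diff_dvd:
  fixes x y :: "'r::comm_ring_1"
  assumes "of_nat p dvd x - y"
  shows "of_nat p ^ Suc k dvd x ^ (p ^ k) - y ^ (p ^ k)"
proof (induction k)
  case (Suc k)
  from power_diff_dvd_step[OF Suc] show ?case
    by (simp add: power_mult[symmetric] mult.commute)
qed (use assms in simp)

text \<open>\<open>ghost\<close> over an arbitrary commutative ring: the lifts of Witt vectors used
  below have components in polynomial rings other than \<open>witt_poly\<close>.\<close>

definition ghost_component :: "nat \<Rightarrow> (nat \<Rightarrow> 'r::comm_ring_1) \<Rightarrow> nat \<Rightarrow> 'r" where
  "ghost_component p a n = (\<Sum>i\<le>n. of_nat p ^ i * a i ^ (p ^ (n - i)))"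

lemma ghost_component_lessThan:
  "ghost_component p a n = (\<Sum>i<n. of_nat p ^ i * a i ^ (p ^ (n - i))) + of_nat p ^ n * a n"
  by (simp add: ghost_component_def lessThan_Suc_atMost[symmetric])

lemma ghost_component_cong: "(\<And>i. i \<le> n \<Longrightarrow> a i = b i) \<Longrightarrow> ghost_component p a n = ghost_component p b n"
  by (simp add: ghost_component_def)

text \<open>The power \<open>p ^ (n - i)\<close> contributes \<open>n - i + 1\<close> factors
  \<open>p\<close>, and the prefactor contributes the remaining \<open>i\<close>.\<close>

lemma ghost_summand_diff_dvd:
  fixes x y :: "'r::comm_ring_1"
  assumes "of_nat p dvd x - y" "i \<le> n"
  shows "of_nat p ^ Suc n dvd of_nat p ^ i * x ^ (p ^ (n - i)) - of_nat p ^ i * y ^ (p ^ (n - i))"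
proof -
  have "of_nat p ^ i * of_nat p ^ Suc (n - i) dvd of_nat p ^ i * (x ^ (p ^ (n - i)) - y ^ (p ^ (n - i)))"
    using power_prime_power_diff_dvd[OF assms(1)] by (intro mult_dvd_mono) auto
  moreover have "of_nat p ^ i * of_nat p ^ Suc (n - i) = (of_nat p ^ Suc n :: 'r)"
    using assms(2) by (metis add_Suc_right le_add_diff_inverse power_add)
  ultimately show ?thesis by (simp add: right_diff_distrib)
qed

lemma power_dvd_cancel:
  fixes x :: "'r::comm_ring_1"
  assumes tf: "\<And>x::'r. of_nat p * x = 0 \<Longrightarrow> x = 0" and "of_nat p ^ (n + k) dvd of_nat p ^ n * x"
  shows "of_nat p ^ k dvd x"
  using assms(2)
proof (induction n)
  case (Suc n)
  then obtain t where "of_nat p ^ Suc (n + k) * t = of_nat p ^ Suc n * x" by (metis dvdE add_Suc)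
  then have "of_nat p * (of_nat p ^ (n + k) * t - of_nat p ^ n * x) = 0"
    by (simp add: algebra_simps)
  then have "of_nat p ^ (n + k) * t = of_nat p ^ n * x" using tf by fastforce
  then show ?case using Suc.IH by (metis dvd_triv_left)
qed simp

text \<open>By induction the summands below the top one agree modulo \<open>p ^ Suc n\<close>. This
  leaves \<open>p ^ n * (a n - b n)\<close>, and torsion-freeness cancels
  \<open>p ^ n\<close>.\<close>

lemma components_cong_of_ghost_cong:
  fixes a b :: "nat \<Rightarrow> 'r::comm_ring_1"
  assumes tf: "\<And>x::'r. of_nat p * x = 0 \<Longrightarrow> x = 0"
    and gh: "\<And>n. of_nat p ^ Suc n dvd ghost_component p a n - ghost_component p b n"
  shows "of_nat p dvd a n - b n"
proof (induction n rule: less_induct)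
  case (less n)
  let ?s = "\<lambda>a. \<Sum>i<n. of_nat p ^ i * a i ^ (p ^ (n - i)) :: 'r"
  have "of_nat p ^ Suc n dvd ?s a - ?s b"
    unfolding sum_subtractf[symmetric]
    using less by (intro dvd_sum ghost_summand_diff_dvd) auto
  then have "of_nat p ^ Suc n dvd (ghost_component p a n - ghost_component p b n) - (?s a - ?s b)"
    by (rule dvd_diff[OF gh])
  also have "\<dots> = of_nat p ^ n * (a n - b n)"
    by (simp add: ghost_component_lessThan algebra_simps)
  finally show ?case using power_dvd_cancel[OF tf, of _ n 1] by simp
qed

lemma ghost_component_inj:
  fixes a b :: "nat \<Rightarrow> 'r::comm_ring_1"
  assumes tf: "\<And>x::'r. of_nat p * x = 0 \<Longrightarrow> x = 0"
    and gh: "\<And>n. ghost_component p a n = ghost_component p b n"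
  shows "a = b"
proof
  fix n show "a n = b n"
  proof (induction n rule: less_induct)
    case (less n)
    then have "of_nat p ^ n * (a n - b n) = 0"
      using gh[of n] by (simp add: ghost_component_lessThan algebra_simps)
    moreover have "x = 0" if "of_nat p ^ k * x = 0" for x :: 'r and k
      using that tf by (induction k) (auto simp: mult.assoc)
    ultimately have "a n - b n = 0" by blast
    then show ?case by simp
  qed
qed

text \<open>Dwork's criterion: a Frobenius lift \<open>\<phi>\<close> characterises the image of the ghost map.\<close>

lemma dwork_criterion:
  fixes \<phi> :: "'r::comm_ring_1 \<Rightarrow> 'r" and t :: "nat \<Rightarrow> 'r"
  assumes hom: "\<And>x y. \<phi> (x + y) = \<phi> x + \<phi> y" "\<And>x y. \<phi> (x * y) = \<phi> x * \<phi> y" "\<phi> 1 = 1"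
    and lift: "\<And>x. of_nat p dvd \<phi> x - x ^ p"
    and t: "\<And>n. of_nat p ^ Suc n dvd t (Suc n) - \<phi> (t n)"
  shows "\<exists>S. \<forall>n. ghost_component p S n = t n"
proof -
  have z: "\<phi> 0 = 0" using hom(1)[of 0 0] by simp
  have pow: "\<phi> (x ^ k) = \<phi> x ^ k" for x k by (induction k) (auto simp: hom)
  have nat: "\<phi> (of_nat k) = of_nat k" for k by (induction k) (auto simp: hom z)
  have sum: "\<phi> (sum f I) = (\<Sum>i\<in>I. \<phi> (f i))" for f :: "nat \<Rightarrow> 'r" and I
    by (induction I rule: infinite_finite_induct) (auto simp: hom z)
  let ?P = "\<lambda>n S. \<forall>k\<le>n. ghost_component p S k = t k"
  let ?Q = "\<lambda>n S S'. \<forall>k\<le>n. S' k = (S :: nat \<Rightarrow> 'r) k"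
  have "\<exists>f. \<forall>n. ?P n (f n) \<and> ?Q n (f n) (f (Suc n))"
  proof (rule dependent_nat_choice)
    show "\<exists>S. ?P 0 S" by (rule exI[of _ "\<lambda>_. t 0"]) (simp add: ghost_component_def)
  next
    fix S n assume S: "?P n S"
    let ?s = "\<Sum>i<Suc n. of_nat p ^ i * S i ^ (p ^ (Suc n - i))"
    \<comment> \<open>The part \<open>?s\<close> of the next ghost component is already fixed by the
      components up to \<open>n\<close>. It agrees with \<open>\<phi> (t n)\<close> modulo
      \<open>p ^ Suc n\<close>, because \<open>\<phi> (S i)\<close> and \<open>S i ^ p\<close> agree
      modulo \<open>p\<close>; so the new component can be solved for.\<close>
    have "\<phi> (t n) = (\<Sum>i<Suc n. of_nat p ^ i * \<phi> (S i) ^ (p ^ (n - i)))"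
      using S by (simp add: ghost_component_def sum hom pow nat lessThan_Suc_atMost flip: S[rule_format])
    moreover have "?s = (\<Sum>i<Suc n. of_nat p ^ i * (S i ^ p) ^ (p ^ (n - i)))"
      by (intro sum.cong) (auto simp: Suc_diff_le power_mult[symmetric])
    ultimately have "of_nat p ^ Suc n dvd \<phi> (t n) - ?s"
      using lift by (simp only: sum_subtractf[symmetric]) (intro dvd_sum ghost_summand_diff_dvd, auto)
    then have "of_nat p ^ Suc n dvd (t (Suc n) - \<phi> (t n)) + (\<phi> (t n) - ?s)"
      using t by (intro dvd_add)
    then obtain r where r: "t (Suc n) - ?s = of_nat p ^ Suc n * r"
      unfolding add_diff_eq diff_add_cancel by (elim dvdE)
    let ?S = "S(Suc n := r)"
    have "ghost_component p ?S (Suc n) = ?s + of_nat p ^ Suc n * r"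
      unfolding ghost_component_lessThan by (auto intro!: sum.cong arg_cong2[of _ _ _ _ "(+)"])
    then have "ghost_component p ?S (Suc n) = t (Suc n)" using r by (simp add: algebra_simps)
    moreover have "ghost_component p ?S k = t k" if "k \<le> n" for k
      using S that ghost_component_cong[of k ?S S p] by auto
    ultimately have "?P (Suc n) ?S" by (auto simp: le_Suc_eq)
    moreover have "?Q n S ?S" by auto
    ultimately show "\<exists>S'. ?P (Suc n) S' \<and> ?Q n S S'" by blast
  qed
  then obtain f where f: "\<And>n. ?P n (f n)" "\<And>n. ?Q n (f n) (f (Suc n))" by blast
  \<comment> \<open>Later approximations keep the earlier components, so the diagonal sequence has
    all the prescribed ghost components.\<close>
  have stab: "f n k = f k k" if "k \<le> n" for n k
    using that by (induction n rule: dec_induct) (use f(2) in auto)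
  have "ghost_component p (\<lambda>k. f k k) n = t n" for n
  proof -
    have "ghost_component p (\<lambda>k. f k k) n = ghost_component p (f n) n"
      by (rule ghost_component_cong) (rule stab[symmetric])
    then show ?thesis using f(1) by simp
  qed
  then show ?thesis by blast
qed

subsection \<open>Evaluation of integral polynomials\<close>

text \<open>\<open>witt_poly\<close> is the case of variables indexed by \<open>nat + nat\<close>.
  Lifting Witt vectors takes one variable for each element of the base ring.\<close>

type_synonym 'v zpoly = "('v \<Rightarrow>\<^sub>0 nat) \<Rightarrow>\<^sub>0 int"

definition zvar :: "'v \<Rightarrow> 'v zpoly" where
  "zvar v = Poly_Mapping.single (Poly_Mapping.single v 1) 1"

lemma poly_mapping_eq_sum_single:
  fixes P :: "'k \<Rightarrow>\<^sub>0 'c::comm_monoid_add"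
  shows "(\<Sum>m\<in>Poly_Mapping.keys P. Poly_Mapping.single m (Poly_Mapping.lookup P m)) = P"
proof (rule poly_mapping_eqI)
  fix k
  have "(\<Sum>m\<in>Poly_Mapping.keys P. (Poly_Mapping.lookup P m when m = k)) =
        (\<Sum>m\<in>Poly_Mapping.keys P. if m = k then Poly_Mapping.lookup P k else 0)"
    by (intro sum.cong) auto
  then show "Poly_Mapping.lookup (\<Sum>m\<in>Poly_Mapping.keys P. Poly_Mapping.single m (Poly_Mapping.lookup P m)) k
        = Poly_Mapping.lookup P k"
    by (simp add: lookup_sum lookup_single in_keys_iff)
qed

lemma zpoly_single_induct:
  assumes "\<And>m c. Q (Poly_Mapping.single m c)" and "\<And>P P'. Q P \<Longrightarrow> Q P' \<Longrightarrow> Q (P + P')"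
  shows "Q (P :: 'v zpoly)"
proof -
  have "Q (\<Sum>m\<in>K. Poly_Mapping.single m (Poly_Mapping.lookup P m))" if "finite K" for K
    using that
  proof (induction K rule: finite_induct)
    case empty
    then show ?case using assms(1)[of 0 0] by simp
  qed (simp add: assms)
  from this[of "Poly_Mapping.keys P"] show ?thesis
    by (simp add: poly_mapping_eq_sum_single)
qed

text \<open>A monomial is a product of variables and an integer a sum of copies of 1 or -1. Claims
  compatible with the ring operations can thus be proved without touching coefficients.\<close>

lemma zpoly_ring_induct [case_names one var uminus add mult]:
  fixes P :: "'v zpoly"
  assumes one: "Q 1" and var: "\<And>v. Q (zvar v)" and uminus: "\<And>P. Q P \<Longrightarrow> Q (- P)"
    and add: "\<And>P P'. Q P \<Longrightarrow> Q P' \<Longrightarrow> Q (P + P')" and mult: "\<And>P P'. Q P \<Longrightarrow> Q P' \<Longrightarrow> Q (P * P')"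
  shows "Q P"
proof (induction P rule: zpoly_single_induct)
  case (1 m c)
  have zero: "Q 0" using add[OF one uminus[OF one]] by simp
  have nat: "Q (of_nat k)" for k by (induction k) (auto simp: zero one add)
  have int: "Q (of_int k)" for k by (cases k) (auto simp: nat intro!: uminus simp del: of_nat_Suc)
  have pow: "Q (zvar v ^ k)" for v k by (induction k) (auto simp: one var mult)
  have single_pow: "zvar v ^ k = Poly_Mapping.single (Poly_Mapping.single v k) 1" for v :: 'v and k
    by (induction k) (auto simp: zvar_def mult_single simp flip: single_add)
  have mon: "Q (Poly_Mapping.single m 1)" for m :: "'v \<Rightarrow>\<^sub>0 nat"
  proof -
    have "Q (Poly_Mapping.single (\<Sum>v\<in>K. Poly_Mapping.single v (Poly_Mapping.lookup m v)) 1)"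
      if "finite K" for K using that
    proof (induction K rule: finite_induct)
      case empty
      then show ?case using one by simp
    next
      case (insert v K)
      show ?case using mult[OF pow[of v "Poly_Mapping.lookup m v"] insert.IH] insert.hyps
        by (simp add: single_pow mult_single)
    qed
    from this[of "Poly_Mapping.keys m"] show ?thesis
      by (simp add: poly_mapping_eq_sum_single)
  qed
  have "Poly_Mapping.single m c = of_int c * Poly_Mapping.single m 1"
    by (simp add: single_of_int[symmetric] mult_single)
  then show ?case using mult[OF int mon] by simp
qed (rule add)

lemma lookup_of_nat_mult: "Poly_Mapping.lookup (of_nat k * P) m = of_nat k * Poly_Mapping.lookup (P :: 'v zpoly) m"
  by (induction k) (auto simp: lookup_add distrib_right)

lemma zpoly_torsion_free:
  assumes "p > 0" "of_nat p * (P :: 'v zpoly) = 0"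
  shows "P = 0"
  using assms lookup_of_nat_mult[of p P] by (auto intro!: poly_mapping_eqI)

definition zeval :: "('a, 'm) ring_scheme \<Rightarrow> ('v \<Rightarrow> 'a) \<Rightarrow> 'v zpoly \<Rightarrow> 'a" where
  "zeval A f P =
     (\<Oplus>\<^bsub>A\<^esub>m\<in>Poly_Mapping.keys P. add_pow A (Poly_Mapping.lookup P m)
        (\<Otimes>\<^bsub>A\<^esub>v\<in>Poly_Mapping.keys m. f v [^]\<^bsub>A\<^esub> Poly_Mapping.lookup m v))"

lemma eval_witt_poly_eq_zeval: "eval_witt_poly A f P = zeval A f P"
  by (simp add: eval_witt_poly_def zeval_def)

context cring begin

lemma add_pow_int_0: "add_pow R (0::int) x = \<zero>"
  by (simp add: add_pow_def)

lemma add_pow_int_1: "x \<in> carrier R \<Longrightarrow> add_pow R (1::int) x = x"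
  by (rule add.int_pow_1)

definition zmon :: "('v \<Rightarrow> 'a) \<Rightarrow> ('v \<Rightarrow>\<^sub>0 nat) \<Rightarrow> 'a" where
  "zmon f m = (\<Otimes>v\<in>Poly_Mapping.keys m. f v [^] Poly_Mapping.lookup m v)"

context
  fixes f :: "'v \<Rightarrow> 'a"
  assumes f: "\<And>v. f v \<in> carrier R"
begin

lemma zmon_closed [simp]: "zmon f m \<in> carrier R"
  unfolding zmon_def by (intro finprod_closed) (auto simp: f)

lemma zmon_superset:
  assumes "finite K" "Poly_Mapping.keys m \<subseteq> K"
  shows "zmon f m = (\<Otimes>v\<in>K. f v [^] Poly_Mapping.lookup m v)"
  unfolding zmon_def using assms
  by (intro finprod_mono_neutral_cong_left) (auto simp: f in_keys_iff)

lemma zmon_add: "zmon f (m + m') = zmon f m \<otimes> zmon f m'"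
proof -
  let ?K = "Poly_Mapping.keys m \<union> Poly_Mapping.keys m'"
  have "zmon f (m + m') = (\<Otimes>v\<in>?K. f v [^] Poly_Mapping.lookup (m + m') v)"
    by (rule zmon_superset) (auto simp: keys_add)
  also have "\<dots> = (\<Otimes>v\<in>?K. f v [^] Poly_Mapping.lookup m v \<otimes> f v [^] Poly_Mapping.lookup m' v)"
    by (simp add: lookup_add nat_pow_mult f)
  also have "\<dots> = zmon f m \<otimes> zmon f m'"
    by (simp add: zmon_superset[of ?K] f finprod_multf)
  finally show ?thesis .
qed

lemma zeval_eq: "zeval R f P = (\<Oplus>m\<in>Poly_Mapping.keys P. add_pow R (Poly_Mapping.lookup P m) (zmon f m))"
  by (simp add: zeval_def zmon_def)

lemma zeval_closed [simp]: "zeval R f P \<in> carrier R"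
  unfolding zeval_eq by (intro finsum_closed) auto

lemma zeval_superset:
  assumes "finite K" "Poly_Mapping.keys P \<subseteq> K"
  shows "zeval R f P = (\<Oplus>m\<in>K. add_pow R (Poly_Mapping.lookup P m) (zmon f m))"
  unfolding zeval_eq using assms
  by (intro add.finprod_mono_neutral_cong_left) (auto simp: in_keys_iff add_pow_int_0)

lemma zeval_add: "zeval R f (P + Q) = zeval R f P \<oplus> zeval R f Q"
proof -
  let ?K = "Poly_Mapping.keys P \<union> Poly_Mapping.keys Q"
  have "zeval R f (P + Q) = (\<Oplus>m\<in>?K. add_pow R (Poly_Mapping.lookup (P + Q) m) (zmon f m))"
    by (rule zeval_superset) (auto simp: keys_add)
  also have "\<dots> = (\<Oplus>m\<in>?K. add_pow R (Poly_Mapping.lookup P m) (zmon f m)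
                         \<oplus> add_pow R (Poly_Mapping.lookup Q m) (zmon f m))"
    by (simp add: lookup_add add.int_pow_mult)
  also have "\<dots> = zeval R f P \<oplus> zeval R f Q"
    by (simp add: zeval_superset[of ?K] finsum_addf)
  finally show ?thesis .
qed

lemma zeval_single: "zeval R f (Poly_Mapping.single m c) = add_pow R c (zmon f m)"
  by (simp add: zeval_superset[of "{m}"])

lemma zeval_mult: "zeval R f (P * Q) = zeval R f P \<otimes> zeval R f Q"
proof (induction P rule: zpoly_single_induct)
  case (1 m c)
  show ?case
  proof (induction Q rule: zpoly_single_induct)
    case (1 m' c')
    have "add_pow R c (zmon f m) \<otimes> add_pow R c' (zmon f m') = add_pow R c' (add_pow R c (zmon f m \<otimes> zmon f m'))"
      by (simp add: add_pow_rdistr_int add_pow_ldistr_int)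
    also have "\<dots> = add_pow R (c * c') (zmon f m \<otimes> zmon f m')"
      by (simp add: add.int_pow_pow)
    finally show ?case by (simp add: mult_single zeval_single zmon_add)
  qed (simp add: distrib_left zeval_add r_distr)
qed (simp add: distrib_right zeval_add l_distr)

lemma zeval_zero: "zeval R f 0 = \<zero>" by (simp add: zeval_eq)

lemma zeval_one: "zeval R f 1 = \<one>"
proof -
  have "zeval R f (Poly_Mapping.single 0 1) = add_pow R (1::int) (zmon f 0)" by (rule zeval_single)
  then show ?thesis by (simp add: zmon_def add_pow_int_1)
qed

lemma zeval_var: "zeval R f (zvar v) = f v"
  by (simp add: zvar_def zeval_single zmon_def f add_pow_int_1)

lemma zeval_uminus: "zeval R f (- P) = \<ominus> zeval R f P"
  using zeval_add[of "-P" P] by (simp add: zeval_zero minus_equality)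

lemma zeval_diff: "zeval R f (P - Q) = zeval R f P \<ominus> zeval R f Q"
  using zeval_add[of P "-Q"] by (simp add: zeval_uminus minus_eq)

lemma zeval_power: "zeval R f (P ^ k) = zeval R f P [^] k"
  by (induction k) (auto simp: zeval_one zeval_mult m_comm)

lemma zeval_of_nat_mult: "zeval R f (of_nat k * P) = add_pow R k (zeval R f P)"
  by (induction k) (auto simp: zeval_zero zeval_add distrib_right a_comm)

end

text \<open>Universal property of the polynomial ring. It serves to move \<open>reduction\<close>
  past the evaluation of a Witt polynomial.\<close>

lemma zeval_unique:
  assumes f: "\<And>v. f v \<in> carrier R" and h: "\<And>P. h P \<in> carrier R"
    and hom: "h 1 = \<one>" "\<And>P Q. h (P + Q) = h P \<oplus> h Q" "\<And>P Q. h (P * Q) = h P \<otimes> h Q"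
    and var: "\<And>v. h (zvar v) = f v"
  shows "h P = zeval R f P"
proof (induction P rule: zpoly_ring_induct)
  case (uminus P)
  have "h 0 \<oplus> h 0 = h 0" using hom(2)[of 0 0] by simp
  then have "h 0 = \<zero>" using h add.r_cancel_one by blast
  then have "h (- P) \<oplus> h P = \<zero>" using hom(2)[of "-P" P] by simp
  then show ?case using h uminus by (simp add: zeval_uminus f minus_equality)
qed (auto simp: hom var zeval_one zeval_add zeval_mult zeval_var f)

end

subsection \<open>Frobenius lifts and the Witt polynomials\<close>

text \<open>A type of class \<open>comm_ring_1\<close> as a ring record, so that
  \<open>zeval\<close> can also substitute polynomials into polynomials.\<close>

definition type_ring :: "'r::comm_ring_1 ring" where
  "type_ring = \<lparr>carrier = UNIV, mult = (*), one = 1, ring.zero = 0, add = (+)\<rparr>"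

lemma type_ring_simps [simp]:
  "carrier type_ring = UNIV" "x \<otimes>\<^bsub>type_ring\<^esub> y = x * y" "\<one>\<^bsub>type_ring\<^esub> = 1"
  "x \<oplus>\<^bsub>type_ring\<^esub> y = x + y" "\<zero>\<^bsub>type_ring\<^esub> = 0"
  by (simp_all add: type_ring_def)

lemma cring_type_ring: "cring (type_ring :: 'r::comm_ring_1 ring)"
proof (rule cringI)
  show "abelian_group (type_ring :: 'r ring)"
  proof (rule abelian_groupI)
    fix x :: 'r
    show "\<exists>y\<in>carrier type_ring. y \<oplus>\<^bsub>type_ring\<^esub> x = \<zero>\<^bsub>type_ring\<^esub>"
      by (auto intro: exI[of _ "- x"])
  qed (auto simp: algebra_simps)
  show "Group.comm_monoid (type_ring :: 'r ring)"
    by (rule comm_monoidI) (auto simp: algebra_simps)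
qed (auto simp: algebra_simps)

interpretation type_ring: cring "type_ring :: 'r::comm_ring_1 ring"
  by (rule cring_type_ring)

lemma zeval_type_ring:
  fixes f :: "'v \<Rightarrow> 'r::comm_ring_1"
  shows "zeval type_ring f (P + Q) = zeval type_ring f P + zeval type_ring f Q"
    "zeval type_ring f (P * Q) = zeval type_ring f P * zeval type_ring f Q"
    "zeval type_ring f 1 = 1" "zeval type_ring f (zvar v) = f v"
  using type_ring.zeval_add[of f] type_ring.zeval_mult[of f] type_ring.zeval_one[of f]
    type_ring.zeval_var[of f]
  by auto

lemma ghost_component_hom:
  fixes h :: "'r::comm_ring_1 \<Rightarrow> 's::comm_ring_1"
  assumes hom: "\<And>x y. h (x + y) = h x + h y" "\<And>x y. h (x * y) = h x * h y" "h 1 = 1"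
  shows "h (ghost_component p S n) = ghost_component p (\<lambda>i. h (S i)) n"
proof -
  have z: "h 0 = 0" using hom(1)[of 0 0] by simp
  have pow: "h (x ^ k) = h x ^ k" for x k by (induction k) (auto simp: hom)
  have nat: "h (of_nat k) = of_nat k" for k by (induction k) (auto simp: hom z)
  have sum: "h (sum f I) = (\<Sum>i\<in>I. h (f i))" for f :: "nat \<Rightarrow> 'r" and I
    by (induction I rule: infinite_finite_induct) (auto simp: hom z)
  show ?thesis by (simp add: ghost_component_def sum hom pow nat)
qed

definition frobenius_lift :: "nat \<Rightarrow> 'v zpoly \<Rightarrow> 'v zpoly" where
  "frobenius_lift p = zeval type_ring (\<lambda>v. zvar v ^ p)"

lemma frobenius_lift_uminus: "frobenius_lift p (- P) = - frobenius_lift p P"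
proof -
  have "frobenius_lift p P + frobenius_lift p (- P) = frobenius_lift p 0"
    unfolding frobenius_lift_def zeval_type_ring(1)[symmetric] by simp
  also have "\<dots> = 0" using type_ring.zeval_zero[of "\<lambda>v. zvar v ^ p"] by (simp add: frobenius_lift_def)
  finally show ?thesis by (simp add: add_eq_0_iff)
qed

text \<open>On variables the congruence is an equality. It passes through the ring operations
  because \<open>p\<close>-th powers are additive modulo \<open>p\<close>.\<close>

lemma frobenius_lift_cong:
  fixes P :: "'v zpoly"
  assumes p: "Factorial_Ring.prime p"
  shows "of_nat p dvd frobenius_lift p P - P ^ p"
proof (induction P rule: zpoly_ring_induct)
  case (uminus P)
  have z: "(0 :: 'v zpoly) ^ p = 0" using p by (simp add: prime_gt_0_nat power_0_left)
  \<comment> \<open>Additivity modulo \<open>p\<close> applied to \<open>P + (- P) = 0\<close>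
    handles the sign uniformly, including \<open>p = 2\<close>.\<close>
  have "of_nat p dvd - (P ^ p + (- P) ^ p)"
    using prime_dvd_power_add[OF p, of P "- P"] z by simp
  then have "of_nat p dvd (P ^ p + (- P) ^ p)" by (simp only: dvd_minus_iff)
  then have "of_nat p dvd - (frobenius_lift p P - P ^ p) - (P ^ p + (- P) ^ p)"
    using uminus by (intro dvd_diff) (simp_all only: dvd_minus_iff)
  then show ?case by (simp add: frobenius_lift_uminus)
next
  case (add P Q)
  have "of_nat p dvd (frobenius_lift p P - P ^ p) + (frobenius_lift p Q - Q ^ p)
     - ((P + Q) ^ p - (P ^ p + Q ^ p))"
    by (rule dvd_diff[OF dvd_add[OF add] prime_dvd_power_add[OF p]])
  also have "\<dots> = frobenius_lift p (P + Q) - (P + Q) ^ p"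
    by (simp add: frobenius_lift_def zeval_type_ring)
  finally show ?case .
next
  case (mult P Q)
  have "of_nat p dvd (frobenius_lift p P - P ^ p) * frobenius_lift p Q + P ^ p * (frobenius_lift p Q - Q ^ p)"
    using mult by (intro dvd_add dvd_mult dvd_mult2)
  also have "\<dots> = frobenius_lift p (P * Q) - (P * Q) ^ p"
    by (simp add: frobenius_lift_def zeval_type_ring algebra_simps power_mult_distrib)
  finally show ?case .
qed (simp_all add: frobenius_lift_def zeval_type_ring)

text \<open>The divisibility condition of \<open>dwork_criterion\<close> for
  \<open>frobenius_lift\<close>. Such sequences are closed under the ring operations, so sums,
  products and negatives of ghost sequences are ghost sequences again.\<close>

definition dwork_seq :: "nat \<Rightarrow> (nat \<Rightarrow> 'v zpoly) \<Rightarrow> bool" where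
  "dwork_seq p t \<longleftrightarrow> (\<forall>n. of_nat p ^ Suc n dvd t (Suc n) - frobenius_lift p (t n))"

lemma dwork_seq_obtain:
  assumes "Factorial_Ring.prime p" "dwork_seq p t"
  obtains S where "\<And>n. ghost_component p S n = t n"
proof -
  have "\<exists>S. \<forall>n. ghost_component p S n = t n"
  by (rule dwork_criterion[of "frobenius_lift p"])
      (use assms(2) frobenius_lift_cong[OF assms(1)] in
        \<open>auto simp: dwork_seq_def frobenius_lift_def zeval_type_ring\<close>)
  then show ?thesis using that by blast
qed

lemma dwork_seq_add: "dwork_seq p s \<Longrightarrow> dwork_seq p t \<Longrightarrow> dwork_seq p (\<lambda>n. s n + t n)"
  unfolding dwork_seq_def frobenius_lift_def zeval_type_ring(1) add_diff_add
  by (blast intro: dvd_add)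

lemma dwork_seq_uminus:
  assumes "dwork_seq p s"
  shows "dwork_seq p (\<lambda>n. - s n)"
proof -
  have "of_nat p ^ Suc n dvd - (s (Suc n) - frobenius_lift p (s n))" for n
    using assms by (simp only: dvd_minus_iff dwork_seq_def)
  then show ?thesis by (simp add: dwork_seq_def frobenius_lift_uminus)
qed

lemma dwork_seq_mult:
  assumes "dwork_seq p s" "dwork_seq p t"
  shows "dwork_seq p (\<lambda>n. s n * t n)"
  unfolding dwork_seq_def
proof
  fix n
  have "of_nat p ^ Suc n dvd (s (Suc n) - frobenius_lift p (s n)) * t (Suc n)
     + frobenius_lift p (s n) * (t (Suc n) - frobenius_lift p (t n))"
    using assms unfolding dwork_seq_def by (intro dvd_add dvd_mult dvd_mult2) auto
  also have "\<dots> = s (Suc n) * t (Suc n) - frobenius_lift p (s n * t n)"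
    by (simp add: frobenius_lift_def zeval_type_ring algebra_simps)
  finally show "of_nat p ^ Suc n dvd s (Suc n) * t (Suc n) - frobenius_lift p (s n * t n)" .
qed

text \<open>Applying the Frobenius lift to ghost component \<open>n\<close> gives ghost component
  \<open>Suc n\<close> without its last summand, which is divisible by
  \<open>p ^ Suc n\<close>.\<close>

lemma dwork_seq_ghost_component:
  assumes "\<And>i. frobenius_lift p (Y i) = Y i ^ p"
  shows "dwork_seq p (ghost_component p Y)"
  unfolding dwork_seq_def
proof
  fix n
  have "frobenius_lift p (ghost_component p Y n) = ghost_component p (\<lambda>i. frobenius_lift p (Y i)) n"
    by (rule ghost_component_hom) (auto simp: frobenius_lift_def zeval_type_ring)
  also have "\<dots> = (\<Sum>i<Suc n. of_nat p ^ i * Y i ^ (p ^ (Suc n - i)))"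
    unfolding ghost_component_def lessThan_Suc_atMost
    by (intro sum.cong) (auto simp: assms Suc_diff_le power_mult[symmetric])
  finally show "of_nat p ^ Suc n dvd ghost_component p Y (Suc n) - frobenius_lift p (ghost_component p Y n)"
    by (simp add: ghost_component_lessThan[of p Y "Suc n"])
qed

lemma ghost_eq_ghost_component: "ghost p S n = ghost_component p S n"
  by (simp add: ghost_def ghost_component_def)

text \<open>Dwork's criterion gives existence and torsion-freeness of the polynomial ring gives
  uniqueness, so the definite description denotes the intended family.\<close>

lemma the_witt_poly:
  assumes p: "Factorial_Ring.prime p" and t: "dwork_seq p t"
  shows "ghost p (THE S. \<forall>n. ghost p S n = t n) n = t n"
proof -
  obtain S where S: "\<And>n. ghost_component p S n = t n" using dwork_seq_obtain[OF p t] by blast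
  have "\<exists>!S. \<forall>n. ghost p S n = t n"
  proof (rule ex1I[of _ S])
    show "\<forall>n. ghost p S n = t n" by (simp add: ghost_eq_ghost_component S)
    fix S' assume "\<forall>n. ghost p S' n = t n"
    then show "S' = S"
      by (intro ghost_component_inj[of p])
        (auto simp: ghost_eq_ghost_component S intro: zpoly_torsion_free[OF prime_gt_0_nat[OF p]])
  qed
  from theI'[OF this] show ?thesis by blast
qed

lemma witt_var_eq_zvar: "witt_var v = zvar v"
  by (simp add: witt_var_def zvar_def)

lemma dwork_seq_witt_var: "dwork_seq p (ghost p (\<lambda>i. witt_var (f i)))"
proof -
  have "ghost p (\<lambda>i. witt_var (f i)) = ghost_component p (\<lambda>i. zvar (f i))"
    by (auto simp: ghost_eq_ghost_component witt_var_eq_zvar fun_eq_iff)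
  then show ?thesis
    using dwork_seq_ghost_component[of p "\<lambda>i. zvar (f i)"]
    by (simp add: frobenius_lift_def zeval_type_ring)
qed

lemma ghost_witt_add_poly:
  assumes "Factorial_Ring.prime p"
  shows "ghost p (witt_add_poly p) n =
    ghost p (\<lambda>i. witt_var (Inl i)) n + ghost p (\<lambda>i. witt_var (Inr i)) n"
  unfolding witt_add_poly_def
  by (rule the_witt_poly[OF assms]) (intro dwork_seq_add dwork_seq_witt_var)

lemma ghost_witt_mult_poly:
  assumes "Factorial_Ring.prime p"
  shows "ghost p (witt_mult_poly p) n =
    ghost p (\<lambda>i. witt_var (Inl i)) n * ghost p (\<lambda>i. witt_var (Inr i)) n"
  unfolding witt_mult_poly_def
  by (rule the_witt_poly[OF assms]) (intro dwork_seq_mult dwork_seq_witt_var)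

subsection \<open>The ring of Witt vectors over a ring of characteristic \<open>p\<close>\<close>

locale char_p_ring = cring B for B :: "('a, 'm) ring_scheme" (structure) +
  fixes p :: nat
  assumes p_prime: "Factorial_Ring.prime p"
    and char_p: "add_pow B p \<one> = \<zero>"
begin

abbreviation W :: "(nat \<Rightarrow> 'a) ring" where "W \<equiv> witt_ring p B"

text \<open>Variables indexed outside the carrier go to zero, so that the evaluation is a
  homomorphism on all polynomials.\<close>

definition reduction :: "'a zpoly \<Rightarrow> 'a" where
  "reduction = zeval B (\<lambda>v. if v \<in> carrier B then v else \<zero>)"

text \<open>Zero is lifted to the zero polynomial and not to a variable. Vanishing components then
  vanish upstairs as well, on which \<open>W_add_disjoint\<close> relies.\<close>

definition lift :: "'a \<Rightarrow> 'a zpoly" where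
  "lift x = (if x = \<zero> then 0 else zvar x)"

lemma p_pos [simp]: "p > 0" using p_prime by (rule prime_gt_0_nat)

lemma p_nonzero [simp]: "p \<noteq> 0" using p_pos by simp

lemma reduction_hom:
  "reduction P \<in> carrier B" "reduction (P + Q) = reduction P \<oplus> reduction Q"
  "reduction (P * Q) = reduction P \<otimes> reduction Q" "reduction 1 = \<one>" "reduction 0 = \<zero>"
  "reduction (P ^ k) = reduction P [^] k" "reduction (P - Q) = reduction P \<ominus> reduction Q"
  unfolding reduction_def
  by (simp_all add: zeval_add zeval_mult zeval_one zeval_zero zeval_power zeval_diff)

lemma reduction_lift: "x \<in> carrier B \<Longrightarrow> reduction (lift x) = x"
  by (simp add: lift_def reduction_def zeval_var zeval_zero)

lemma add_pow_p: "x \<in> carrier B \<Longrightarrow> add_pow B p x = \<zero>"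
  using add_pow_ldistr[of \<one> x p] char_p by simp

lemma reduction_cong:
  assumes "of_nat p dvd P - Q"
  shows "reduction P = reduction Q"
proof -
  obtain D where "P - Q = of_nat p * D" using assms by (elim dvdE)
  then have "reduction P \<ominus> reduction Q = add_pow B p (reduction D)"
    unfolding reduction_hom(7)[symmetric] by (simp add: reduction_def zeval_of_nat_mult)
  then show ?thesis by (simp add: add_pow_p reduction_hom)
qed

text \<open>The binomial computation takes place among polynomials, and \<open>reduction\<close>
  kills multiples of \<open>p\<close>.\<close>

lemma frobenius_add:
  assumes "x \<in> carrier B" "y \<in> carrier B"
  shows "(x \<oplus> y) [^] p = x [^] p \<oplus> y [^] p"
  using reduction_cong[OF prime_dvd_power_add[OF p_prime, of "lift x" "lift y"]] assms
  by (simp add: reduction_hom reduction_lift)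

text \<open>\<open>g\<close> is the sequence of ghost components of some lift of \<open>a\<close> to Witt vectors over
  \<open>\<int>[X\<^sub>b | b \<in> B]\<close>. By \<open>has_ghost_eq\<close> below, identities in \<^const>\<open>witt_ring\<close> reduce to
  congruences between such sequences.\<close>

definition has_ghost :: "(nat \<Rightarrow> 'a) \<Rightarrow> (nat \<Rightarrow> 'a zpoly) \<Rightarrow> bool" where
  "has_ghost a g \<longleftrightarrow> (\<exists>U. (\<forall>n. a n = reduction (U n)) \<and> (\<forall>n. g n = ghost_component p U n))"

lemma has_ghostI: "(\<And>n. a n = reduction (U n)) \<Longrightarrow> (\<And>n. g n = ghost_component p U n) \<Longrightarrow> has_ghost a g"
  unfolding has_ghost_def by blast

lemma has_ghost_eq:
  assumes "has_ghost a g" "has_ghost b g'" "\<And>n. of_nat p ^ Suc n dvd g n - g' n"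
  shows "a = b"
proof
  fix n
  obtain U where U: "\<And>n. a n = reduction (U n)" "\<And>n. g n = ghost_component p U n"
    using assms(1) unfolding has_ghost_def by blast
  obtain V where V: "\<And>n. b n = reduction (V n)" "\<And>n. g' n = ghost_component p V n"
    using assms(2) unfolding has_ghost_def by blast
  have "of_nat p dvd U n - V n"
    by (rule components_cong_of_ghost_cong)
      (use assms(3) in \<open>auto simp: U V intro: zpoly_torsion_free[OF p_pos]\<close>)
  then show "a n = b n" unfolding U V by (rule reduction_cong)
qed

lemma has_ghost_unique: "has_ghost a g \<Longrightarrow> has_ghost b g' \<Longrightarrow> (\<And>n. g n = g' n) \<Longrightarrow> a = b"
  by (erule (1) has_ghost_eq) simp

lemma W_simps:
  "carrier W = {a. \<forall>n. a n \<in> carrier B}" "\<one>\<^bsub>W\<^esub> = teichmuller B \<one>" "\<zero>\<^bsub>W\<^esub> = (\<lambda>_. \<zero>)"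
  by (simp_all add: witt_ring_def)

text \<open>Both sides are ring homomorphisms in \<open>P\<close> with the same values on
  variables.\<close>

lemma eval_witt_poly_reduction:
  "eval_witt_poly B (case_sum (\<lambda>n. reduction (U n)) (\<lambda>n. reduction (V n))) P =
   reduction (zeval type_ring (case_sum U V) P)"
  unfolding eval_witt_poly_eq_zeval
  by (rule zeval_unique[symmetric, of _ "\<lambda>P. reduction (zeval type_ring (case_sum U V) P)"])
    (auto simp: zeval_type_ring reduction_hom split: sum.splits)

lemma zeval_ghost_witt_var:
  "zeval type_ring f (ghost p (\<lambda>i. witt_var (v i)) n) = ghost_component p (\<lambda>i. f (v i)) n"
proof -
  have "zeval type_ring f (ghost_component p (\<lambda>i. zvar (v i)) n) =
        ghost_component p (\<lambda>i. zeval type_ring f (zvar (v i))) n"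
    by (rule ghost_component_hom) (auto simp: zeval_type_ring)
  then show ?thesis
    by (simp add: ghost_eq_ghost_component witt_var_eq_zvar zeval_type_ring)
qed

text \<open>Treats sum and product at once: \<open>F\<close> is the operation on Witt polynomials
  and \<open>F'\<close> the same operation on ghost sequences. Evaluating the defining identity of
  \<open>S\<close> at the lifts \<open>U\<close> and \<open>V\<close> gives the claim.\<close>

lemma has_ghost_witt_poly:
  assumes "has_ghost a g" "has_ghost b h"
    and gh: "\<And>n. ghost p S n = F (ghost p (\<lambda>i. witt_var (Inl i)) n) (ghost p (\<lambda>i. witt_var (Inr i)) n)"
    and F: "\<And>f P Q. zeval type_ring f (F P Q) = F' (zeval type_ring f P) (zeval type_ring f Q)"
  shows "has_ghost (\<lambda>n. eval_witt_poly B (case_sum a b) (S n)) (\<lambda>n. F' (g n) (h n))"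
proof -
  obtain U where U: "a = (\<lambda>n. reduction (U n))" "\<And>n. g n = ghost_component p U n"
    using assms(1) unfolding has_ghost_def by blast
  obtain V where V: "b = (\<lambda>n. reduction (V n))" "\<And>n. h n = ghost_component p V n"
    using assms(2) unfolding has_ghost_def by blast
  show ?thesis
  proof (rule has_ghostI)
    fix n
    show "eval_witt_poly B (case_sum a b) (S n) = reduction (zeval type_ring (case_sum U V) (S n))"
      unfolding U V by (rule eval_witt_poly_reduction)
    have "ghost_component p (\<lambda>n. zeval type_ring (case_sum U V) (S n)) n =
          zeval type_ring (case_sum U V) (ghost p S n)"
      unfolding ghost_eq_ghost_component
      by (rule ghost_component_hom[symmetric]) (auto simp: zeval_type_ring)
    then show "F' (g n) (h n) = ghost_component p (\<lambda>n. zeval type_ring (case_sum U V) (S n)) n"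
      by (simp add: gh F zeval_ghost_witt_var U V)
  qed
qed

lemma has_ghost_add:
  assumes "has_ghost a g" "has_ghost b h"
  shows "has_ghost (a \<oplus>\<^bsub>W\<^esub> b) (\<lambda>n. g n + h n)"
  using has_ghost_witt_poly[OF assms ghost_witt_add_poly[OF p_prime], of "(+)"]
  by (simp add: zeval_type_ring witt_ring_def)

lemma has_ghost_mult:
  assumes "has_ghost a g" "has_ghost b h"
  shows "has_ghost (a \<otimes>\<^bsub>W\<^esub> b) (\<lambda>n. g n * h n)"
  using has_ghost_witt_poly[OF assms ghost_witt_mult_poly[OF p_prime], of "(*)"]
  by (simp add: zeval_type_ring witt_ring_def)

lemma has_ghost_lift:
  assumes "a \<in> carrier W"
  shows "has_ghost a (ghost_component p (\<lambda>n. lift (a n)))"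
  using assms by (intro has_ghostI) (auto simp: W_simps reduction_lift)

lemma has_ghost_zero: "has_ghost \<zero>\<^bsub>W\<^esub> (\<lambda>_. 0)"
  by (rule has_ghostI[of _ "\<lambda>_. 0"]) (auto simp: W_simps reduction_hom ghost_component_def power_0_left)

lemma ghost_component_concentrated:
  "ghost_component p (\<lambda>n. if n = 0 then x else 0) n = x ^ (p ^ n)"
proof -
  have "ghost_component p (\<lambda>n. if n = 0 then x else 0) n =
        (\<Sum>i\<le>n. if i = 0 then x ^ (p ^ n) else 0)"
    unfolding ghost_component_def by (intro sum.cong) (auto simp: power_0_left)
  then show ?thesis by simp
qed

lemma has_ghost_teichmuller:
  "x \<in> carrier B \<Longrightarrow> has_ghost (teichmuller B x) (\<lambda>n. lift x ^ (p ^ n))"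
  by (rule has_ghostI[of _ "\<lambda>n. if n = 0 then lift x else 0"])
    (auto simp: teichmuller_def reduction_hom reduction_lift ghost_component_concentrated)

lemma has_ghost_one: "has_ghost \<one>\<^bsub>W\<^esub> (\<lambda>_. 1)"
  by (rule has_ghostI[of _ "\<lambda>n. if n = 0 then 1 else 0"])
    (auto simp: W_simps teichmuller_def reduction_hom ghost_component_concentrated)

lemma has_ghost_closed: "has_ghost a g \<Longrightarrow> a \<in> carrier W"
  by (auto simp: has_ghost_def W_simps reduction_hom)

lemma has_ghost_exists:
  assumes "a \<in> carrier W"
  obtains g where "has_ghost a g"
  using has_ghost_lift[OF assms] by blast

text \<open>\<open>witt_ring\<close> records no negation polynomials, so the negative is built from
  Dwork's criterion. It applies because each lifted component is a variable or 0, and the Frobenius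
  lift raises it to its \<open>p\<close>-th power.\<close>

lemma witt_neg_exists:
  assumes "a \<in> carrier W"
  shows "\<exists>b\<in>carrier W. b \<oplus>\<^bsub>W\<^esub> a = \<zero>\<^bsub>W\<^esub>"
proof -
  let ?g = "ghost_component p (\<lambda>n. lift (a n))"
  have "dwork_seq p ?g"
    using type_ring.zeval_zero[of "\<lambda>v. zvar v ^ p"]
    by (intro dwork_seq_ghost_component)
      (auto simp: lift_def frobenius_lift_def zeval_type_ring power_0_left)
  then obtain S where S: "\<And>n. ghost_component p S n = - ?g n"
    using dwork_seq_obtain[OF p_prime dwork_seq_uminus] by blast
  have b: "has_ghost (\<lambda>n. reduction (S n)) (\<lambda>n. - ?g n)"
    by (rule has_ghostI[of _ S]) (auto simp: S)
  have "(\<lambda>n. reduction (S n)) \<oplus>\<^bsub>W\<^esub> a = \<zero>\<^bsub>W\<^esub>"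
    by (rule has_ghost_unique[OF has_ghost_add[OF b has_ghost_lift[OF assms]] has_ghost_zero]) simp
  then show ?thesis using has_ghost_closed[OF b] by blast
qed

text \<open>Each axiom is the same axiom for polynomials, applied to every entry of the ghost
  sequences.\<close>

lemma cring_W: "cring W"
proof (rule cringI)
  show "abelian_group W"
  proof (rule abelian_groupI)
    fix a b assume "a \<in> carrier W" "b \<in> carrier W"
    then obtain g h where gh: "has_ghost a g" "has_ghost b h" by (metis has_ghost_exists)
    show "a \<oplus>\<^bsub>W\<^esub> b \<in> carrier W" by (rule has_ghost_closed[OF has_ghost_add[OF gh]])
    show "a \<oplus>\<^bsub>W\<^esub> b = b \<oplus>\<^bsub>W\<^esub> a"
      by (rule has_ghost_unique[OF has_ghost_add[OF gh] has_ghost_add[OF gh(2,1)]]) simp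
    fix c assume "c \<in> carrier W"
    then obtain k where k: "has_ghost c k" by (metis has_ghost_exists)
    show "a \<oplus>\<^bsub>W\<^esub> b \<oplus>\<^bsub>W\<^esub> c = a \<oplus>\<^bsub>W\<^esub> (b \<oplus>\<^bsub>W\<^esub> c)"
      by (rule has_ghost_unique[OF has_ghost_add[OF has_ghost_add[OF gh] k]
            has_ghost_add[OF gh(1) has_ghost_add[OF gh(2) k]]]) simp
  next
    show "\<zero>\<^bsub>W\<^esub> \<in> carrier W" by (rule has_ghost_closed[OF has_ghost_zero])
    fix a assume a: "a \<in> carrier W"
    then obtain g where g: "has_ghost a g" by (metis has_ghost_exists)
    show "\<zero>\<^bsub>W\<^esub> \<oplus>\<^bsub>W\<^esub> a = a"
      by (rule has_ghost_unique[OF has_ghost_add[OF has_ghost_zero g] g]) simp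
    show "\<exists>b\<in>carrier W. b \<oplus>\<^bsub>W\<^esub> a = \<zero>\<^bsub>W\<^esub>" by (rule witt_neg_exists[OF a])
  qed
  show "Group.comm_monoid W"
  proof (rule comm_monoidI)
    show "\<one>\<^bsub>W\<^esub> \<in> carrier W" by (rule has_ghost_closed[OF has_ghost_one])
    fix a assume "a \<in> carrier W"
    then obtain g where g: "has_ghost a g" by (metis has_ghost_exists)
    show "\<one>\<^bsub>W\<^esub> \<otimes>\<^bsub>W\<^esub> a = a"
      by (rule has_ghost_unique[OF has_ghost_mult[OF has_ghost_one g] g]) simp
    fix b assume "b \<in> carrier W"
    then obtain h where h: "has_ghost b h" by (metis has_ghost_exists)
    show "a \<otimes>\<^bsub>W\<^esub> b \<in> carrier W" by (rule has_ghost_closed[OF has_ghost_mult[OF g h]])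
    show "a \<otimes>\<^bsub>W\<^esub> b = b \<otimes>\<^bsub>W\<^esub> a"
      by (rule has_ghost_unique[OF has_ghost_mult[OF g h] has_ghost_mult[OF h g]]) simp
    fix c assume "c \<in> carrier W"
    then obtain k where k: "has_ghost c k" by (metis has_ghost_exists)
    show "a \<otimes>\<^bsub>W\<^esub> b \<otimes>\<^bsub>W\<^esub> c = a \<otimes>\<^bsub>W\<^esub> (b \<otimes>\<^bsub>W\<^esub> c)"
      by (rule has_ghost_unique[OF has_ghost_mult[OF has_ghost_mult[OF g h] k]
            has_ghost_mult[OF g has_ghost_mult[OF h k]]]) simp
  qed
  fix a b c assume "a \<in> carrier W" "b \<in> carrier W" "c \<in> carrier W"
  then obtain g h k where gh: "has_ghost a g" "has_ghost b h" "has_ghost c k" by (metis has_ghost_exists)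
  show "(a \<oplus>\<^bsub>W\<^esub> b) \<otimes>\<^bsub>W\<^esub> c = a \<otimes>\<^bsub>W\<^esub> c \<oplus>\<^bsub>W\<^esub> b \<otimes>\<^bsub>W\<^esub> c"
    by (rule has_ghost_unique[OF has_ghost_mult[OF has_ghost_add[OF gh(1,2)] gh(3)]
          has_ghost_add[OF has_ghost_mult[OF gh(1,3)] has_ghost_mult[OF gh(2,3)]]])
      (simp add: algebra_simps)
qed

sublocale W: cring W by (rule cring_W)

section \<open>Component formulas for Teichmueller products and for multiplication by
  \<open>p\<close>\<close>

lemma teichmuller_closed [simp]: "x \<in> carrier B \<Longrightarrow> teichmuller B x \<in> carrier W"
  by (simp add: W_simps teichmuller_def)

lemma W_component_closed: "a \<in> carrier W \<Longrightarrow> a n \<in> carrier B"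
  by (simp add: W_simps)

lemma has_ghost_0: "has_ghost a g \<Longrightarrow> a 0 = reduction (g 0)"
  by (auto simp: has_ghost_def ghost_component_def)

lemma W_add_0: "a \<in> carrier W \<Longrightarrow> b \<in> carrier W \<Longrightarrow> (a \<oplus>\<^bsub>W\<^esub> b) 0 = a 0 \<oplus> b 0"
  using has_ghost_0[OF has_ghost_add[OF has_ghost_lift has_ghost_lift], of a b]
    has_ghost_0[OF has_ghost_lift, of a] has_ghost_0[OF has_ghost_lift, of b]
  by (simp add: reduction_hom)

text \<open>At each index one of the two lifts is zero, so powers of their sum split and the ghost
  components add. This allows cutting a Witt vector into head and tail.\<close>

lemma W_add_disjoint:
  assumes ab: "a \<in> carrier W" "b \<in> carrier W" and disj: "\<And>n. a n = \<zero> \<or> b n = \<zero>"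
  shows "a \<oplus>\<^bsub>W\<^esub> b = (\<lambda>n. a n \<oplus> b n)"
proof (rule has_ghost_unique[OF has_ghost_add[OF has_ghost_lift[OF ab(1)] has_ghost_lift[OF ab(2)]]])
  let ?U = "\<lambda>n. lift (a n) + lift (b n)"
  show "has_ghost (\<lambda>n. a n \<oplus> b n) (ghost_component p ?U)"
    using ab by (intro has_ghostI) (auto simp: reduction_hom reduction_lift W_simps(1))
  show "ghost_component p (\<lambda>n. lift (a n)) n + ghost_component p (\<lambda>n. lift (b n)) n = ghost_component p ?U n" for n
    unfolding ghost_component_def sum.distrib[symmetric]
  proof (rule sum.cong)
    fix i
    show "of_nat p ^ i * lift (a i) ^ p ^ (n - i) + of_nat p ^ i * lift (b i) ^ p ^ (n - i)
        = of_nat p ^ i * (lift (a i) + lift (b i)) ^ p ^ (n - i)"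
      using disj[of i] by (auto simp: lift_def power_0_left)
  qed simp
qed

text \<open>\<open>x [^] (p ^ i)\<close> raised to the power \<open>p ^ (n - i)\<close> is
  \<open>x [^] (p ^ n)\<close> for every \<open>i\<close>, so this factor comes out of the whole
  n-th ghost component.\<close>

lemma teichmuller_mult_W:
  assumes x: "x \<in> carrier B" and w: "w \<in> carrier W"
  shows "teichmuller B x \<otimes>\<^bsub>W\<^esub> w = (\<lambda>n. x [^] (p ^ n) \<otimes> w n)"
proof (rule has_ghost_unique[OF has_ghost_mult[OF has_ghost_teichmuller[OF x] has_ghost_lift[OF w]]])
  let ?U = "\<lambda>n. lift x ^ (p ^ n) * lift (w n)"
  show "has_ghost (\<lambda>n. x [^] (p ^ n) \<otimes> w n) (ghost_component p ?U)"
    using assms by (intro has_ghostI) (auto simp: reduction_hom reduction_lift W_simps(1))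
  show "lift x ^ p ^ n * ghost_component p (\<lambda>n. lift (w n)) n = ghost_component p ?U n" for n
    unfolding ghost_component_def sum_distrib_left
    by (intro sum.cong) (auto simp: power_mult_distrib algebra_simps simp flip: power_mult power_add)
qed

lemma teichmuller_mult:
  assumes "x \<in> carrier B" "y \<in> carrier B"
  shows "teichmuller B (x \<otimes> y) = teichmuller B x \<otimes>\<^bsub>W\<^esub> teichmuller B y"
  by (simp add: teichmuller_mult_W[OF assms(1) teichmuller_closed[OF assms(2)]]) (simp add: assms teichmuller_def fun_eq_iff)

lemma teichmuller_pow:
  "x \<in> carrier B \<Longrightarrow> teichmuller B (x [^] (k::nat)) = teichmuller B x [^]\<^bsub>W\<^esub> k"
proof (induction k)
  case 0
  then show ?case by (simp add: W_simps(2)[symmetric])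
next
  case (Suc k)
  then show ?case using teichmuller_mult[of "x [^] k" x] by simp
qed

lemma has_ghost_add_pow:
  assumes "has_ghost a g"
  shows "has_ghost (add_pow W (k::nat) a) (\<lambda>n. of_nat k * g n)"
proof (induction k)
  case 0
  then show ?case using has_ghost_zero by simp
next
  case (Suc k)
  then show ?case using has_ghost_add[OF Suc assms] by (simp add: algebra_simps)
qed

text \<open>In characteristic \<open>p\<close>, multiplication by \<open>p\<close> is Verschiebung
  composed with Frobenius. Upstairs the two ghost sequences differ by \<open>p ^ Suc n\<close> times
  the n-th lifted component, so \<open>has_ghost_eq\<close> has to be applied with congruences
  instead of equalities.\<close>

lemma add_pow_p_W:
  assumes w: "w \<in> carrier W"
  shows "add_pow W p w = (\<lambda>n. case n of 0 \<Rightarrow> \<zero> | Suc k \<Rightarrow> w k [^] p)"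
proof (rule has_ghost_eq[OF has_ghost_add_pow[OF has_ghost_lift[OF w]]])
  let ?U = "\<lambda>n. case n of 0 \<Rightarrow> 0 | Suc k \<Rightarrow> lift (w k) ^ p"
  let ?g = "ghost_component p (\<lambda>n. lift (w n))"
  show "has_ghost (\<lambda>n. case n of 0 \<Rightarrow> \<zero> | Suc k \<Rightarrow> w k [^] p) (ghost_component p ?U)"
    using assms by (intro has_ghostI) (auto simp: reduction_hom reduction_lift W_simps(1) split: nat.splits)
  fix n
  have "ghost_component p ?U n = of_nat p * (\<Sum>i<n. of_nat p ^ i * lift (w i) ^ (p ^ (n - i)))"
  proof (cases n)
    case (Suc k)
    have "ghost_component p ?U n = (\<Sum>i\<le>k. of_nat p ^ Suc i * (lift (w i) ^ p) ^ (p ^ (k - i)))"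
      unfolding ghost_component_def Suc by (subst sum.atMost_Suc_shift) (simp add: power_0_left)
    also have "\<dots> = (\<Sum>i<n. of_nat p * (of_nat p ^ i * lift (w i) ^ (p ^ (n - i))))"
      unfolding Suc lessThan_Suc_atMost
      by (intro sum.cong) (auto simp: Suc_diff_le power_mult[symmetric] mult_ac)
    finally show ?thesis by (simp add: sum_distrib_left)
  qed (simp add: ghost_component_def)
  then have "of_nat p * ?g n - ghost_component p ?U n = of_nat p ^ Suc n * lift (w n)"
    by (simp add: ghost_component_lessThan algebra_simps)
  then show "of_nat p ^ Suc n dvd of_nat p * ?g n - ghost_component p ?U n" by simp
qed

end

subsection \<open>Isobaric polynomials\<close>

definition zweight :: "('v \<Rightarrow> nat) \<Rightarrow> ('v \<Rightarrow>\<^sub>0 nat) \<Rightarrow> nat" where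
  "zweight c m = (\<Sum>v\<in>Poly_Mapping.keys m. c v * Poly_Mapping.lookup m v)"

definition isobaric :: "('v \<Rightarrow> nat) \<Rightarrow> nat \<Rightarrow> 'v zpoly \<Rightarrow> bool" where
  "isobaric c d P \<longleftrightarrow> (\<forall>m\<in>Poly_Mapping.keys P. zweight c m = d)"

lemma zweight_add: "zweight c (m + m') = zweight c m + zweight c m'"
  unfolding zweight_def by (rule setsum_keys_plus_distrib) (auto simp: algebra_simps)

lemma isobaric_add: "isobaric c d P \<Longrightarrow> isobaric c d Q \<Longrightarrow> isobaric c d (P + Q)"
  using keys_add[of P Q] by (auto simp: isobaric_def)

lemma isobaric_diff: "isobaric c d P \<Longrightarrow> isobaric c d Q \<Longrightarrow> isobaric c d (P - Q)"
  using keys_diff[of P Q] by (auto simp: isobaric_def)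

lemma isobaric_sum: "(\<And>i. i \<in> I \<Longrightarrow> isobaric c d (f i)) \<Longrightarrow> isobaric c d (sum f I)"
  by (induction I rule: infinite_finite_induct) (auto intro: isobaric_add simp: isobaric_def[of c d 0])

lemma isobaric_mult:
  assumes "isobaric c d P" "isobaric c e Q"
  shows "isobaric c (d + e) (P * Q)"
  unfolding isobaric_def
proof
  fix m assume "m \<in> Poly_Mapping.keys (P * Q)"
  then obtain a b where "m = a + b" "a \<in> Poly_Mapping.keys P" "b \<in> Poly_Mapping.keys Q"
    using keys_mult[of P Q] by blast
  then show "zweight c m = d + e" using assms by (simp add: zweight_add isobaric_def)
qed

lemma isobaric_power: "isobaric c d P \<Longrightarrow> isobaric c (d * k) (P ^ k)"
proof (induction k)
  case 0
  then show ?case by (simp add: isobaric_def zweight_def)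
next
  case (Suc k)
  then show ?case using isobaric_mult[of c d P "d * k" "P ^ k"] by simp
qed

lemma keys_of_nat_mult: "k > 0 \<Longrightarrow> Poly_Mapping.keys (of_nat k * (P :: 'v zpoly)) = Poly_Mapping.keys P"
  by (auto simp: in_keys_iff lookup_of_nat_mult)

lemma isobaric_of_nat_power_mult_iff:
  "p > 0 \<Longrightarrow> isobaric c d (of_nat p ^ i * P) \<longleftrightarrow> isobaric c d P"
  using keys_of_nat_mult[of "p ^ i" P] by (simp add: isobaric_def)

lemma isobaric_zvar: "isobaric c (c v) (zvar v)"
  by (simp add: isobaric_def zvar_def zweight_def)

text \<open>With these weights both ghost polynomials are isobaric of weight \<open>p ^ n\<close>,
  and by induction so are all summands except \<open>p ^ n * S n\<close>. Dividing by
  \<open>p ^ n\<close> leaves the set of monomials unchanged.\<close>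

lemma isobaric_witt_add_poly:
  assumes p: "Factorial_Ring.prime p"
  shows "isobaric (case_sum (\<lambda>i. p ^ i) (\<lambda>i. p ^ i)) (p ^ n) (witt_add_poly p n)"
proof (induction n rule: less_induct)
  case (less n)
  let ?c = "case_sum (\<lambda>i. p ^ i) (\<lambda>i. p ^ i) :: nat + nat \<Rightarrow> nat"
  let ?S = "witt_add_poly p"
  have p0: "p > 0" using p by (rule prime_gt_0_nat)
  have summand: "isobaric ?c (p ^ n) (of_nat p ^ i * P ^ (p ^ (n - i)))"
    if "isobaric ?c (p ^ i) P" "i \<le> n" for i P
    using isobaric_power[OF that(1), of "p ^ (n - i)"] that(2) p0
    by (simp add: isobaric_of_nat_power_mult_iff flip: power_add)
  have var: "isobaric ?c (p ^ n) (ghost p (\<lambda>i. witt_var (v i)) n)" if "\<And>i. ?c (v i) = p ^ i" for v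
    unfolding ghost_eq_ghost_component ghost_component_def witt_var_eq_zvar
    using isobaric_zvar[of ?c "v _"] by (intro isobaric_sum summand) (auto simp: that simp del: sum.case)
  have "isobaric ?c (p ^ n) (ghost p ?S n - (\<Sum>i<n. of_nat p ^ i * ?S i ^ (p ^ (n - i))))"
    unfolding ghost_witt_add_poly[OF p]
    using less by (intro isobaric_diff isobaric_add var isobaric_sum summand) auto
  also have "ghost p ?S n - (\<Sum>i<n. of_nat p ^ i * ?S i ^ (p ^ (n - i))) = of_nat p ^ n * ?S n"
    by (simp add: ghost_eq_ghost_component ghost_component_lessThan)
  finally show ?case using p0 by (simp only: isobaric_of_nat_power_mult_iff)
qed

subsection \<open>Gauss norm estimates\<close>

lemma witt_ring_add: "(a \<oplus>\<^bsub>witt_ring p B\<^esub> b) n = zeval B (case_sum a b) (witt_add_poly p n)"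
  by (simp add: witt_ring_def eval_witt_poly_eq_zeval)

text \<open>The properties of R+ on which the Gauss norm estimates rest. The bound by 1 and the
  existence of \<open>p\<close>-th roots are established for a perfectoid pair at the end.\<close>

locale perfect_normed_ring = char_p_ring +
  fixes N :: "'a \<Rightarrow> real" and \<rho> :: real
  assumes N_nonneg: "x \<in> carrier B \<Longrightarrow> 0 \<le> N x"
    and N_eq_0: "x \<in> carrier B \<Longrightarrow> N x = 0 \<longleftrightarrow> x = \<zero>"
    and N_diff: "x \<in> carrier B \<Longrightarrow> y \<in> carrier B \<Longrightarrow> N (x \<ominus> y) \<le> max (N x) (N y)"
    and N_mult: "x \<in> carrier B \<Longrightarrow> y \<in> carrier B \<Longrightarrow> N (x \<otimes> y) \<le> N x * N y"
    and N_pow: "x \<in> carrier B \<Longrightarrow> k > 0 \<Longrightarrow> N (x [^] (k::nat)) = N x ^ k"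
    and N_le_1: "x \<in> carrier B \<Longrightarrow> N x \<le> 1"
    and rho: "0 < \<rho>" "\<rho> < 1"
    and perfect: "x \<in> carrier B \<Longrightarrow> \<exists>y\<in>carrier B. y [^] p = x"
begin

lemma N_0 [simp]: "N \<zero> = 0" by (simp add: N_eq_0)

lemma N_neg: "x \<in> carrier B \<Longrightarrow> N (\<ominus> x) \<le> N x"
  using N_diff[of \<zero> x] N_nonneg[of x] by (simp add: minus_eq max_def split: if_splits)

lemma N_add:
  assumes "x \<in> carrier B" "y \<in> carrier B"
  shows "N (x \<oplus> y) \<le> max (N x) (N y)"
  using N_diff[of x "\<ominus> y"] N_neg[of y] assms by (auto simp: minus_eq)

lemma N_add_pow_nat: "x \<in> carrier B \<Longrightarrow> N (add_pow B (k::nat) x) \<le> N x"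
proof (induction k)
  case (Suc k)
  then show ?case using N_add[of "add_pow B k x" x] by simp
qed (simp add: N_nonneg)

lemma N_add_pow_int:
  assumes "x \<in> carrier B"
  shows "N (add_pow B (k::int) x) \<le> N x"
proof (cases "k \<ge> 0")
  case True
  then show ?thesis using N_add_pow_nat[OF assms] by (simp add: add_pow_int_ge)
next
  case False
  then show ?thesis
    using N_neg[of "add_pow B (nat (- k)) x"] N_add_pow_nat[OF assms, of "nat (- k)"] assms
    by (simp add: add_pow_int_lt)
qed

lemma N_zeval_le:
  fixes f :: "'v \<Rightarrow> 'a"
  assumes f: "\<And>v. f v \<in> carrier B" and C: "C \<ge> 0"
    and le: "\<And>m. m \<in> Poly_Mapping.keys P \<Longrightarrow> N (zmon f m) \<le> C"
  shows "N (zeval B f P) \<le> C"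
proof -
  have "N (\<Oplus>m\<in>K. add_pow B (Poly_Mapping.lookup P m) (zmon f m)) \<le> C"
    if "finite K" "K \<subseteq> Poly_Mapping.keys P" for K
    using that
  proof (induction K rule: finite_induct)
    case (insert m K)
    have "N (add_pow B (Poly_Mapping.lookup P m) (zmon f m)) \<le> C"
      using N_add_pow_int[of "zmon f m" "Poly_Mapping.lookup P m"] le[of m] insert.prems f by simp
    then show ?case
      using insert N_add[of "add_pow B (Poly_Mapping.lookup P m) (zmon f m)"
          "\<Oplus>m\<in>K. add_pow B (Poly_Mapping.lookup P m) (zmon f m)"] f
      by (subst finsum_insert) auto
  qed (simp add: C)
  then show ?thesis by (simp add: zeval_eq f)
qed

lemma N_pow_le: "x \<in> carrier B \<Longrightarrow> N (x [^] (k::nat)) \<le> N x ^ k"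
  using N_pow[of x k] N_le_1[of \<one>] by (cases "k = 0") auto

lemma N_zmon_le:
  fixes f :: "'v \<Rightarrow> 'a"
  assumes f: "\<And>v. f v \<in> carrier B" and D: "D \<ge> 0"
    and le: "\<And>v. v \<in> Poly_Mapping.keys m \<Longrightarrow> N (f v) \<le> D ^ c v"
  shows "N (zmon f m) \<le> D ^ zweight c m"
proof -
  let ?t = "\<lambda>v. f v [^] Poly_Mapping.lookup m v"
  have "N (\<Otimes>v\<in>K. ?t v) \<le> D ^ (\<Sum>v\<in>K. c v * Poly_Mapping.lookup m v)"
    if "finite K" "K \<subseteq> Poly_Mapping.keys m" for K
    using that
  proof (induction K rule: finite_induct)
    case (insert v K)
    have "N (?t v) \<le> (D ^ c v) ^ Poly_Mapping.lookup m v"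
      using N_pow_le[OF f] le[of v] insert.prems N_nonneg[OF f]
      by (meson insert_subset order_trans power_mono)
    then have "N (?t v) * N (\<Otimes>v\<in>K. ?t v) \<le>
        D ^ (c v * Poly_Mapping.lookup m v) * D ^ (\<Sum>v\<in>K. c v * Poly_Mapping.lookup m v)"
      using insert D f by (intro mult_mono) (auto simp: power_mult intro!: N_nonneg finprod_closed)
    moreover have "N (?t v \<otimes> (\<Otimes>v\<in>K. ?t v)) \<le> N (?t v) * N (\<Otimes>v\<in>K. ?t v)"
      using f by (intro N_mult finprod_closed) auto
    ultimately show ?case using insert.hyps f by (subst finprod_insert) (auto simp: power_add)
  qed (use N_le_1[of \<one>] in auto)
  then show ?thesis by (simp add: zmon_def zweight_def)
qed

text \<open>All monomials of the addition polynomial have weight \<open>p ^ n\<close>, so the bounds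
  on their factors multiply to \<open>D ^ (p ^ n)\<close>; integer coefficients and sums do not
  enlarge an ultrametric norm.\<close>

lemma N_W_add_le:
  assumes ab: "a \<in> carrier W" "b \<in> carrier W" and D: "D \<ge> 0"
    and le: "\<And>i. i \<le> n \<Longrightarrow> N (a i) \<le> D ^ (p ^ i)" "\<And>i. i \<le> n \<Longrightarrow> N (b i) \<le> D ^ (p ^ i)"
  shows "N ((a \<oplus>\<^bsub>W\<^esub> b) n) \<le> D ^ (p ^ n)"
proof -
  let ?c = "case_sum (\<lambda>i. p ^ i) (\<lambda>i. p ^ i) :: nat + nat \<Rightarrow> nat"
  have f: "case_sum a b v \<in> carrier B" for v using ab by (auto simp: W_simps(1) split: sum.splits)
  have "(a \<oplus>\<^bsub>W\<^esub> b) n = zeval B (case_sum a b) (witt_add_poly p n)"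
    by (rule witt_ring_add)
  moreover have "N (zeval B (case_sum a b) (witt_add_poly p n)) \<le> D ^ (p ^ n)"
  proof (rule N_zeval_le[OF f])
    fix m assume "m \<in> Poly_Mapping.keys (witt_add_poly p n)"
    then have w: "zweight ?c m = p ^ n"
      using isobaric_witt_add_poly[OF p_prime] by (simp add: isobaric_def)
    have "N (case_sum a b v) \<le> D ^ ?c v" if v: "v \<in> Poly_Mapping.keys m" for v
    proof -
      \<comment> \<open>An occurring variable has weight at most the total weight
        \<open>p ^ n\<close>, hence index at most \<open>n\<close>, where the hypotheses
        apply.\<close>
      have "?c v * 1 \<le> ?c v * Poly_Mapping.lookup m v"
        using v by (intro mult_le_mono) (auto simp: in_keys_iff)
      also have "\<dots> \<le> p ^ n" unfolding w[symmetric] zweight_def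
        using v by (intro member_le_sum) auto
      finally have c: "?c v \<le> p ^ n" by simp
      have "p > 1" using p_prime by (rule prime_gt_1_nat)
      then have "i \<le> n" if "p ^ i \<le> p ^ n" for i using that power_le_imp_le_exp by blast
      then show ?thesis using c le by (auto split: sum.splits)
    qed
    then show "N (zmon (case_sum a b) m) \<le> D ^ (p ^ n)"
      unfolding w[symmetric] by (rule N_zmon_le[OF f D])
  qed (use D in simp)
  ultimately show ?thesis by simp
qed

text \<open>The condition \<open>\<rho> ^ n * N (y n) \<le> c\<close>, rewritten for the Witt
  component \<open>w n = y n [^] (p ^ n)\<close>. The cutoff \<open>k\<close> makes the estimate for
  products accessible to induction.\<close>

definition gauss_bound :: "nat \<Rightarrow> real \<Rightarrow> (nat \<Rightarrow> 'a) \<Rightarrow> bool" where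
  "gauss_bound k c w \<longleftrightarrow> (\<forall>n<k. N (w n) \<le> (c / \<rho> ^ n) ^ (p ^ n))"

lemma gauss_bound_add:
  assumes "a \<in> carrier W" "b \<in> carrier W" "c \<ge> 0" "gauss_bound k c a" "gauss_bound k c b"
  shows "gauss_bound k c (a \<oplus>\<^bsub>W\<^esub> b)"
  unfolding gauss_bound_def
proof (intro allI impI)
  fix n assume "n < k"
  \<comment> \<open>\<open>N_W_add_le\<close> needs a single \<open>D\<close> for all components up
    to \<open>n\<close>; since \<open>\<rho> < 1\<close>, the largest of the numbers
    \<open>c / \<rho> ^ i\<close> is the one at \<open>n\<close>.\<close>
  have mono: "(c / \<rho> ^ i) ^ (p ^ i) \<le> (c / \<rho> ^ n) ^ (p ^ i)" if "i \<le> n" for i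
    using rho assms(3) that by (intro power_mono divide_left_mono power_decreasing) auto
  show "N ((a \<oplus>\<^bsub>W\<^esub> b) n) \<le> (c / \<rho> ^ n) ^ (p ^ n)"
    using assms \<open>n < k\<close> rho mono
    by (intro N_W_add_le) (auto simp: gauss_bound_def intro: order_trans[OF _ mono])
qed

text \<open>Shifting by one component and taking \<open>p\<close>-th powers turns the exponent
  \<open>p ^ i\<close> into \<open>p ^ Suc i\<close>. One component is gained because component 0 of
  the multiple is zero.\<close>

lemma gauss_bound_p:
  assumes "a \<in> carrier W" "c \<ge> 0" "gauss_bound k (c / \<rho>) a"
  shows "gauss_bound (Suc k) c (add_pow W p a)"
  unfolding gauss_bound_def
proof (intro allI impI)
  fix n assume n: "n < Suc k"
  note [simp] = W_component_closed[OF assms(1)]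
  show "N (add_pow W p a n) \<le> (c / \<rho> ^ n) ^ (p ^ n)"
  proof (cases n)
    case (Suc i)
    have "N (a i) ^ p \<le> ((c / \<rho> / \<rho> ^ i) ^ (p ^ i)) ^ p"
      using assms n Suc N_nonneg by (intro power_mono) (auto simp: gauss_bound_def)
    then show ?thesis using assms by (simp add: Suc add_pow_p_W N_pow power_mult[symmetric] mult.commute)
  qed (use assms in \<open>simp add: add_pow_p_W\<close>)
qed

lemma gauss_bound_teichmuller_mult:
  assumes "x \<in> carrier B" "w \<in> carrier W" "N x \<le> c" "gauss_bound k d w"
  shows "gauss_bound k (c * d) (teichmuller B x \<otimes>\<^bsub>W\<^esub> w)"
  unfolding gauss_bound_def
proof (intro allI impI)
  fix n assume "n < k"
  note [simp] = W_component_closed[OF assms(2)]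
  have c: "0 \<le> c" using N_nonneg[OF assms(1)] assms(3) by linarith
  have "N (x [^] (p ^ n) \<otimes> w n) \<le> N (x [^] (p ^ n)) * N (w n)" using assms by (intro N_mult) auto
  also have "\<dots> \<le> c ^ (p ^ n) * (d / \<rho> ^ n) ^ (p ^ n)"
    using assms \<open>n < k\<close> N_nonneg c
    by (intro mult_mono) (auto simp: N_pow gauss_bound_def intro!: power_mono)
  finally show "N ((teichmuller B x \<otimes>\<^bsub>W\<^esub> w) n) \<le> (c * d / \<rho> ^ n) ^ (p ^ n)"
    using assms by (simp add: teichmuller_mult_W power_mult_distrib[symmetric])
qed

lemma frobenius_eq_0: "x \<in> carrier B \<Longrightarrow> x [^] p = \<zero> \<Longrightarrow> x = \<zero>"
  using N_pow[of x p] N_eq_0[of x] by simp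

text \<open>Perfectness enters here: the components of \<open>a'\<close> are the \<open>p\<close>-th
  roots of the shifted components of \<open>a\<close>, which undoes the Frobenius in
  \<open>add_pow_p_W\<close>.\<close>

lemma W_decompose:
  assumes "a \<in> carrier W"
  obtains a' where "a' \<in> carrier W" "a = teichmuller B (a 0) \<oplus>\<^bsub>W\<^esub> add_pow W p a'"
    "\<And>n. a' n [^] p = a (Suc n)"
proof -
  note [simp] = W_component_closed[OF assms]
  have "\<forall>n. \<exists>y. y \<in> carrier B \<and> y [^] p = a (Suc n)" 
    using perfect[OF W_component_closed[OF assms]] by blast
  then obtain a' where "\<forall>n. a' n \<in> carrier B \<and> a' n [^] p = a (Suc n)"
    unfolding choice_iff by blast
  then have a': "\<And>n. a' n \<in> carrier B" "\<And>n. a' n [^] p = a (Suc n)" by auto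
  have c: "a' \<in> carrier W" unfolding W_simps(1) using a'(1) by blast
  have "teichmuller B (a 0) \<oplus>\<^bsub>W\<^esub> add_pow W p a' = (\<lambda>n. teichmuller B (a 0) n \<oplus> add_pow W p a' n)"
  proof (rule W_add_disjoint)
    show "teichmuller B (a 0) n = \<zero> \<or> add_pow W p a' n = \<zero>" for n
      by (cases n) (simp_all add: add_pow_p_W[OF c] teichmuller_def)
  qed (use assms c in simp_all)
  also have "\<dots> = a"
    unfolding add_pow_p_W[OF c]
    using assms by (auto simp: teichmuller_def fun_eq_iff a'(2) split: nat.splits)
  finally show ?thesis by (intro that[OF c _ a'(2)]) simp
qed

text \<open>Induction on the cutoff. Passing from \<open>a\<close> to \<open>a'\<close> loses one
  component and replaces \<open>c\<close> by \<open>c / \<rho>\<close>; multiplication by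
  \<open>p\<close> restores both. Only the addition polynomials thus have to be estimated.\<close>

lemma gauss_bound_mult:
  assumes "a \<in> carrier W" "b \<in> carrier W" "c \<ge> 0" "d \<ge> 0" "gauss_bound k c a" "gauss_bound k d b"
  shows "gauss_bound k (c * d) (a \<otimes>\<^bsub>W\<^esub> b)"
  using assms
proof (induction k arbitrary: a c)
  case 0
  then show ?case by (simp add: gauss_bound_def)
next
  case (Suc k)
  note [simp] = W_component_closed[OF Suc.prems(1)]
  obtain a' where a': "a' \<in> carrier W" "a = teichmuller B (a 0) \<oplus>\<^bsub>W\<^esub> add_pow W p a'"
    "\<And>n. a' n [^] p = a (Suc n)" using W_decompose[OF Suc.prems(1)] by blast
  note [simp] = W_component_closed[OF a'(1)]
  have "gauss_bound k (c / \<rho>) a'"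
    unfolding gauss_bound_def
  proof (intro allI impI)
    fix n assume "n < k"
    then have "N (a' n) ^ p \<le> ((c / \<rho> / \<rho> ^ n) ^ (p ^ n)) ^ p"
      using Suc.prems(5)[unfolded gauss_bound_def, rule_format, of "Suc n"] N_pow[of "a' n" p] a'(1,3)
      by (simp add: power_mult[symmetric] mult.commute)
    then show "N (a' n) \<le> (c / \<rho> / \<rho> ^ n) ^ (p ^ n)"
      using rho Suc.prems(3) by (subst (asm) power_mono_iff) (auto simp: N_nonneg)
  qed
  then have "gauss_bound k (c * d / \<rho>) (a' \<otimes>\<^bsub>W\<^esub> b)"
    using Suc.IH[of a' "c / \<rho>"] Suc.prems a' rho by (auto simp: gauss_bound_def)
  then have 1: "gauss_bound (Suc k) (c * d) (add_pow W p (a' \<otimes>\<^bsub>W\<^esub> b))"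
    using Suc.prems a' by (intro gauss_bound_p) auto
  have "N (a 0) \<le> c" using Suc.prems(5) by (auto simp: gauss_bound_def)
  then have 2: "gauss_bound (Suc k) (c * d) (teichmuller B (a 0) \<otimes>\<^bsub>W\<^esub> b)"
    using Suc.prems by (intro gauss_bound_teichmuller_mult) auto
  have "a \<otimes>\<^bsub>W\<^esub> b = (teichmuller B (a 0) \<oplus>\<^bsub>W\<^esub> add_pow W p a') \<otimes>\<^bsub>W\<^esub> b"
    using a'(2) by (rule arg_cong)
  also have "\<dots> = teichmuller B (a 0) \<otimes>\<^bsub>W\<^esub> b \<oplus>\<^bsub>W\<^esub> add_pow W p (a' \<otimes>\<^bsub>W\<^esub> b)"
    using Suc.prems(1,2) a'(1) by (simp add: W.l_distr W.add_pow_ldistr)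
  finally show ?case using 1 2 Suc.prems a'(1) by (simp add: gauss_bound_add)
qed

lemma gauss_bound_1: "w \<in> carrier W \<Longrightarrow> gauss_bound k 1 w"
  unfolding gauss_bound_def
  using rho by (auto intro!: order_trans[OF N_le_1] W_component_closed one_le_power power_le_one)

text \<open>The negative is the product with -1, which satisfies the bound 1 like every Witt vector.
  For \<open>p = 2\<close> negation is not componentwise.\<close>

lemma gauss_bound_neg:
  assumes "a \<in> carrier W" "c \<ge> 0" "gauss_bound k c a"
  shows "gauss_bound k c (\<ominus>\<^bsub>W\<^esub> a)"
  using gauss_bound_mult[of "\<ominus>\<^bsub>W\<^esub> \<one>\<^bsub>W\<^esub>" a 1 c k] gauss_bound_1 assms by (simp add: W.l_minus)

lemma gauss_bound_diff:
  assumes "a \<in> carrier W" "b \<in> carrier W" "c \<ge> 0" "gauss_bound k c a" "gauss_bound k c b"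
  shows "gauss_bound k c (a \<ominus>\<^bsub>W\<^esub> b)"
  unfolding W.minus_eq using assms by (intro gauss_bound_add gauss_bound_neg) auto

end

subsection \<open>Adic and norm topologies\<close>

context cring begin

abbreviation ideal_power :: "'a set \<Rightarrow> nat \<Rightarrow> 'a set" where
  "ideal_power I n \<equiv> I [^]\<^bsub>ideals_set R\<^esub> n"

lemma ideal_power_0: "ideal_power I 0 = carrier R"
  by (simp add: ideals_set_def)

lemma ideal_power_Suc: "ideal_power I (Suc n) = ideal_prod R (ideal_power I n) I"
  by (simp add: ideals_set_def)

lemma ideal_ideal_power: "ideal I R \<Longrightarrow> ideal (ideal_power I n) R"
proof (induction n)
  case 0
  show ?case unfolding ideal_power_0 by (rule oneideal)
next
  case (Suc n)
  then show ?case unfolding ideal_power_Suc by (intro ideal_prod_is_ideal)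
qed

lemma ideal_power_1: "ideal I R \<Longrightarrow> ideal_power I 1 = I"
  using ideal_prod_commute[OF oneideal, of I] ideal_prod_one[of I]
  by (simp only: One_nat_def ideal_power_Suc ideal_power_0)

lemma ideal_power_Suc_subset: "ideal I R \<Longrightarrow> ideal_power I (Suc n) \<subseteq> ideal_power I n"
  unfolding ideal_power_Suc using ideal_prod_inter[OF ideal_ideal_power] by blast

lemma ideal_power_antimono: "ideal I R \<Longrightarrow> m \<le> n \<Longrightarrow> ideal_power I n \<subseteq> ideal_power I m"
  by (rule lift_Suc_antimono_le[of "ideal_power I"]) (rule ideal_power_Suc_subset)

lemma ideal_prod_mono:
  assumes "I \<subseteq> I'" "J \<subseteq> J'"
  shows "ideal_prod R I J \<subseteq> ideal_prod R I' J'"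
proof
  fix x assume "x \<in> ideal_prod R I J"
  then show "x \<in> ideal_prod R I' J'"
    by (induction rule: ideal_prod.induct) (use assms in \<open>auto intro: ideal_prod.intros\<close>)
qed

lemma ideal_power_mono: "I \<subseteq> J \<Longrightarrow> ideal_power I n \<subseteq> ideal_power J n"
  by (induction n) (simp_all only: ideal_power_0 ideal_power_Suc ideal_prod_mono order_refl)

lemma pow_mem_ideal_power:
  assumes "ideal I R" "a \<in> I"
  shows "a [^] n \<in> ideal_power I n"
proof (induction n)
  case 0
  then show ?case by (simp add: ideals_set_def)
next
  case (Suc n)
  then show ?case unfolding ideal_power_Suc using assms(2) by (auto intro: ideal_prod.prod)
qed

lemma ideal_minus_closed: "ideal I R \<Longrightarrow> a \<in> I \<Longrightarrow> b \<in> I \<Longrightarrow> a \<ominus> b \<in> I"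
  by (simp add: minus_eq additive_subgroup.a_closed additive_subgroup.a_inv_closed ideal.axioms(1))

lemma ideal_plus_closed: "ideal I R \<Longrightarrow> a \<in> I \<Longrightarrow> b \<in> I \<Longrightarrow> a \<oplus> b \<in> I"
  by (simp add: additive_subgroup.a_closed ideal.axioms(1))

lemma ideal_zero_mem: "ideal I R \<Longrightarrow> \<zero> \<in> I"
  by (simp add: additive_subgroup.zero_closed ideal.axioms(1))

lemma mem_a_l_coset_iff:
  assumes "ideal I R" "x \<in> carrier R"
  shows "y \<in> x <+ I \<longleftrightarrow> y \<in> carrier R \<and> y \<ominus> x \<in> I"
proof
  assume "y \<in> x <+ I"
  then obtain i where i: "i \<in> I" "y = x \<oplus> i" by (auto simp: a_l_coset_def')
  moreover have "i \<in> carrier R" using assms i ideal.Icarr by metis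
  moreover from this have "x \<oplus> i \<ominus> x = i" using assms(2) by algebra
  ultimately show "y \<in> carrier R \<and> y \<ominus> x \<in> I" using assms by simp
next
  assume y: "y \<in> carrier R \<and> y \<ominus> x \<in> I"
  then have "y = x \<oplus> (y \<ominus> x)" using assms(2) by algebra
  then show "y \<in> x <+ I" using y by (auto simp: a_l_coset_def')
qed

text \<open>\<open>topology\<close> inverts \<open>openin\<close> only on predicates satisfying
  \<open>istopology\<close>, which is therefore verified first. Cosets are rewritten as differences
  to match the description of norm-open sets.\<close>

lemma openin_adic_topology:
  assumes I: "ideal I R"
  shows "openin (adic_topology R I) U \<longleftrightarrow>
    U \<subseteq> carrier R \<and> (\<forall>x\<in>U. \<exists>n. \<forall>y\<in>carrier R. y \<ominus> x \<in> ideal_power I n \<longrightarrow> y \<in> U)"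
proof -
  let ?P = "\<lambda>U. U \<subseteq> carrier R \<and> (\<forall>x\<in>U. \<exists>n. x <+ ideal_power I n \<subseteq> U)"
  have "istopology ?P"
    unfolding istopology_def
  proof (intro conjI allI impI)
    fix S T assume S: "?P S" and T: "?P T"
    have "\<exists>n. x <+ ideal_power I n \<subseteq> S \<inter> T" if x: "x \<in> S \<inter> T" for x
    proof -
      obtain m n where mn: "x <+ ideal_power I m \<subseteq> S" "x <+ ideal_power I n \<subseteq> T"
        using S T x by blast
      have "x <+ ideal_power I (max m n) \<subseteq> x <+ ideal_power I m"
        "x <+ ideal_power I (max m n) \<subseteq> x <+ ideal_power I n"
        using ideal_power_antimono[OF I, of m "max m n"] ideal_power_antimono[OF I, of n "max m n"]
        by (auto simp: a_l_coset_def')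
      then show ?thesis using mn by blast
    qed
    then show "S \<inter> T \<subseteq> carrier R" "\<forall>x\<in>S \<inter> T. \<exists>n. x <+ ideal_power I n \<subseteq> S \<inter> T"
      using S by blast+
  next
    fix \<K> assume K: "\<forall>S\<in>\<K>. ?P S"
    then show "\<Union>\<K> \<subseteq> carrier R" by blast
    show "\<forall>x\<in>\<Union>\<K>. \<exists>n. x <+ ideal_power I n \<subseteq> \<Union>\<K>"
    proof
      fix x assume "x \<in> \<Union>\<K>"
      then obtain S where S: "x \<in> S" "S \<in> \<K>" by blast
      then obtain n where "x <+ ideal_power I n \<subseteq> S" using K by blast
      then show "\<exists>n. x <+ ideal_power I n \<subseteq> \<Union>\<K>" using S by blast
    qed
  qed
  then have "openin (adic_topology R I) U \<longleftrightarrow> ?P U"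
    by (simp add: adic_topology_def topology_inverse')
  also have "\<dots> \<longleftrightarrow> U \<subseteq> carrier R \<and> (\<forall>x\<in>U. \<exists>n. \<forall>y\<in>carrier R. y \<ominus> x \<in> ideal_power I n \<longrightarrow> y \<in> U)"
  proof (intro conj_cong refl ball_cong ex_cong1)
    fix x n assume "U \<subseteq> carrier R" "x \<in> U"
    then show "x <+ ideal_power I n \<subseteq> U \<longleftrightarrow> (\<forall>y\<in>carrier R. y \<ominus> x \<in> ideal_power I n \<longrightarrow> y \<in> U)"
      using mem_a_l_coset_iff[OF ideal_ideal_power[OF I], of x _ n] by blast
  qed
  finally show ?thesis .
qed

lemma topspace_adic_topology: "ideal I R \<Longrightarrow> topspace (adic_topology R I) = carrier R"
  using openin_adic_topology[of I] by (auto simp: topspace_def)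

lemma openin_adic_coset:
  assumes I: "ideal I R" and x: "x \<in> carrier R"
  shows "openin (adic_topology R I) {y \<in> carrier R. y \<ominus> x \<in> ideal_power I n}"
  unfolding openin_adic_topology[OF I]
proof (intro conjI ballI exI impI)
  fix y z assume y: "y \<in> {y \<in> carrier R. y \<ominus> x \<in> ideal_power I n}"
    and z: "z \<in> carrier R" "z \<ominus> y \<in> ideal_power I n"
  have "z \<ominus> x = (z \<ominus> y) \<oplus> (y \<ominus> x)" using x y z by simp algebra
  then show "z \<in> {y \<in> carrier R. y \<ominus> x \<in> ideal_power I n}"
    using ideal_plus_closed[OF ideal_ideal_power[OF I] z(2), of "y \<ominus> x"] y z by simp
qed auto

lemma limitin_adic_topology_iff:
  assumes I: "ideal I R" and w: "w \<in> carrier R" and s: "\<And>k. s k \<in> carrier R"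
  shows "limitin (adic_topology R I) s w sequentially \<longleftrightarrow>
    (\<forall>n. \<exists>K. \<forall>k\<ge>K. s k \<ominus> w \<in> ideal_power I n)"
proof (intro iffI allI)
  fix n assume l: "limitin (adic_topology R I) s w sequentially"
  have "w \<in> {y \<in> carrier R. y \<ominus> w \<in> ideal_power I n}"
    using w ideal_zero_mem[OF ideal_ideal_power[OF I]] by (auto simp: r_neg minus_eq)
  then show "\<exists>K. \<forall>k\<ge>K. s k \<ominus> w \<in> ideal_power I n"
    using l openin_adic_coset[OF I w, of n] unfolding limitin_def eventually_sequentially by blast
next
  assume c: "\<forall>n. \<exists>K. \<forall>k\<ge>K. s k \<ominus> w \<in> ideal_power I n"
  show "limitin (adic_topology R I) s w sequentially"
    unfolding limitin_def eventually_sequentially topspace_adic_topology[OF I]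
  proof (intro conjI allI impI)
    fix U assume "openin (adic_topology R I) U \<and> w \<in> U"
    then obtain n where n: "\<forall>y\<in>carrier R. y \<ominus> w \<in> ideal_power I n \<longrightarrow> y \<in> U"
      unfolding openin_adic_topology[OF I] by blast
    obtain K where "\<forall>k\<ge>K. s k \<ominus> w \<in> ideal_power I n" using c by blast
    then show "\<exists>N. \<forall>n\<ge>N. s n \<in> U" using n s by blast
  qed (rule w)
qed

section \<open>Norm topologies and their comparison with adic ones\<close>

lemma Metric_space_norm_dist:
  assumes nonneg: "\<And>x. x \<in> carrier R \<Longrightarrow> 0 \<le> N x"
    and zero: "\<And>x. x \<in> carrier R \<Longrightarrow> N x = 0 \<longleftrightarrow> x = \<zero>"
    and diff: "\<And>x y. x \<in> carrier R \<Longrightarrow> y \<in> carrier R \<Longrightarrow> N (x \<ominus> y) \<le> max (N x) (N y)"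
  shows "Metric_space (carrier R) (norm_dist R N)"
proof
  \<comment> \<open>Symmetry comes out of the ultrametric inequality for
    \<open>\<zero> \<ominus> x\<close>, applied in both directions.\<close>
  have neg: "N (\<ominus> x) \<le> N x" if "x \<in> carrier R" for x
    using diff[of \<zero> x] zero[of \<zero>] nonneg[of x] that by (simp add: minus_eq)
  have sym: "N (x \<ominus> y) \<le> N (y \<ominus> x)" if "x \<in> carrier R" "y \<in> carrier R" for x y
  proof -
    have "x \<ominus> y = \<ominus> (y \<ominus> x)" using that by algebra
    then show ?thesis using neg[of "y \<ominus> x"] that by simp
  qed
  fix x y z
  show "0 \<le> norm_dist R N x y" by (simp add: norm_dist_def nonneg)
  show "norm_dist R N x y = norm_dist R N y x" using sym by (auto simp: norm_dist_def intro!: antisym)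
  assume xy: "x \<in> carrier R" "y \<in> carrier R"
  show "norm_dist R N x y = 0 \<longleftrightarrow> x = y" using xy by (simp add: norm_dist_def zero)
  assume z: "z \<in> carrier R"
  have "x \<ominus> z = (x \<ominus> y) \<ominus> (z \<ominus> y)" using xy z by algebra
  then have "N (x \<ominus> z) \<le> max (N (x \<ominus> y)) (N (y \<ominus> z))"
    using diff[of "x \<ominus> y" "z \<ominus> y"] sym[of z y] xy z by auto
  also have "\<dots> \<le> N (x \<ominus> y) + N (y \<ominus> z)" using nonneg xy z by simp
  finally show "norm_dist R N x z \<le> norm_dist R N x y + norm_dist R N y z"
    using xy z by (simp add: norm_dist_def)
qed

lemma openin_norm_topology:
  assumes "Metric_space (carrier R) (norm_dist R N)"
  shows "openin (norm_topology R N) U \<longleftrightarrow>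
    U \<subseteq> carrier R \<and> (\<forall>x\<in>U. \<exists>r>0. \<forall>y\<in>carrier R. N (y \<ominus> x) < r \<longrightarrow> y \<in> U)"
proof -
  interpret M: Metric_space "carrier R" "norm_dist R N" by (rule assms)
  have "y \<in> M.mball x r \<longleftrightarrow> y \<in> carrier R \<and> N (y \<ominus> x) < r" if "x \<in> carrier R" for x y r
    using that M.commute[of x y] by (auto simp: norm_dist_def)
  then show ?thesis
    unfolding norm_topology_def M.openin_mtopology subset_iff by metis
qed

text \<open>Both topologies are translation invariant, so it is enough that balls around zero and
  ideal powers are cofinal in each other.\<close>

lemma norm_topology_eq_adic_topology:
  assumes M: "Metric_space (carrier R) (norm_dist R N)" and I: "ideal I R"
    and "\<And>n. \<exists>r>0. \<forall>w\<in>carrier R. N w < r \<longrightarrow> w \<in> ideal_power I n"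
    and "\<And>r. r > 0 \<Longrightarrow> \<exists>n. \<forall>w\<in>ideal_power I n. N w < r"
  shows "norm_topology R N = adic_topology R I"
proof -
  have "(\<exists>r>0. \<forall>y\<in>carrier R. N (y \<ominus> x) < r \<longrightarrow> y \<in> U) \<longleftrightarrow>
        (\<exists>n. \<forall>y\<in>carrier R. y \<ominus> x \<in> ideal_power I n \<longrightarrow> y \<in> U)" if x: "x \<in> carrier R" for x U
    using assms(3,4) minus_closed[OF _ x] by meson
  then show ?thesis
    unfolding topology_eq openin_norm_topology[OF M] openin_adic_topology[OF I] by blast
qed

end

subsection \<open>Teichmueller expansions\<close>

context perfect_normed_ring begin

text \<open>Frobenius is additive, so injectivity amounts to a trivial kernel, and a
  power-multiplicative norm excludes nilpotent elements.\<close>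

lemma frobenius_power_inj:
  assumes "x \<in> carrier B" "y \<in> carrier B" "x [^] (p ^ k) = y [^] (p ^ k)"
  shows "x = y"
  using assms
proof (induction k arbitrary: x y)
  case (Suc k)
  have "(x [^] p) [^] (p ^ k) = (y [^] p) [^] (p ^ k)"
    using Suc.prems by (simp add: nat_pow_pow)
  then have eq: "x [^] p = y [^] p" using Suc by simp
  have "x = (x \<ominus> y) \<oplus> y" using Suc.prems by algebra
  then have "x [^] p = (x \<ominus> y) [^] p \<oplus> y [^] p"
    using frobenius_add[of "x \<ominus> y" y] Suc.prems by simp
  then have "(x \<ominus> y) [^] p = \<zero>" using Suc.prems eq by simp
  then have "x \<ominus> y = \<zero>" by (rule frobenius_eq_0[OF minus_closed[OF Suc.prems(1,2)]])
  then show ?case using Suc.prems(1,2) by simp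
qed simp

lemma frobenius_power_root:
  assumes "x \<in> carrier B"
  shows "\<exists>y\<in>carrier B. y [^] (p ^ k) = x"
proof (induction k)
  case 0
  then show ?case using assms by auto
next
  case (Suc k)
  then obtain y where y: "y \<in> carrier B" "y [^] (p ^ k) = x" by blast
  obtain z where z: "z \<in> carrier B" "z [^] p = y" using perfect[OF y(1)] by blast
  have "z [^] (p ^ Suc k) = (z [^] p) [^] (p ^ k)" using z(1) by (simp add: nat_pow_pow)
  then show ?case using y z by auto
qed

section \<open>The \<open>p\<close>-adic filtration\<close>

definition vanishing :: "nat \<Rightarrow> (nat \<Rightarrow> 'a) set" where
  "vanishing n = {w \<in> carrier W. \<forall>i<n. w i = \<zero>}"

lemma vanishing_Suc: "vanishing (Suc n) = add_pow W p ` vanishing n"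
proof (intro equalityI subsetI)
  fix w assume w: "w \<in> vanishing (Suc n)"
  then have wc: "w \<in> carrier W" by (simp add: vanishing_def)
  then obtain u where u: "u \<in> carrier W" "w = teichmuller B (w 0) \<oplus>\<^bsub>W\<^esub> add_pow W p u"
    "\<And>n. u n [^] p = w (Suc n)" using W_decompose by blast
  have "teichmuller B (w 0) = \<zero>\<^bsub>W\<^esub>"
    using w by (simp add: vanishing_def teichmuller_def W_simps fun_eq_iff)
  then have "w = add_pow W p u" using u(1,2) by simp
  moreover have "u i = \<zero>" if "i < n" for i
    using w u(3)[of i] that by (intro frobenius_eq_0[OF W_component_closed[OF u(1)]]) (auto simp: vanishing_def)
  ultimately show "w \<in> add_pow W p ` vanishing n" using u(1) by (auto simp: vanishing_def)
next
  fix w assume "w \<in> add_pow W p ` vanishing n"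
  then obtain u where u: "u \<in> carrier W" "\<And>i. i < n \<Longrightarrow> u i = \<zero>" "w = add_pow W p u"
    by (auto simp: vanishing_def)
  moreover have "add_pow W p u i = \<zero>" if "i < Suc n" for i
    using u(1,2) that by (cases i) (auto simp: add_pow_p_W nat_pow_zero)
  ultimately show "w \<in> vanishing (Suc n)" by (simp add: vanishing_def)
qed

abbreviation p_ideal :: "(nat \<Rightarrow> 'a) set" where
  "p_ideal \<equiv> Idl\<^bsub>W\<^esub> {add_pow W p \<one>\<^bsub>W\<^esub>}"

lemma add_pow_p_eq_mult: "w \<in> carrier W \<Longrightarrow> add_pow W p w = w \<otimes>\<^bsub>W\<^esub> add_pow W p \<one>\<^bsub>W\<^esub>"
  by (simp add: W.add_pow_rdistr)

lemma p_ideal_eq: "p_ideal = add_pow W p ` carrier W"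
proof -
  have "p_ideal = PIdl\<^bsub>W\<^esub> (add_pow W p \<one>\<^bsub>W\<^esub>)" by (simp add: W.cgenideal_eq_genideal)
  moreover have "add_pow W p ` carrier W = (\<lambda>w. w \<otimes>\<^bsub>W\<^esub> add_pow W p \<one>\<^bsub>W\<^esub>) ` carrier W"
    by (rule image_cong[OF refl add_pow_p_eq_mult])
  ultimately show ?thesis by (auto simp: cgenideal_def)
qed

lemma ideal_p_ideal: "ideal p_ideal W" by (rule W.genideal_ideal) simp

text \<open>Multiplication by \<open>p\<close> shifts the components up to a bijective Frobenius, so
  the multiples of \<open>p ^ n\<close> are exactly the vectors starting with \<open>n\<close>
  zeros. This turns \<open>p\<close>-adic congruence into agreement of initial components.\<close>

lemma p_ideal_power: "W.ideal_power p_ideal n = vanishing n"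
proof (induction n)
  case 0
  then show ?case by (simp only: W.ideal_power_0) (simp add: vanishing_def)
next
  case (Suc n)
  have V: "ideal (vanishing n) W" using W.ideal_ideal_power[OF ideal_p_ideal, of n] Suc by simp
  have "ideal_prod W (vanishing n) p_ideal = vanishing (Suc n)"
  proof (intro equalityI subsetI)
    fix w assume "w \<in> ideal_prod W (vanishing n) p_ideal"
    then show "w \<in> vanishing (Suc n)"
    proof (induction rule: ideal_prod.induct)
      case (prod v q)
      then obtain u where u: "u \<in> carrier W" "q = add_pow W p u" by (auto simp: p_ideal_eq)
      have "v \<in> carrier W" using prod(1) by (simp add: vanishing_def)
      then have "v \<otimes>\<^bsub>W\<^esub> q = add_pow W p (v \<otimes>\<^bsub>W\<^esub> u)" using u by (simp add: W.add_pow_rdistr)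
      moreover have "v \<otimes>\<^bsub>W\<^esub> u \<in> vanishing n" using V prod(1) u(1) by (rule ideal.I_r_closed)
      ultimately show ?case by (simp add: vanishing_Suc)
    next
      case (sum a b)
      then obtain u v where uv: "u \<in> vanishing n" "v \<in> vanishing n" "a = add_pow W p u" "b = add_pow W p v"
        by (auto simp: vanishing_Suc)
      have "u \<in> carrier W" "v \<in> carrier W" using uv by (auto simp: vanishing_def)
      then have "a \<oplus>\<^bsub>W\<^esub> b = add_pow W p (u \<oplus>\<^bsub>W\<^esub> v)"
        using uv by (simp add: W.add.nat_pow_distrib)
      then show ?case using W.ideal_plus_closed[OF V uv(1,2)] by (simp add: vanishing_Suc)
    qed
  next
    fix w assume "w \<in> vanishing (Suc n)"
    then obtain u where u: "u \<in> vanishing n" "w = add_pow W p u" by (auto simp: vanishing_Suc)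
    have "w = u \<otimes>\<^bsub>W\<^esub> add_pow W p \<one>\<^bsub>W\<^esub>"
      unfolding u(2) by (rule add_pow_p_eq_mult) (use u(1) in \<open>simp add: vanishing_def\<close>)
    moreover have "add_pow W p \<one>\<^bsub>W\<^esub> \<in> p_ideal" by (auto simp: p_ideal_eq)
    ultimately show "w \<in> ideal_prod W (vanishing n) p_ideal"
      using ideal_prod.prod[OF u(1)] by simp
  qed
  then show ?case by (simp only: W.ideal_power_Suc Suc)
qed

lemma ideal_vanishing: "ideal (vanishing n) W"
  using W.ideal_ideal_power[OF ideal_p_ideal, of n] by (simp only: p_ideal_power)

lemma W_split:
  assumes "w \<in> carrier W"
  obtains v where "v \<in> vanishing n" "w = (\<lambda>i. if i < n then w i else \<zero>) \<oplus>\<^bsub>W\<^esub> v"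
proof
  let ?v = "\<lambda>i. if i < n then \<zero> else w i"
  let ?u = "\<lambda>i. if i < n then w i else \<zero>"
  show "?v \<in> vanishing n" using assms by (simp add: vanishing_def W_simps)
  have "?u \<oplus>\<^bsub>W\<^esub> ?v = (\<lambda>i. ?u i \<oplus> ?v i)"
    using assms by (intro W_add_disjoint) (auto simp: W_simps)
  also have "\<dots> = w" using W_component_closed[OF assms] by auto
  finally show "w = ?u \<oplus>\<^bsub>W\<^esub> ?v" by simp
qed

lemma trunc_closed: "w \<in> carrier W \<Longrightarrow> (\<lambda>i. if i < n then w i else \<zero>) \<in> carrier W"
  by (simp add: W_simps)

text \<open>Split \<open>w\<close> into head and tail. The tail plus \<open>v\<close> stays in the
  ideal \<open>vanishing n\<close>, and its support is disjoint from that of the head, so the outer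
  sum is componentwise.\<close>

lemma W_add_vanishing:
  assumes w: "w \<in> carrier W" and v: "v \<in> vanishing n" and i: "i < n"
  shows "(w \<oplus>\<^bsub>W\<^esub> v) i = w i"
proof -
  let ?u = "\<lambda>i. if i < n then w i else \<zero>"
  obtain v' where v': "v' \<in> vanishing n" "w = ?u \<oplus>\<^bsub>W\<^esub> v'" using W_split[OF w] by blast
  have c: "?u \<in> carrier W" "v \<in> carrier W" "v' \<in> carrier W"
    using trunc_closed[OF w] v v' by (auto simp: vanishing_def)
  have s: "v' \<oplus>\<^bsub>W\<^esub> v \<in> vanishing n" by (rule W.ideal_plus_closed[OF ideal_vanishing v'(1) v])
  have "w \<oplus>\<^bsub>W\<^esub> v = ?u \<oplus>\<^bsub>W\<^esub> (v' \<oplus>\<^bsub>W\<^esub> v)"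
    by (subst v'(2)) (rule W.a_assoc[OF c(1,3,2)])
  also have "\<dots> = (\<lambda>i. ?u i \<oplus> (v' \<oplus>\<^bsub>W\<^esub> v) i)"
    by (rule W_add_disjoint) (use c s in \<open>auto simp: vanishing_def\<close>)
  finally show ?thesis using s i W_component_closed[OF w, of i] by (simp add: vanishing_def)
qed

text \<open>Vectors with the same first \<open>n\<close> components have the same head; it cancels
  in the difference and leaves a difference of tails.\<close>

lemma W_diff_vanishing_iff:
  assumes "a \<in> carrier W" "b \<in> carrier W"
  shows "a \<ominus>\<^bsub>W\<^esub> b \<in> vanishing n \<longleftrightarrow> (\<forall>i<n. a i = b i)"
proof
  assume v: "a \<ominus>\<^bsub>W\<^esub> b \<in> vanishing n"
  have "a = b \<oplus>\<^bsub>W\<^esub> (a \<ominus>\<^bsub>W\<^esub> b)" using assms by algebra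
  then show "\<forall>i<n. a i = b i" using W_add_vanishing[OF assms(2) v] by metis
next
  assume eq: "\<forall>i<n. a i = b i"
  let ?u = "\<lambda>i. if i < n then a i else \<zero>"
  obtain v where v: "v \<in> vanishing n" "a = ?u \<oplus>\<^bsub>W\<^esub> v" using W_split[OF assms(1)] by blast
  have "?u = (\<lambda>i. if i < n then b i else \<zero>)" using eq by auto
  then obtain v' where v': "v' \<in> vanishing n" "b = ?u \<oplus>\<^bsub>W\<^esub> v'"
    using W_split[OF assms(2), of n] by metis
  have c: "?u \<in> carrier W" "v \<in> carrier W" "v' \<in> carrier W"
    using trunc_closed[OF assms(1)] v v' by (auto simp: vanishing_def)
  have "(u \<oplus>\<^bsub>W\<^esub> v) \<ominus>\<^bsub>W\<^esub> (u \<oplus>\<^bsub>W\<^esub> v') = v \<ominus>\<^bsub>W\<^esub> v'" if "u \<in> carrier W" for u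
    using c(2,3) that by algebra
  then have "a \<ominus>\<^bsub>W\<^esub> b = v \<ominus>\<^bsub>W\<^esub> v'" using c(1) v(2) v'(2) by metis
  then show "a \<ominus>\<^bsub>W\<^esub> b \<in> vanishing n" using W.ideal_minus_closed[OF ideal_vanishing v(1) v'(1)] by simp
qed

lemma add_pow_p_power_teichmuller:
  assumes y: "y \<in> carrier B"
  shows "add_pow W (p ^ n) (teichmuller B y) = (\<lambda>i. if i = n then y [^] (p ^ n) else \<zero>)"
proof (induction n)
  case 0
  have "add_pow W (p ^ 0) (teichmuller B y) = teichmuller B y"
    unfolding power_0 by (rule W.add.nat_pow_eone) (use y in simp)
  moreover have "y [^] (1::nat) = y" using y by (rule nat_pow_eone)
  ultimately show ?case by (simp only: teichmuller_def power_0)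
next
  case (Suc n)
  let ?v = "\<lambda>i. if i = n then y [^] (p ^ n) else \<zero>"
  have v: "?v \<in> carrier W" using y by (simp add: W_simps)
  have "add_pow W (p ^ Suc n) (teichmuller B y) = add_pow W p (add_pow W (p ^ n) (teichmuller B y))"
    using y by (simp add: W.add.nat_pow_pow mult.commute)
  also have "\<dots> = (\<lambda>i. if i = Suc n then y [^] (p ^ Suc n) else \<zero>)"
    unfolding Suc add_pow_p_W[OF v]
    using y by (auto simp: fun_eq_iff nat_pow_pow mult.commute nat_pow_zero split: nat.splits)
  finally show ?case .
qed

text \<open>The summand with index \<open>n\<close> is supported at component \<open>n\<close>
  alone, so the Witt sum is formed without carries.\<close>

lemma partial_sum_eq:
  assumes y: "\<And>n. y n \<in> carrier B"
  shows "(\<Oplus>\<^bsub>W\<^esub>n\<in>{..<k}. add_pow W (p ^ n) (teichmuller B (y n))) =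
    (\<lambda>n. if n < k then y n [^] (p ^ n) else \<zero>)"
proof (induction k)
  case 0
  then show ?case by (simp add: W_simps)
next
  case (Suc k)
  let ?t = "\<lambda>n. add_pow W (p ^ n) (teichmuller B (y n))"
  let ?u = "\<lambda>n. if n < k then y n [^] (p ^ n) else \<zero>"
  have "(\<Oplus>\<^bsub>W\<^esub>n\<in>{..<Suc k}. ?t n) = ?t k \<oplus>\<^bsub>W\<^esub> (\<Oplus>\<^bsub>W\<^esub>n\<in>{..<k}. ?t n)"
    using y unfolding lessThan_Suc by (intro W.finsum_insert) auto
  also have "\<dots> = (\<lambda>i. if i = k then y k [^] (p ^ k) else \<zero>) \<oplus>\<^bsub>W\<^esub> ?u"
    by (subst Suc) (simp only: add_pow_p_power_teichmuller[OF y])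
  also have "\<dots> = (\<lambda>i. (if i = k then y k [^] (p ^ k) else \<zero>) \<oplus> ?u i)"
    using y by (intro W_add_disjoint) (auto simp: W_simps)
  also have "\<dots> = (\<lambda>n. if n < Suc k then y n [^] (p ^ n) else \<zero>)"
    using y by (auto simp: fun_eq_iff less_Suc_eq)
  finally show ?case .
qed

text \<open>Convergence means that each component of the partial sums eventually equals that of
  \<open>w\<close>, and component \<open>n\<close> of the partial sums is constant as soon as the
  summand \<open>n\<close> is included.\<close>

lemma teichmuller_expansion_iff:
  assumes w: "w \<in> carrier W"
  shows "teichmuller_expansion p B w y \<longleftrightarrow> (\<forall>n. y n \<in> carrier B \<and> y n [^] (p ^ n) = w n)"
proof (cases "\<forall>n. y n \<in> carrier B")
  case True
  then have y: "\<And>n. y n \<in> carrier B" by blast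
  let ?s = "\<lambda>k n. if n < k then y n [^] (p ^ n) else \<zero>"
  have s: "?s k \<in> carrier W" for k using y by (simp add: W_simps)
  have "teichmuller_expansion p B w y \<longleftrightarrow> limitin (adic_topology W p_ideal) ?s w sequentially"
    using y by (simp add: teichmuller_expansion_def partial_sum_eq Let_def)
  also have "\<dots> \<longleftrightarrow> (\<forall>n. \<exists>K. \<forall>k\<ge>K. \<forall>i<n. ?s k i = w i)"
    by (simp only: W.limitin_adic_topology_iff[OF ideal_p_ideal w s] p_ideal_power W_diff_vanishing_iff[OF s w])
  also have "\<dots> \<longleftrightarrow> (\<forall>n. y n [^] (p ^ n) = w n)"
  proof
    assume l: "\<forall>n. \<exists>K. \<forall>k\<ge>K. \<forall>i<n. ?s k i = w i"
    show "\<forall>n. y n [^] (p ^ n) = w n"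
    proof
      fix n
      obtain K where "\<forall>k\<ge>K. \<forall>i<Suc n. ?s k i = w i" using l by blast
      \<comment> \<open>The chosen index is at least \<open>K\<close>, so the limit condition
        applies, and exceeds \<open>n\<close>, so component \<open>n\<close> has not been cut
        off.\<close>
      then have "?s (max K (Suc n)) n = w n" by (metis lessI max.cobounded1)
      moreover have "n < max K (Suc n)" by simp
      ultimately show "y n [^] (p ^ n) = w n" by (simp only: if_True)
    qed
  next
    assume eq: "\<forall>n. y n [^] (p ^ n) = w n"
    have "?s k i = w i" if "n \<le> k" "i < n" for n k i using eq that by auto
    then show "\<forall>n. \<exists>K. \<forall>k\<ge>K. \<forall>i<n. ?s k i = w i" by blast
  qed
  finally show ?thesis using y by simp
next
  case False
  then show ?thesis by (auto simp: teichmuller_expansion_def)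
qed

section \<open>The Gauss norm as an ultrametric submultiplicative norm\<close>

abbreviation G :: "(nat \<Rightarrow> 'a) \<Rightarrow> real" where "G \<equiv> gauss_norm p B N \<rho>"

text \<open>Perfectness gives the roots and injectivity of Frobenius their uniqueness, so the
  definite description picks this \<open>y\<close>. Boundedness is recorded because a real supremum
  says nothing about an unbounded family.\<close>

lemma gauss_norm_obtain:
  assumes w: "w \<in> carrier W"
  obtains y where "\<forall>n. y n \<in> carrier B" "\<forall>n. y n [^] (p ^ n) = w n"
    "G w = (SUP n. \<rho> ^ n * N (y n))" "bdd_above (range (\<lambda>n. \<rho> ^ n * N (y n)))"
proof -
  have "\<forall>n. \<exists>y. y \<in> carrier B \<and> y [^] (p ^ n) = w n"
    using frobenius_power_root[OF W_component_closed[OF w]] by blast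
  then obtain y where "\<forall>n. y n \<in> carrier B \<and> y n [^] (p ^ n) = w n" unfolding choice_iff by blast
  then have y: "\<And>n. y n \<in> carrier B" "\<And>n. y n [^] (p ^ n) = w n" by auto
  have "(THE y. teichmuller_expansion p B w y) = y"
  proof (rule the_equality)
    show "teichmuller_expansion p B w y" using y by (simp add: teichmuller_expansion_iff[OF w])
    fix y' assume "teichmuller_expansion p B w y'"
    then have y': "\<And>n. y' n \<in> carrier B" "\<And>n. y' n [^] (p ^ n) = w n"
      by (auto simp: teichmuller_expansion_iff[OF w])
    show "y' = y"
    proof
      fix n show "y' n = y n" 
        by (rule frobenius_power_inj[OF y'(1) y(1), where k = n]) (simp only: y(2) y'(2))
    qed
  qed
  then have 1: "G w = (SUP n. \<rho> ^ n * N (y n))" by (simp add: gauss_norm_def)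
  have "\<rho> ^ n * N (y n) \<le> 1 * 1" for n
    using rho by (intro mult_mono N_le_1 N_nonneg y) (auto simp: power_le_one)
  then have "bdd_above (range (\<lambda>n. \<rho> ^ n * N (y n)))" by (intro bdd_aboveI2[of _ _ 1]) simp
  with 1 y show ?thesis by (intro that[of y]) auto
qed

text \<open>The inequality for \<open>y n\<close> is raised to the power \<open>p ^ n\<close>, which
  is reversible for nonnegative reals and commutes with \<open>N\<close>.\<close>

lemma gauss_norm_le_iff:
  assumes w: "w \<in> carrier W" and c: "c \<ge> 0"
  shows "G w \<le> c \<longleftrightarrow> (\<forall>k. gauss_bound k c w)"
proof -
  obtain y where y: "\<forall>n. y n \<in> carrier B" "\<forall>n. y n [^] (p ^ n) = w n"
    "G w = (SUP n. \<rho> ^ n * N (y n))" "bdd_above (range (\<lambda>n. \<rho> ^ n * N (y n)))"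
    by (rule gauss_norm_obtain[OF w]) (rule that; assumption)
  note y = y[rule_format]
  have "\<rho> ^ n * N (y n) \<le> c \<longleftrightarrow> N (w n) \<le> (c / \<rho> ^ n) ^ (p ^ n)" for n
  proof -
    have "N (w n) = N (y n) ^ (p ^ n)" using N_pow[OF y(1), of "p ^ n" n] y(2)[of n] by simp
    moreover have "N (y n) ^ (p ^ n) \<le> (c / \<rho> ^ n) ^ (p ^ n) \<longleftrightarrow> N (y n) \<le> c / \<rho> ^ n"
      using rho c N_nonneg[OF y(1)] by (intro power_mono_iff) auto
    ultimately show ?thesis using rho by (simp add: field_simps)
  qed
  then have "G w \<le> c \<longleftrightarrow> (\<forall>n. N (w n) \<le> (c / \<rho> ^ n) ^ (p ^ n))"
    unfolding y(3) by (subst cSUP_le_iff[OF _ y(4)]) auto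
  then show ?thesis unfolding gauss_bound_def by blast
qed

lemma gauss_norm_nonneg:
  assumes "w \<in> carrier W"
  shows "0 \<le> G w"
proof -
  obtain y where y: "\<forall>n. y n \<in> carrier B" "\<forall>n. y n [^] (p ^ n) = w n"
    "G w = (SUP n. \<rho> ^ n * N (y n))" "bdd_above (range (\<lambda>n. \<rho> ^ n * N (y n)))"
    by (rule gauss_norm_obtain[OF assms]) (rule that; assumption)
  note y = y[rule_format]
  have "\<rho> ^ 0 * N (y 0) \<le> G w" unfolding y(3) by (rule cSUP_upper[OF _ y(4)]) simp
  then show ?thesis using N_nonneg[OF y(1), of 0] by simp
qed

lemma gauss_bound_gauss_norm: "w \<in> carrier W \<Longrightarrow> gauss_bound k (G w) w"
  using gauss_norm_le_iff[of w "G w"] gauss_norm_nonneg by simp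

lemma gauss_bound_mono:
  assumes "gauss_bound k c w" "0 \<le> c" "c \<le> d"
  shows "gauss_bound k d w"
  unfolding gauss_bound_def
proof (intro allI impI)
  fix n assume "n < k"
  then have "N (w n) \<le> (c / \<rho> ^ n) ^ (p ^ n)" using assms by (simp add: gauss_bound_def)
  also have "\<dots> \<le> (d / \<rho> ^ n) ^ (p ^ n)"
    using assms rho by (intro power_mono divide_right_mono) auto
  finally show "N (w n) \<le> (d / \<rho> ^ n) ^ (p ^ n)" .
qed

lemma gauss_norm_diff:
  assumes "a \<in> carrier W" "b \<in> carrier W"
  shows "G (a \<ominus>\<^bsub>W\<^esub> b) \<le> max (G a) (G b)"
proof -
  have nn: "0 \<le> G a" "0 \<le> G b" using assms gauss_norm_nonneg by auto
  have "gauss_bound k (max (G a) (G b)) (a \<ominus>\<^bsub>W\<^esub> b)" for k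
    using assms nn gauss_bound_mono[OF gauss_bound_gauss_norm[OF assms(1), of k], of "max (G a) (G b)"]
      gauss_bound_mono[OF gauss_bound_gauss_norm[OF assms(2), of k], of "max (G a) (G b)"]
    by (intro gauss_bound_diff) auto
  then show ?thesis using assms nn by (subst gauss_norm_le_iff) auto
qed

lemma gauss_norm_mult:
  assumes "a \<in> carrier W" "b \<in> carrier W"
  shows "G (a \<otimes>\<^bsub>W\<^esub> b) \<le> G a * G b"
  using assms gauss_norm_nonneg
  by (subst gauss_norm_le_iff) (auto intro!: gauss_bound_mult gauss_bound_gauss_norm)

lemma gauss_norm_le_1: "w \<in> carrier W \<Longrightarrow> G w \<le> 1"
  by (subst gauss_norm_le_iff) (auto intro: gauss_bound_1)

lemma gauss_norm_eq_0_iff: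
  assumes "w \<in> carrier W"
  shows "G w = 0 \<longleftrightarrow> w = \<zero>\<^bsub>W\<^esub>"
proof -
  have "G w = 0 \<longleftrightarrow> G w \<le> 0" using gauss_norm_nonneg[OF assms] by linarith
  also have "\<dots> \<longleftrightarrow> (\<forall>n. N (w n) \<le> 0)"
    using assms by (subst gauss_norm_le_iff) (auto simp: gauss_bound_def power_0_left)
  also have "\<dots> \<longleftrightarrow> (\<forall>n. w n = \<zero>)"
    using N_nonneg[OF W_component_closed[OF assms]] N_eq_0[OF W_component_closed[OF assms]]
    by (metis order_antisym order_refl)
  finally show ?thesis by (auto simp: W_simps fun_eq_iff)
qed

lemma Metric_space_gauss_norm: "Metric_space (carrier W) (norm_dist W G)"
  by (rule W.Metric_space_norm_dist[OF gauss_norm_nonneg gauss_norm_eq_0_iff gauss_norm_diff])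

lemma gauss_norm_teichmuller_le:
  assumes "x \<in> carrier B"
  shows "G (teichmuller B x) \<le> N x"
proof -
  have "gauss_bound k (N x * 1) (teichmuller B x \<otimes>\<^bsub>W\<^esub> \<one>\<^bsub>W\<^esub>)" for k
    using assms by (intro gauss_bound_teichmuller_mult gauss_bound_1) auto
  then show ?thesis using assms N_nonneg by (subst gauss_norm_le_iff) auto
qed

lemma gauss_norm_p_le: "G (add_pow W p \<one>\<^bsub>W\<^esub>) \<le> \<rho>"
proof -
  \<comment> \<open>The trivial bound 1, in the form required for multiplying by
    \<open>p\<close>.\<close>
  have "gauss_bound k (\<rho> / \<rho>) \<one>\<^bsub>W\<^esub>" for k using gauss_bound_1 rho by simp
  then have "gauss_bound (Suc k) \<rho> (add_pow W p \<one>\<^bsub>W\<^esub>)" for k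
    using rho by (intro gauss_bound_p) auto
  then have "gauss_bound k \<rho> (add_pow W p \<one>\<^bsub>W\<^esub>)" for k
    by (auto simp: gauss_bound_def)
  then show ?thesis using rho by (subst gauss_norm_le_iff) auto
qed

subsection \<open>Comparison of the topologies\<close>

context
  fixes x :: "nat \<Rightarrow> 'a" and m :: nat and J :: "(nat \<Rightarrow> 'a) set"
  assumes x: "\<And>i. i \<le> m \<Longrightarrow> x i \<in> carrier B"
  defines "J \<equiv> Idl\<^bsub>W\<^esub> ({add_pow W p \<one>\<^bsub>W\<^esub>} \<union> (\<lambda>i. teichmuller B (x i)) ` {..m})"
begin

lemma generators_subset: "{add_pow W p \<one>\<^bsub>W\<^esub>} \<union> (\<lambda>i. teichmuller B (x i)) ` {..m} \<subseteq> carrier W"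
  using x by auto

lemma ideal_J: "ideal J W"
  unfolding J_def by (rule W.genideal_ideal[OF generators_subset])

lemma generators_in_J: "add_pow W p \<one>\<^bsub>W\<^esub> \<in> J" "i \<le> m \<Longrightarrow> teichmuller B (x i) \<in> J"
  using W.genideal_self[OF generators_subset] unfolding J_def by auto

lemma vanishing_subset_J_power: "vanishing n \<subseteq> W.ideal_power J n"
proof -
  have "p_ideal \<subseteq> J" using generators_in_J(1) by (intro W.genideal_minimal[OF ideal_J]) simp
  then show ?thesis using W.ideal_power_mono[of p_ideal J n] by (simp only: p_ideal_power)
qed

text \<open>Balls absorb multiplication because the Gauss norm is at most 1 everywhere. An inclusion
  of \<open>J\<close> into a ball can then be checked on generators.\<close>

lemma ideal_gauss_ball:
  assumes "c \<ge> 0"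
  shows "ideal {w \<in> carrier W. G w \<le> c} W"
proof (rule idealI[OF W.ring_axioms])
  show "subgroup {w \<in> carrier W. G w \<le> c} (add_monoid W)"
  proof (rule W.add.subgroupI)
    show "{w \<in> carrier W. G w \<le> c} \<noteq> {}" using assms gauss_norm_eq_0_iff[of "\<zero>\<^bsub>W\<^esub>"] by auto
    have neg: "G (\<ominus>\<^bsub>W\<^esub> a) \<le> c" if "a \<in> carrier W" "G a \<le> c" for a
      using gauss_norm_diff[of "\<zero>\<^bsub>W\<^esub>" a] gauss_norm_eq_0_iff[of "\<zero>\<^bsub>W\<^esub>"] that assms
      by (simp add: W.minus_eq)
    fix a assume a: "a \<in> {w \<in> carrier W. G w \<le> c}"
    then show "\<ominus>\<^bsub>W\<^esub> a \<in> {w \<in> carrier W. G w \<le> c}" using neg by simp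
    fix b assume b: "b \<in> {w \<in> carrier W. G w \<le> c}"
    show "a \<oplus>\<^bsub>W\<^esub> b \<in> {w \<in> carrier W. G w \<le> c}"
      using gauss_norm_diff[of a "\<ominus>\<^bsub>W\<^esub> b"] neg[of b] a b by (auto simp: W.minus_eq)
  qed auto
  fix a w assume a: "a \<in> {w \<in> carrier W. G w \<le> c}" and w: "w \<in> carrier W"
  have "G (w \<otimes>\<^bsub>W\<^esub> a) \<le> G w * G a" using gauss_norm_mult a w by simp
  also have "\<dots> \<le> 1 * c" using a w assms gauss_norm_nonneg gauss_norm_le_1 by (intro mult_mono) auto
  finally show "w \<otimes>\<^bsub>W\<^esub> a \<in> {w \<in> carrier W. G w \<le> c}" using a w by simp
  then show "a \<otimes>\<^bsub>W\<^esub> w \<in> {w \<in> carrier W. G w \<le> c}" using a w by (simp add: W.m_comm)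
qed

lemma J_power_subset_gauss_ball:
  assumes c: "\<rho> \<le> c" "\<And>i. i \<le> m \<Longrightarrow> N (x i) \<le> c"
  shows "W.ideal_power J n \<subseteq> {w \<in> carrier W. G w \<le> c ^ n}"
proof (induction n)
  case 0
  then show ?case using gauss_norm_le_1 by (simp only: W.ideal_power_0) auto
next
  case (Suc n)
  have c0: "0 \<le> c" using rho c by linarith
  have J: "J \<subseteq> {w \<in> carrier W. G w \<le> c}"
    unfolding J_def
  proof (rule W.genideal_minimal[OF ideal_gauss_ball[OF c0]])
    show "{add_pow W p \<one>\<^bsub>W\<^esub>} \<union> (\<lambda>i. teichmuller B (x i)) ` {..m} \<subseteq> {w \<in> carrier W. G w \<le> c}"
      using x c gauss_norm_p_le gauss_norm_teichmuller_le order_trans by (fastforce)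
  qed
  show ?case
  proof
    fix w assume "w \<in> W.ideal_power J (Suc n)"
    then have "w \<in> ideal_prod W (W.ideal_power J n) J" by (simp only: W.ideal_power_Suc)
    then show "w \<in> {w \<in> carrier W. G w \<le> c ^ Suc n}"
    proof (induction rule: ideal_prod.induct)
      case (prod a b)
      then have a: "a \<in> carrier W" "G a \<le> c ^ n" and b: "b \<in> carrier W" "G b \<le> c"
        using Suc J by auto
      have "G (a \<otimes>\<^bsub>W\<^esub> b) \<le> G a * G b" using gauss_norm_mult a b by simp
      also have "\<dots> \<le> c ^ n * c" using a b c0 gauss_norm_nonneg by (intro mult_mono) auto
      finally show ?case using a b by (simp add: mult.commute)
    next
      case (sum a b)
      then show ?case using W.ideal_plus_closed[OF ideal_gauss_ball] c0 by simp
    qed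
  qed
qed

text \<open>Membership in \<open>J\<close> depends only on component 0, since a Witt vector minus
  the Teichmueller lift of its component 0 is a multiple of \<open>p\<close>. Component 0 is
  additive, so \<open>[b] + [b']\<close> in \<open>J\<close> gives \<open>[b + b']\<close> in
  \<open>J\<close>, although the lift is not additive.\<close>

lemma teichmuller_in_J:
  assumes z: "z \<in> Idl\<^bsub>B\<^esub> (x ` {..m})"
  shows "teichmuller B z \<in> J"
proof -
  have p_sub: "vanishing 1 \<subseteq> J"
    using vanishing_subset_J_power[of 1] W.ideal_power_1[OF ideal_J] by simp
  have key: "w \<in> J \<longleftrightarrow> teichmuller B (w 0) \<in> J" if w: "w \<in> carrier W" for w
  proof -
    let ?t = "teichmuller B (w 0)"
    have t: "?t \<in> carrier W" using W_component_closed[OF w] by simp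
    have d: "w \<ominus>\<^bsub>W\<^esub> ?t \<in> J"
      using W_diff_vanishing_iff[OF w t, of 1] p_sub by (auto simp: teichmuller_def)
    have "w = (w \<ominus>\<^bsub>W\<^esub> ?t) \<oplus>\<^bsub>W\<^esub> ?t" "?t = w \<ominus>\<^bsub>W\<^esub> (w \<ominus>\<^bsub>W\<^esub> ?t)" using w t by algebra+
    then show ?thesis
      using W.ideal_plus_closed[OF ideal_J d] W.ideal_minus_closed[OF ideal_J _ d] by metis
  qed
  have "ideal {b \<in> carrier B. teichmuller B b \<in> J} B"
  proof (rule idealI[OF ring_axioms])
    show "subgroup {b \<in> carrier B. teichmuller B b \<in> J} (add_monoid B)"
    proof (rule add.subgroupI)
      have "teichmuller B \<zero> = \<zero>\<^bsub>W\<^esub>" by (simp add: teichmuller_def W_simps fun_eq_iff)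
      then show "{b \<in> carrier B. teichmuller B b \<in> J} \<noteq> {}"
        using W.ideal_zero_mem[OF ideal_J] by auto
      fix a assume a: "a \<in> {b \<in> carrier B. teichmuller B b \<in> J}"
      have sum: "teichmuller B (b \<oplus> b') \<in> J"
        if "b \<in> carrier B" "b' \<in> carrier B" "teichmuller B b \<in> J" "teichmuller B b' \<in> J" for b b'
      proof -
        let ?s = "teichmuller B b \<oplus>\<^bsub>W\<^esub> teichmuller B b'"
        have "?s \<in> J" by (rule W.ideal_plus_closed[OF ideal_J that(3,4)])
        moreover have "?s 0 = b \<oplus> b'" using that by (simp add: W_add_0) (simp add: teichmuller_def)
        ultimately show ?thesis using key[of ?s] that by simp
      qed
      have neg: "teichmuller B (\<ominus> b) \<in> J" if "b \<in> carrier B" "teichmuller B b \<in> J" for b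
      proof -
        have "teichmuller B (\<ominus> \<one> \<otimes> b) \<in> J"
          using that ideal.I_l_closed[OF ideal_J that(2), of "teichmuller B (\<ominus> \<one>)"]
          by (simp add: teichmuller_mult)
        then show ?thesis using that by (simp add: l_minus)
      qed
      show "\<ominus> a \<in> {b \<in> carrier B. teichmuller B b \<in> J}" using a neg by simp
      fix b assume "b \<in> {b \<in> carrier B. teichmuller B b \<in> J}"
      then show "a \<oplus> b \<in> {b \<in> carrier B. teichmuller B b \<in> J}" using a sum by simp
    qed auto
    fix a b assume a: "a \<in> {b \<in> carrier B. teichmuller B b \<in> J}" and b: "b \<in> carrier B"
    show "b \<otimes> a \<in> {b \<in> carrier B. teichmuller B b \<in> J}"
      using a b ideal.I_l_closed[OF ideal_J, of "teichmuller B a" "teichmuller B b"]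
      by (simp add: teichmuller_mult)
    then show "a \<otimes> b \<in> {b \<in> carrier B. teichmuller B b \<in> J}" using a b by (simp add: m_comm)
  qed
  then have "Idl\<^bsub>B\<^esub> (x ` {..m}) \<subseteq> {b \<in> carrier B. teichmuller B b \<in> J}"
    using x generators_in_J(2) by (intro genideal_minimal) auto
  then show ?thesis using z by blast
qed

text \<open>Origin of the radius: for \<open>n < k\<close> the weight \<open>\<rho> ^ n\<close> is
  at least \<open>\<rho> ^ k\<close>, so the first factor yields
  \<open>N (y n) < \<delta> ^ (p ^ k)\<close>; a root of order \<open>p ^ k\<close> then has norm
  below \<open>\<delta>\<close>.\<close>

lemma gauss_ball_subset_J_power:
  assumes \<delta>: "\<delta> > 0" "\<And>b. b \<in> carrier B \<Longrightarrow> N b < \<delta> \<Longrightarrow> b \<in> Idl\<^bsub>B\<^esub> (x ` {..m})"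
    and w: "w \<in> carrier W" "G w < \<rho> ^ k * \<delta> ^ (p ^ k)"
  shows "w \<in> W.ideal_power J k"
proof -
  obtain y where y: "\<forall>n. y n \<in> carrier B" "\<forall>n. y n [^] (p ^ n) = w n"
    "G w = (SUP n. \<rho> ^ n * N (y n))" "bdd_above (range (\<lambda>n. \<rho> ^ n * N (y n)))"
    by (rule gauss_norm_obtain[OF w(1)]) (rule that; assumption)
  note y = y[rule_format]
  have Jk: "ideal (W.ideal_power J k) W" by (rule W.ideal_ideal_power[OF ideal_J])
  have t: "teichmuller B (y n) \<in> W.ideal_power J k" if n: "n < k" for n
  proof -
    obtain z where z: "z \<in> carrier B" "z [^] (p ^ k) = y n" using frobenius_power_root[OF y(1)] by blast
    have "\<rho> ^ k * N (y n) \<le> \<rho> ^ n * N (y n)"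
      using rho n N_nonneg[OF y(1)] by (intro mult_right_mono power_decreasing) auto
    also have "\<dots> \<le> G w" unfolding y(3) by (rule cSUP_upper[OF _ y(4)]) simp
    finally have "\<rho> ^ k * N (y n) < \<rho> ^ k * \<delta> ^ (p ^ k)" using w(2) by linarith
    then have "N (y n) < \<delta> ^ (p ^ k)" using rho by simp
    then have "N z ^ (p ^ k) < \<delta> ^ (p ^ k)" using N_pow[OF z(1), of "p ^ k"] z(2) by simp
    then have "N z < \<delta>" using \<delta>(1) by (meson less_imp_le power_less_imp_less_base)
    then have "teichmuller B z \<in> J" using \<delta>(2) z(1) by (intro teichmuller_in_J) simp
    then have "teichmuller B z [^]\<^bsub>W\<^esub> (p ^ k) \<in> W.ideal_power J (p ^ k)"
      by (rule W.pow_mem_ideal_power[OF ideal_J])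
    then have "teichmuller B (y n) \<in> W.ideal_power J (p ^ k)"
      unfolding z(2)[symmetric] using z(1) by (simp add: teichmuller_pow)
    \<comment> \<open>Roots exist only for orders that are powers of \<open>p\<close>, so the
      exponent overshoots \<open>k\<close> and is cut back here.\<close>
    moreover have "k \<le> p ^ k"
      using prime_gt_1_nat[OF p_prime] by (intro less_imp_le power_gt_expt) simp
    ultimately show ?thesis using W.ideal_power_antimono[OF ideal_J] by blast
  qed
  let ?t = "\<lambda>n. add_pow W (p ^ n) (teichmuller B (y n))"
  have "(\<Oplus>\<^bsub>W\<^esub>n\<in>{..<k'}. ?t n) \<in> W.ideal_power J k" if "k' \<le> k" for k'
    using that
  proof (induction k')
    case 0
    then show ?case using W.ideal_zero_mem[OF Jk] by simp
  next
    case (Suc k')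
    have "?t k' = teichmuller B (y k') \<otimes>\<^bsub>W\<^esub> add_pow W (p ^ k') \<one>\<^bsub>W\<^esub>"
      using y(1) by (simp add: W.add_pow_rdistr)
    then have "?t k' \<in> W.ideal_power J k"
      using ideal.I_r_closed[OF Jk t, of k'] Suc.prems by simp
    moreover have "(\<Oplus>\<^bsub>W\<^esub>n\<in>{..<Suc k'}. ?t n) = ?t k' \<oplus>\<^bsub>W\<^esub> (\<Oplus>\<^bsub>W\<^esub>n\<in>{..<k'}. ?t n)"
      using y(1) unfolding lessThan_Suc by (intro W.finsum_insert) auto
    ultimately show ?case using Suc W.ideal_plus_closed[OF Jk] by simp
  qed
  from this[OF order_refl] have s: "(\<lambda>n. if n < k then w n else \<zero>) \<in> W.ideal_power J k"
    unfolding partial_sum_eq[OF y(1)] y(2) .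
  \<comment> \<open>From component \<open>k\<close> on, the vector is a multiple of
    \<open>p ^ k\<close> and lies in the power of \<open>J\<close> irrespective of its size.\<close>
  obtain v where v: "v \<in> vanishing k" "w = (\<lambda>n. if n < k then w n else \<zero>) \<oplus>\<^bsub>W\<^esub> v"
    by (rule W_split[OF w(1)])
  have "v \<in> W.ideal_power J k" using v(1) vanishing_subset_J_power by blast
  from W.ideal_plus_closed[OF Jk s this] show ?thesis by (simp only: v(2)[symmetric])
qed

theorem gauss_norm_topology_eq:
  assumes x1: "\<And>i. i \<le> m \<Longrightarrow> N (x i) < 1"
    and \<delta>: "\<delta> > 0" "\<And>b. b \<in> carrier B \<Longrightarrow> N b < \<delta> \<Longrightarrow> b \<in> Idl\<^bsub>B\<^esub> (x ` {..m})"
  shows "norm_topology W G = adic_topology W J"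
proof (rule W.norm_topology_eq_adic_topology[OF Metric_space_gauss_norm ideal_J])
  fix n
  show "\<exists>r>0. \<forall>w\<in>carrier W. G w < r \<longrightarrow> w \<in> W.ideal_power J n"
    using gauss_ball_subset_J_power[OF \<delta>] \<delta>(1) rho
    by (intro exI[of _ "\<rho> ^ n * \<delta> ^ (p ^ n)"]) auto
next
  fix r :: real assume "r > 0"
  \<comment> \<open>The maximum over all generators of \<open>J\<close>: \<open>\<rho>\<close>
    accounts for \<open>p\<close> and \<open>N (x i)\<close> for the Teichmueller lifts. As a finite
    maximum it stays below 1.\<close>
  define c where "c = Max (insert \<rho> ((\<lambda>i. N (x i)) ` {..m}))"
  have c: "\<rho> \<le> c" "\<And>i. i \<le> m \<Longrightarrow> N (x i) \<le> c" "c < 1"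
    unfolding c_def using rho x1 by (auto intro!: Max_ge simp del: Max_insert)
  then obtain n where "c ^ n < r" using real_arch_pow_inv[OF \<open>r > 0\<close>] by blast
  then show "\<exists>n. \<forall>w\<in>W.ideal_power J n. G w < r"
    using J_power_subset_gauss_ball[OF c(1,2), of n] by fastforce
qed

end

end

subsection \<open>Perfectness of the ring of integral elements\<close>

context char_p_ring begin

lemma frobenius_power_add:
  assumes "x \<in> carrier B" "y \<in> carrier B"
  shows "(x \<oplus> y) [^] (p ^ k) = x [^] (p ^ k) \<oplus> y [^] (p ^ k)"
proof (induction k)
  case 0
  then show ?case using assms by simp
next
  case (Suc k)
  have pow: "z [^] (p ^ Suc k) = (z [^] (p ^ k)) [^] p" if "z \<in> carrier B" for z
    using that by (simp add: nat_pow_pow mult.commute)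
  show ?case using assms by (simp only: pow a_closed Suc frobenius_add nat_pow_closed)
qed

lemma frobenius_diff:
  assumes "x \<in> carrier B" "y \<in> carrier B"
  shows "(x \<ominus> y) [^] p = x [^] p \<ominus> y [^] p"
proof -
  have "x = (x \<ominus> y) \<oplus> y" using assms by algebra
  then have eq: "x [^] p = (x \<ominus> y) [^] p \<oplus> y [^] p" using frobenius_add[of "x \<ominus> y" y] assms by simp
  have "u = (u \<oplus> v) \<ominus> v" if "u \<in> carrier B" "v \<in> carrier B" for u v using that by algebra
  from this[of "(x \<ominus> y) [^] p" "y [^] p"] show ?thesis using assms eq by simp
qed

text \<open>Induction on \<open>n\<close>. For a product with \<open>a\<close> in
  \<open>I ^ n\<close> and \<open>b\<close> in \<open>I\<close>, let \<open>c ^ p\<close>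
  approximate \<open>a\<close> modulo \<open>I ^ (n + 1)\<close> and \<open>d ^ p\<close>
  approximate \<open>b\<close>. Then
  \<open>a b - (c d) ^ p = a (b - d ^ p) + (a - c ^ p) d ^ p\<close>, and both terms lie in
  \<open>I ^ (n + 2)\<close>. Sums are covered by additivity of Frobenius.\<close>

lemma frobenius_approximation_step:
  assumes I: "ideal I B" and approx: "\<And>z. z \<in> carrier B \<Longrightarrow> \<exists>c\<in>carrier B. z \<ominus> c [^] p \<in> ideal_power I p"
    and e: "e \<in> ideal_power I n"
  shows "\<exists>c\<in>carrier B. e \<ominus> c [^] p \<in> ideal_power I (Suc n)"
  using e
proof (induction n arbitrary: e)
  case 0
  have "ideal_power I p \<subseteq> ideal_power I (Suc 0)" 
    using prime_ge_1_nat[OF p_prime] by (intro ideal_power_antimono[OF I]) simp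
  moreover have "e \<in> carrier B" using 0 by (simp only: ideal_power_0)
  ultimately show ?case using approx by blast
next
  case (Suc n)
  note In = ideal_ideal_power[OF I]
  have carr: "ideal_power I k \<subseteq> carrier B" for k using ideal.Icarr[OF In] by blast
  have I_carr: "I \<subseteq> carrier B" using ideal.Icarr[OF I] by blast
  have I2: "ideal_power I 2 = ideal_prod B I I"
    using ideal_power_Suc[of I 1] ideal_power_1[OF I] by (simp only: Suc_1)
  have ISS: "ideal_power I (Suc (Suc n)) = ideal_prod B (ideal_power I n) (ideal_power I 2)"
    unfolding I2 by (simp only: ideal_power_Suc ideal_prod_assoc[OF In I I])
  from Suc.prems have "e \<in> ideal_prod B (ideal_power I n) I" by (simp only: ideal_power_Suc)
  then show ?case
  proof (induction rule: ideal_prod.induct)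
    case (prod a b)
    have a: "a \<in> carrier B" and b: "b \<in> carrier B" using prod carr I_carr by auto
    obtain c where c: "c \<in> carrier B" "a \<ominus> c [^] p \<in> ideal_power I (Suc n)"
      using Suc.IH[OF prod(1)] by blast
    obtain d where d: "d \<in> carrier B" "b \<ominus> d [^] p \<in> ideal_power I p" using approx[OF b] by blast
    \<comment> \<open>Because \<open>p \<ge> 2\<close>, the error of \<open>d ^ p\<close> lies one
      power deeper than \<open>b\<close> itself. In particular \<open>d ^ p\<close> is in
      \<open>I\<close>, which supplies the extra factor in the second term.\<close>
    have "ideal_power I p \<subseteq> ideal_power I 2"
      using prime_ge_2_nat[OF p_prime] by (rule ideal_power_antimono[OF I])
    then have d2: "b \<ominus> d [^] p \<in> ideal_power I 2" using d by blast
    then have "b \<ominus> d [^] p \<in> I" unfolding I2 using ideal_prod_inter[OF I I] by blast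
    then have "b \<ominus> (b \<ominus> d [^] p) \<in> I" by (rule ideal_minus_closed[OF I prod(2)])
    moreover have "b \<ominus> (b \<ominus> v) = v" if "v \<in> carrier B" for v using b that by algebra
    ultimately have dI: "d [^] p \<in> I" using d(1) by simp
    have "a \<otimes> (b \<ominus> d [^] p) \<in> ideal_power I (Suc (Suc n))"
      unfolding ISS using prod(1) d2 by (rule ideal_prod.prod)
    moreover have "(a \<ominus> c [^] p) \<otimes> d [^] p \<in> ideal_power I (Suc (Suc n))"
      unfolding ideal_power_Suc[of I "Suc n"] using c(2) dI by (rule ideal_prod.prod)
    ultimately have "a \<otimes> (b \<ominus> d [^] p) \<oplus> (a \<ominus> c [^] p) \<otimes> d [^] p \<in> ideal_power I (Suc (Suc n))"
      by (rule ideal_plus_closed[OF In])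
    moreover have "a \<otimes> (b \<ominus> v) \<oplus> (a \<ominus> u) \<otimes> v = a \<otimes> b \<ominus> u \<otimes> v"
      if "u \<in> carrier B" "v \<in> carrier B" for u v using a b that by algebra
    ultimately have "a \<otimes> b \<ominus> (c \<otimes> d) [^] p \<in> ideal_power I (Suc (Suc n))"
      using c(1) d(1) by (simp add: nat_pow_distrib)
    then show ?case using c(1) d(1) by blast
  next
    case (sum s t)
    then obtain c d where c: "c \<in> carrier B" "s \<ominus> c [^] p \<in> ideal_power I (Suc (Suc n))"
      and d: "d \<in> carrier B" "t \<ominus> d [^] p \<in> ideal_power I (Suc (Suc n))" by blast
    have st: "s \<in> carrier B" "t \<in> carrier B"
      using sum(1,2) ideal_prod_in_carrier[OF In I] by auto
    have "(s \<ominus> u) \<oplus> (t \<ominus> v) = (s \<oplus> t) \<ominus> (u \<oplus> v)" if "u \<in> carrier B" "v \<in> carrier B" for u v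
      using st that by algebra
    from this[of "c [^] p" "d [^] p"]
    have "(s \<oplus> t) \<ominus> (c \<oplus> d) [^] p \<in> ideal_power I (Suc (Suc n))"
      using ideal_plus_closed[OF In c(2) d(2)] c(1) d(1) by (simp add: frobenius_add)
    then show ?case using c(1) d(1) by blast
  qed
qed

text \<open>The remaining error is itself a \<open>p\<close>-th power up to the next power of
  \<open>I\<close>, and additivity of Frobenius merges this correction into the root.\<close>

lemma frobenius_approximation:
  assumes I: "ideal I B" and approx: "\<And>z. z \<in> carrier B \<Longrightarrow> \<exists>c\<in>carrier B. z \<ominus> c [^] p \<in> ideal_power I p"
    and z: "z \<in> carrier B"
  shows "\<exists>s\<in>carrier B. z \<ominus> s [^] p \<in> ideal_power I n"
proof (induction n)
  case 0
  have "z \<ominus> \<zero> [^] p \<in> carrier B" using z by simp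
  then show ?case unfolding ideal_power_0 by blast
next
  case (Suc n)
  then obtain s where s: "s \<in> carrier B" "z \<ominus> s [^] p \<in> ideal_power I n" by blast
  then obtain c where c: "c \<in> carrier B" "(z \<ominus> s [^] p) \<ominus> c [^] p \<in> ideal_power I (Suc n)"
    using frobenius_approximation_step[OF I approx] by blast
  have "(z \<ominus> u) \<ominus> v = z \<ominus> (u \<oplus> v)" if "u \<in> carrier B" "v \<in> carrier B" for u v
    using z that by algebra
  from this[of "s [^] p" "c [^] p"] have "z \<ominus> (s \<oplus> c) [^] p \<in> ideal_power I (Suc n)"
    using s c by (simp add: frobenius_add)
  then show ?case using s c by blast
qed

end

text \<open>The coset of \<open>z\<close> contains \<open>z\<close>, so \<open>z\<close> lies in one
  of the cosets of \<open>c ^ p\<close> whose union is \<open>frobenius_mod\<close>.\<close>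

lemma surj_frobenius_modD:
  fixes B :: "('a, 'm) ring_scheme"
  assumes "cring B" and I: "ideal I B"
    and surj: "frobenius_mod p B I ` carrier (B Quot I) = carrier (B Quot (I [^]\<^bsub>ideals_set B\<^esub> p))"
    and z: "z \<in> carrier B"
  shows "\<exists>c\<in>carrier B. z \<ominus>\<^bsub>B\<^esub> c [^]\<^bsub>B\<^esub> p \<in> I [^]\<^bsub>ideals_set B\<^esub> p"
proof -
  interpret cring B by fact
  let ?Ip = "ideal_power I p"
  have Ip: "ideal ?Ip B" by (rule ideal_ideal_power[OF I])
  have "?Ip +>\<^bsub>B\<^esub> z \<in> carrier (B Quot ?Ip)" using z by (auto simp: FactRing_def A_RCOSETS_def')
  then obtain C where C: "C \<in> carrier (B Quot I)" "?Ip +>\<^bsub>B\<^esub> z = frobenius_mod p B I C"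
    using surj by blast
  have "\<zero>\<^bsub>B\<^esub> \<oplus>\<^bsub>B\<^esub> z \<in> ?Ip +>\<^bsub>B\<^esub> z" using ideal_zero_mem[OF Ip] by (auto simp: a_r_coset_def')
  then have "z \<in> frobenius_mod p B I C" using C z by simp
  then obtain c i where c: "c \<in> C" and i: "i \<in> ?Ip" "z = i \<oplus>\<^bsub>B\<^esub> c [^]\<^bsub>B\<^esub> p"
    by (auto simp: frobenius_mod_def a_r_coset_def')
  have "C \<subseteq> carrier B"
    using C(1) ideal.Icarr[OF I] by (auto simp: FactRing_def A_RCOSETS_def' a_r_coset_def')
  then have c: "c \<in> carrier B" using c by blast
  have "i \<in> carrier B" using ideal.Icarr[OF Ip i(1)] .
  moreover have "(u \<oplus>\<^bsub>B\<^esub> v) \<ominus>\<^bsub>B\<^esub> v = u" if "u \<in> carrier B" "v \<in> carrier B" for u v using that by algebra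
  ultimately have "z \<ominus>\<^bsub>B\<^esub> c [^]\<^bsub>B\<^esub> p = i" using c i(2) by simp
  then show ?thesis using c i(1) by blast
qed

section \<open>The norm and Frobenius on the ring of integral elements\<close>

locale normed_perfectoid_pair =
  fixes p :: nat and R :: "('a, 'm) ring_scheme" (structure) and T :: "'a topology" and Rplus :: "'a set"
    and N :: "'a \<Rightarrow> real"
  assumes p_prime: "Factorial_Ring.prime p"
    and perfectoid: "analytic_perfectoid_pair p R T Rplus"
    and char_p: "add_pow R p \<one> = \<zero>"
    and banach: "banach_ring_norm R N" and power_mult: "power_multiplicative_norm R N"
    and topology: "norm_topology R N = T"
begin

abbreviation B :: "('a, 'm) ring_scheme" where "B \<equiv> restrict_ring R Rplus"

lemma huber: "huber_pair R T Rplus" using perfectoid by (simp add: analytic_perfectoid_pair_def)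

lemma cring_R: "cring R"
  using huber
  by (simp add: huber_pair_def huber_ring_def complete_topological_cring_def topological_cring_def)

sublocale R: char_p_ring R p
  by (rule char_p_ring.intro[OF cring_R]) (unfold_locales, fact p_prime, fact char_p)

lemma subring_Rplus: "subring Rplus R" using huber by (simp add: huber_pair_def)

lemma Rplus_carrier: "x \<in> Rplus \<Longrightarrow> x \<in> carrier R"
  using subringE(1)[OF subring_Rplus] by blast

lemma cring_B: "cring B"
  using R.subcring_iff[of Rplus] R.subcringI'[OF subring_Rplus] Rplus_carrier by blast

lemma add_pow_B: "add_pow B (k::nat) x = add_pow R k x"
  by (simp add: add_pow_def nat_pow_def)

lemma pow_B: "x [^]\<^bsub>B\<^esub> (k::nat) = x [^] k"
  by (simp add: nat_pow_def)

sublocale B: char_p_ring B p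
  by (rule char_p_ring.intro[OF cring_B]) (unfold_locales, fact p_prime, simp add: add_pow_B char_p)

text \<open>Additive inverses are defined by a description that refers to the carrier, so
  restricting the ring does not preserve subtraction by definition, unlike sums and powers.\<close>

lemma minus_B:
  assumes "x \<in> Rplus" "y \<in> Rplus"
  shows "x \<ominus>\<^bsub>B\<^esub> y = x \<ominus> y"
proof -
  have c: "\<ominus>\<^bsub>B\<^esub> y \<in> Rplus" using B.a_inv_closed[of y] assms by simp
  have "\<ominus>\<^bsub>B\<^esub> y \<oplus>\<^bsub>B\<^esub> y = \<zero>\<^bsub>B\<^esub>" using B.l_neg[of y] assms by simp
  then have "\<ominus>\<^bsub>B\<^esub> y = \<ominus> y" using R.minus_equality[of "\<ominus>\<^bsub>B\<^esub> y" y] c assms Rplus_carrier by simp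
  then show ?thesis by (simp add: a_minus_def)
qed

lemma N_nonneg: "x \<in> carrier R \<Longrightarrow> 0 \<le> N x"
  and N_eq_0: "x \<in> carrier R \<Longrightarrow> N x = 0 \<longleftrightarrow> x = \<zero>"
  and N_diff: "x \<in> carrier R \<Longrightarrow> y \<in> carrier R \<Longrightarrow> N (x \<ominus> y) \<le> max (N x) (N y)"
  and N_mult: "x \<in> carrier R \<Longrightarrow> y \<in> carrier R \<Longrightarrow> N (x \<otimes> y) \<le> N x * N y"
  and N_complete: "Metric_space.mcomplete (carrier R) (norm_dist R N)"
  using banach by (simp_all add: banach_ring_norm_def)

lemma N_pow: "x \<in> carrier R \<Longrightarrow> k > 0 \<Longrightarrow> N (x [^] (k::nat)) = N x ^ k"
  using power_mult by (simp add: power_multiplicative_norm_def)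

lemma N_0: "N \<zero> = 0" by (simp add: N_eq_0)

lemma N_add:
  assumes "x \<in> carrier R" "y \<in> carrier R"
  shows "N (x \<oplus> y) \<le> max (N x) (N y)"
proof -
  have "N (\<ominus> y) \<le> N y" using N_diff[of \<zero> y] N_nonneg[of y] assms by (simp add: N_0 R.minus_eq)
  then show ?thesis using N_diff[of x "\<ominus> y"] assms by (auto simp: R.minus_eq)
qed

lemma Metric_space_N: "Metric_space (carrier R) (norm_dist R N)"
  by (rule R.Metric_space_norm_dist[OF N_nonneg N_eq_0 N_diff])

lemma openin_T:
  "openin T U \<longleftrightarrow> U \<subseteq> carrier R \<and> (\<forall>x\<in>U. \<exists>r>0. \<forall>y\<in>carrier R. N (y \<ominus> x) < r \<longrightarrow> y \<in> U)"
  unfolding topology[symmetric] by (rule R.openin_norm_topology[OF Metric_space_N])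

lemma openin_T_ball: "openin T {y \<in> carrier R. N y < r}"
  unfolding openin_T
proof (intro conjI ballI)
  fix x assume x: "x \<in> {y \<in> carrier R. N y < r}"
  then have "0 < r" using N_nonneg[of x] by auto
  moreover have "N y < r" if "y \<in> carrier R" "N (y \<ominus> x) < r" for y
  proof -
    have "y = (y \<ominus> x) \<oplus> x" using x that by simp algebra
    then have "N y \<le> max (N (y \<ominus> x)) (N x)" using N_add[of "y \<ominus> x" x] x that by simp
    then show ?thesis using x that by auto
  qed
  ultimately show "\<exists>r'>0. \<forall>y\<in>carrier R. N (y \<ominus> x) < r' \<longrightarrow> y \<in> {y \<in> carrier R. N y < r}" by blast
qed auto

lemma openin_T_zero:
  assumes "openin T U" "\<zero> \<in> U"
  obtains r where "r > 0" "\<And>y. y \<in> carrier R \<Longrightarrow> N y < r \<Longrightarrow> y \<in> U"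
proof -
  have "y \<ominus> \<zero> = y" if "y \<in> carrier R" for y using that by (simp add: R.minus_eq)
  then show ?thesis using assms that unfolding openin_T by metis
qed

text \<open>The elements some power of which multiplies all \<open>x\<^sup>n\<close> into a common ball form an ideal
  containing every topologically nilpotent element. As the ring is analytic, the ideal contains
  \<open>1\<close>, so the powers of \<open>x\<close> are bounded in norm.\<close>

lemma N_le_1:
  assumes x: "x \<in> Rplus"
  shows "N x \<le> 1"
proof -
  have xc: "x \<in> carrier R" using Rplus_carrier[OF x] .
  define K where "K = {r \<in> carrier R. \<exists>(e::nat) C. \<forall>n::nat. N (r [^] e \<otimes> x [^] n) \<le> C}"
  have KI: "r \<in> K" if "r \<in> carrier R" "\<And>n::nat. N (r [^] e \<otimes> x [^] n) \<le> C" for r C and e :: nat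
    using that unfolding K_def by blast
  have larger: "\<exists>C. \<forall>n::nat. N (r [^] e' \<otimes> x [^] n) \<le> C"
    if r: "r \<in> carrier R" and C: "\<forall>n::nat. N (r [^] e \<otimes> x [^] n) \<le> C" and e: "e \<le> e'" for r C and e e' :: nat
  proof (intro exI allI)
    fix n :: nat
    let ?d = "r [^] (e' - e)"
    have "r [^] e' = r [^] e \<otimes> ?d" using r e by (simp add: R.nat_pow_mult)
    then have "r [^] e' \<otimes> x [^] n = ?d \<otimes> (r [^] e \<otimes> x [^] n)"
      using r xc by (simp add: R.m_ac)
    then have "N (r [^] e' \<otimes> x [^] n) \<le> N ?d * N (r [^] e \<otimes> x [^] n)" using N_mult r xc by simp
    also have "\<dots> \<le> N ?d * C" using C N_nonneg r by (intro mult_left_mono) auto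
    finally show "N (r [^] e' \<otimes> x [^] n) \<le> N ?d * C" .
  qed
  have l_closed: "s \<otimes> r \<in> K" if r: "r \<in> K" and s: "s \<in> carrier R" for r s
  proof -
    obtain e C where rc: "r \<in> carrier R" and C: "\<forall>n::nat. N (r [^] (e::nat) \<otimes> x [^] n) \<le> C"
      using r unfolding K_def by blast
    have "N ((s \<otimes> r) [^] e \<otimes> x [^] n) \<le> N (s [^] e) * C" for n :: nat
    proof -
      have "(s \<otimes> r) [^] e \<otimes> x [^] n = s [^] e \<otimes> (r [^] e \<otimes> x [^] n)"
        using rc s xc by (simp add: R.nat_pow_distrib R.m_assoc)
      then have "N ((s \<otimes> r) [^] e \<otimes> x [^] n) \<le> N (s [^] e) * N (r [^] e \<otimes> x [^] n)"
        using N_mult rc s xc by simp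
      also have "\<dots> \<le> N (s [^] e) * C" using C N_nonneg s by (intro mult_left_mono) auto
      finally show ?thesis .
    qed
    then show ?thesis using rc s by (intro KI) auto
  qed
  have K: "ideal K R"
  proof (rule idealI[OF R.ring_axioms])
    show "subgroup K (add_monoid R)"
    proof (rule R.add.subgroupI)
      show "K \<subseteq> carrier R" by (auto simp: K_def)
      have "\<zero> \<in> K" by (rule KI[of _ 1 0]) (use xc in \<open>simp_all add: N_0\<close>)
      then show "K \<noteq> {}" by blast
      fix a assume a: "a \<in> K"
      then have ac: "a \<in> carrier R" by (simp add: K_def)
      have "\<ominus> \<one> \<otimes> a \<in> K" by (rule l_closed[OF a]) simp
      then show "\<ominus> a \<in> K" using ac by (simp add: R.l_minus)
      fix b assume b: "b \<in> K"
      then have bc: "b \<in> carrier R" by (simp add: K_def)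
      obtain e C where C: "\<forall>n::nat. N (a [^] (e::nat) \<otimes> x [^] n) \<le> C" using a unfolding K_def by blast
      obtain f D where D: "\<forall>n::nat. N (b [^] (f::nat) \<otimes> x [^] n) \<le> D" using b unfolding K_def by blast
      \<comment> \<open>Both conditions are moved to the common exponent \<open>p ^ k\<close>; a
        power of \<open>p\<close> is chosen because only those powers are additive.\<close>
      define k where "k = max e f"
      have k: "k \<le> p ^ k" using prime_gt_1_nat[OF p_prime] by (intro less_imp_le power_gt_expt) simp
      obtain C' where C': "\<forall>n::nat. N (a [^] (p ^ k) \<otimes> x [^] n) \<le> C'"
        using larger[OF ac C, of "p ^ k"] k by (auto simp: k_def)
      obtain D' where D': "\<forall>n::nat. N (b [^] (p ^ k) \<otimes> x [^] n) \<le> D'"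
        using larger[OF bc D, of "p ^ k"] k by (auto simp: k_def)
      have "N ((a \<oplus> b) [^] (p ^ k) \<otimes> x [^] n) \<le> max C' D'" for n :: nat
      proof -
        have "(a \<oplus> b) [^] (p ^ k) \<otimes> x [^] n = a [^] (p ^ k) \<otimes> x [^] n \<oplus> b [^] (p ^ k) \<otimes> x [^] n"
          using ac bc xc by (simp add: R.frobenius_power_add R.l_distr)
        then have "N ((a \<oplus> b) [^] (p ^ k) \<otimes> x [^] n) \<le>
            max (N (a [^] (p ^ k) \<otimes> x [^] n)) (N (b [^] (p ^ k) \<otimes> x [^] n))"
          using N_add ac bc xc by simp
        also have "\<dots> \<le> max C' D'" using C' D' by (intro max.mono) auto
        finally show ?thesis .
      qed
      then show "a \<oplus> b \<in> K" using ac bc by (intro KI) auto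
    qed
    fix a s assume as: "a \<in> K" "s \<in> carrier R"
    then show "s \<otimes> a \<in> K" by (rule l_closed)
    then show "a \<otimes> s \<in> K" using as by (simp add: R.m_comm K_def)
  qed
  have "topologically_nilpotent_elements R T \<subseteq> K"
  proof
    fix t assume "t \<in> topologically_nilpotent_elements R T"
    then have t: "t \<in> carrier R" and lim: "limitin T (\<lambda>n::nat. t [^] n) \<zero> sequentially"
      by (auto simp: topologically_nilpotent_elements_def)
    have "x \<in> power_bounded_elements R T" using huber x by (auto simp: huber_pair_def)
    then have "bounded_in R T (range (\<lambda>n::nat. x [^] n))" by (simp add: power_bounded_elements_def)
    \<comment> \<open>Boundedness of the powers of \<open>x\<close> is tested against the unit ball.
      The resulting neighbourhood \<open>V\<close> of zero contains a power of \<open>t\<close>,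
      whose exponent witnesses membership in \<open>K\<close>.\<close>
    moreover have "openin T {y \<in> carrier R. N y < 1} \<and> \<zero> \<in> {y \<in> carrier R. N y < 1}"
      using openin_T_ball by (simp add: N_0)
    ultimately obtain V where V: "openin T V" "\<zero> \<in> V"
      and Vx: "\<And>v n. v \<in> V \<Longrightarrow> v \<otimes> x [^] (n::nat) \<in> {y \<in> carrier R. N y < 1}"
      unfolding bounded_in_def by (meson rangeI)
    obtain e where "t [^] (e::nat) \<in> V"
      using lim V unfolding limitin_def eventually_sequentially by blast
    then have "N (t [^] e \<otimes> x [^] n) \<le> 1" for n :: nat using Vx[of "t [^] e" n] by simp
    then show "t \<in> K" by (rule KI[OF t])
  qed
  then have "Idl (topologically_nilpotent_elements R T) \<subseteq> K" by (rule R.genideal_minimal[OF K])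
  then have "\<one> \<in> K" using perfectoid by (auto simp: analytic_perfectoid_pair_def analytic_ring_def)
  then obtain e C where "\<forall>n::nat. N (\<one> [^] (e::nat) \<otimes> x [^] n) \<le> C" unfolding K_def by blast
  then have C: "N (x [^] n) \<le> C" for n :: nat using xc by (simp add: R.nat_pow_one)
  show ?thesis
  proof (rule ccontr)
    assume "\<not> N x \<le> 1"
    then obtain n where n: "max C 1 < N x ^ n" using real_arch_pow[of "N x" "max C 1"] by auto
    then have "n > 0" by (cases n) auto
    then show False using C[of n] N_pow[OF xc, of n] n by auto
  qed
qed

lemma openin_Rplus: "openin T Rplus" using huber by (simp add: huber_pair_def)

lemma zero_Rplus: "\<zero> \<in> Rplus" using subringE(2)[OF subring_Rplus] .

lemma ideal_of_definition_ideal: "ideal_of_definition R T Rplus I \<Longrightarrow> ideal I B"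
  unfolding ideal_of_definition_def fg_ideal_def using B.genideal_ideal by blast

lemma minus_B_zero: "y \<in> Rplus \<Longrightarrow> y \<ominus>\<^bsub>B\<^esub> \<zero> = y"
  using minus_B[OF _ zero_Rplus] Rplus_carrier by (simp add: R.minus_eq)

text \<open>\<open>I\<close> is open in \<open>Rplus\<close> for the adic topology and
  \<open>Rplus\<close> is open in \<open>R\<close>, so \<open>I\<close> is a neighbourhood of zero
  for the norm.\<close>

lemma ideal_of_definition_ball:
  assumes I: "ideal_of_definition R T Rplus I"
  obtains \<delta> where "\<delta> > 0" "\<And>b. b \<in> Rplus \<Longrightarrow> N b < \<delta> \<Longrightarrow> b \<in> I"
proof -
  have id: "ideal I B" by (rule ideal_of_definition_ideal[OF I])
  have "openin (adic_topology B I) {y \<in> carrier B. y \<ominus>\<^bsub>B\<^esub> \<zero>\<^bsub>B\<^esub> \<in> B.ideal_power I 1}"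
    by (rule B.openin_adic_coset[OF id B.zero_closed])
  also have "{y \<in> carrier B. y \<ominus>\<^bsub>B\<^esub> \<zero>\<^bsub>B\<^esub> \<in> B.ideal_power I 1} = I"
    using ideal.Icarr[OF id] by (auto simp: B.ideal_power_1[OF id] minus_B_zero simp del: One_nat_def)
  finally have "openin (subtopology T Rplus) I" using I by (simp add: ideal_of_definition_def)
  then have "openin T I" using openin_Rplus openin_trans_full by blast
  moreover have "\<zero> \<in> I" using B.ideal_zero_mem[OF id] by simp
  ultimately obtain r where "r > 0" "\<And>y. y \<in> carrier R \<Longrightarrow> N y < r \<Longrightarrow> y \<in> I"
    by (rule openin_T_zero) blast
  then show ?thesis using that Rplus_carrier by blast
qed

text \<open>A norm ball meets \<open>Rplus\<close> in a set that is open for the adic topology, and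
  such a neighbourhood of zero contains a power of \<open>I\<close>.\<close>

lemma ideal_of_definition_power_small:
  assumes I: "ideal_of_definition R T Rplus I" and r: "r > 0"
  obtains n where "\<And>w. w \<in> B.ideal_power I n \<Longrightarrow> N w < r"
proof -
  have id: "ideal I B" by (rule ideal_of_definition_ideal[OF I])
  have "openin (subtopology T Rplus) (Rplus \<inter> {y \<in> carrier R. N y < r})"
    by (rule openin_subtopology_Int2[OF openin_T_ball])
  then have "openin (adic_topology B I) (Rplus \<inter> {y \<in> carrier R. N y < r})"
    using I by (simp add: ideal_of_definition_def)
  moreover have "\<zero> \<in> Rplus \<inter> {y \<in> carrier R. N y < r}" using zero_Rplus r by (simp add: N_0)
  ultimately obtain n where n: "\<forall>y\<in>carrier B. y \<ominus>\<^bsub>B\<^esub> \<zero> \<in> B.ideal_power I n \<longrightarrow>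
      y \<in> Rplus \<inter> {y \<in> carrier R. N y < r}"
    unfolding B.openin_adic_topology[OF id] by blast
  have "N w < r" if "w \<in> B.ideal_power I n" for w
  proof -
    have "w \<in> Rplus" using ideal.Icarr[OF B.ideal_ideal_power[OF id] that] by simp
    then show ?thesis using n that by (simp add: minus_B_zero)
  qed
  then show ?thesis by (rule that)
qed

text \<open>The powers \<open>s n ^ p\<close> converge to \<open>z\<close>. Additivity of Frobenius
  and power-multiplicativity give \<open>N (s n - s n') ^ p = N (s n ^ p - s n' ^ p)\<close>, so the
  approximate roots themselves are Cauchy, and their limit is the root.\<close>

lemma perfect:
  assumes z: "z \<in> Rplus"
  shows "\<exists>s\<in>Rplus. s [^] p = z"
proof -
  obtain I where I: "ideal_of_definition R T Rplus I"
    and surj: "frobenius_mod p B I ` carrier (B Quot I) = carrier (B Quot (B.ideal_power I p))"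
    using perfectoid unfolding analytic_perfectoid_pair_def Let_def by blast
  have id: "ideal I B" by (rule ideal_of_definition_ideal[OF I])
  have "\<forall>n. \<exists>s. s \<in> carrier B \<and> z \<ominus>\<^bsub>B\<^esub> s [^]\<^bsub>B\<^esub> p \<in> B.ideal_power I n"
    using B.frobenius_approximation[OF id surj_frobenius_modD[OF cring_B id surj]] z by simp blast
  then obtain s where "\<forall>n. s n \<in> carrier B \<and> z \<ominus>\<^bsub>B\<^esub> s n [^]\<^bsub>B\<^esub> p \<in> B.ideal_power I n"
    unfolding choice_iff by blast
  then have sB: "\<And>n. s n \<in> Rplus" and s0: "\<And>n. z \<ominus>\<^bsub>B\<^esub> s n [^]\<^bsub>B\<^esub> p \<in> B.ideal_power I n" by auto
  have sR: "\<And>n. s n \<in> carrier R" using sB Rplus_carrier by blast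
  have zR: "z \<in> carrier R" using z Rplus_carrier by blast
  have pB: "y [^] p \<in> Rplus" if "y \<in> Rplus" for y
    using B.nat_pow_closed[of y p] that by (simp add: pow_B)
  have s: "z \<ominus> s n [^] p \<in> B.ideal_power I n" for n
    using s0[of n] minus_B[OF z pB[OF sB]] by (simp add: pow_B)
  have small: "\<exists>K. \<forall>n\<ge>K. N (z \<ominus> s n [^] p) < r" if "r > 0" for r
  proof -
    obtain K where K: "\<And>w. w \<in> B.ideal_power I K \<Longrightarrow> N w < r"
      by (rule ideal_of_definition_power_small[OF I \<open>r > 0\<close>]) blast
    have "N (z \<ominus> s n [^] p) < r" if "n \<ge> K" for n
      using K s[of n] B.ideal_power_antimono[OF id that] by blast
    then show ?thesis by blast
  qed
  interpret M: Metric_space "carrier R" "norm_dist R N" by (rule Metric_space_N)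
  have p0: "p > 0" using p_prime by (rule prime_gt_0_nat)
  have "M.MCauchy s"
    unfolding M.MCauchy_def
  proof (intro conjI allI impI)
    show "range s \<subseteq> carrier R" using sR by blast
    fix \<epsilon> :: real assume \<epsilon>: "\<epsilon> > 0"
    then obtain K where K: "\<And>n. n \<ge> K \<Longrightarrow> N (z \<ominus> s n [^] p) < \<epsilon> ^ p" using small[of "\<epsilon> ^ p"] by auto
    have "norm_dist R N (s n) (s n') < \<epsilon>" if "K \<le> n" "K \<le> n'" for n n'
    proof -
      have "u \<ominus> v = (z \<ominus> v) \<ominus> (z \<ominus> u)" if "u \<in> carrier R" "v \<in> carrier R" for u v
        using zR that by algebra
      from this[of "s n [^] p" "s n' [^] p"]
      have "N (s n [^] p \<ominus> s n' [^] p) \<le> max (N (z \<ominus> s n' [^] p)) (N (z \<ominus> s n [^] p))"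
        using N_diff[of "z \<ominus> s n' [^] p" "z \<ominus> s n [^] p"] sR zR by simp
      also have "\<dots> < \<epsilon> ^ p" using K that by simp
      finally have "N (s n \<ominus> s n') ^ p < \<epsilon> ^ p"
        using N_pow[of "s n \<ominus> s n'" p] p0 sR by (simp add: R.frobenius_diff)
      then have "N (s n \<ominus> s n') < \<epsilon>" using \<epsilon> by (meson less_imp_le power_less_imp_less_base)
      then show ?thesis using sR by (simp add: norm_dist_def)
    qed
    then show "\<exists>K. \<forall>n n'. K \<le> n \<longrightarrow> K \<le> n' \<longrightarrow> norm_dist R N (s n) (s n') < \<epsilon>" by blast
  qed
  then obtain l where "limitin M.mtopology s l sequentially"
    using N_complete unfolding M.mcomplete_def by blast
  then have l: "l \<in> carrier R" and lim: "\<And>\<epsilon>. \<epsilon> > 0 \<Longrightarrow> \<exists>K. \<forall>n\<ge>K. norm_dist R N (s n) l < \<epsilon>"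
    unfolding M.limit_metric_sequentially by blast+
  have lim: "\<exists>K. \<forall>n\<ge>K. N (l \<ominus> s n) < \<epsilon>" if "\<epsilon> > 0" for \<epsilon>
  proof -
    have "N (l \<ominus> s n) = norm_dist R N (s n) l" for n
      using M.commute[of l "s n"] l sR[of n] by (simp add: norm_dist_def)
    then show ?thesis using lim[OF that] by simp
  qed
  \<comment> \<open>An open subgroup is closed: the limit differs from a late approximant by an
    element so small that it lies in \<open>Rplus\<close>.\<close>
  obtain r where r: "r > 0" "\<And>y. y \<in> carrier R \<Longrightarrow> N y < r \<Longrightarrow> y \<in> Rplus"
    by (rule openin_T_zero[OF openin_Rplus zero_Rplus]) blast
  obtain n where "N (l \<ominus> s n) < r" using lim[OF r(1)] by blast
  then have "l \<ominus> s n \<in> Rplus" using r(2) l sR by simp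
  then have "(l \<ominus> s n) \<oplus> s n \<in> Rplus" using subringE(7)[OF subring_Rplus] sB by blast
  moreover have "(l \<ominus> s n) \<oplus> s n = l" using l sR[of n] by algebra
  ultimately have lB: "l \<in> Rplus" by simp
  have approx: "N (z \<ominus> l [^] p) < r" if "r > 0" for r
  proof -
    \<comment> \<open>The cap at 1 ensures \<open>\<epsilon> ^ p \<le> \<epsilon> \<le> r\<close>,
      so that closeness of \<open>s n\<close> to \<open>l\<close> passes to their
      \<open>p\<close>-th powers.\<close>
    define \<epsilon> where "\<epsilon> = min 1 r"
    have \<epsilon>: "\<epsilon> > 0" "\<epsilon> \<le> r" "\<epsilon> ^ p \<le> \<epsilon>"
      using that prime_ge_1_nat[OF p_prime] power_decreasing[of 1 p \<epsilon>] by (auto simp: \<epsilon>_def)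
    obtain K where K: "\<And>n. n \<ge> K \<Longrightarrow> N (z \<ominus> s n [^] p) < r" using small[OF \<open>r > 0\<close>] by blast
    obtain K' where K': "\<And>n. n \<ge> K' \<Longrightarrow> N (l \<ominus> s n) < \<epsilon>" using lim[OF \<epsilon>(1)] by blast
    define n where "n = max K K'"
    have "N (l \<ominus> s n) ^ p < \<epsilon> ^ p"
      using K'[of n] p0 N_nonneg l sR by (intro power_strict_mono) (auto simp: n_def)
    then have 1: "N (l [^] p \<ominus> s n [^] p) < r"
      using N_pow[of "l \<ominus> s n" p] p0 l sR \<epsilon> by (simp add: R.frobenius_diff)
    have "z \<ominus> u = (z \<ominus> v) \<ominus> (u \<ominus> v)" if "u \<in> carrier R" "v \<in> carrier R" for u v
      using zR that by algebra
    from this[of "l [^] p" "s n [^] p"]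
    have "N (z \<ominus> l [^] p) \<le> max (N (z \<ominus> s n [^] p)) (N (l [^] p \<ominus> s n [^] p))"
      using N_diff[of "z \<ominus> s n [^] p" "l [^] p \<ominus> s n [^] p"] zR l sR by simp
    then show ?thesis using 1 K[of n] by (auto simp: n_def)
  qed
  have "N (z \<ominus> l [^] p) = 0"
    using approx[of "N (z \<ominus> l [^] p)"] N_nonneg[of "z \<ominus> l [^] p"] zR l by fastforce
  then have "z \<ominus> l [^] p = \<zero>" using N_eq_0 zR l by simp
  then have "l [^] p = z" using zR l by simp
  then show ?thesis using lB by blast
qed

lemma perfect_normed_ring_B:
  assumes "0 < \<rho>" "\<rho> < 1"
  shows "perfect_normed_ring B p N \<rho>"
proof (rule perfect_normed_ring.intro[OF B.char_p_ring_axioms], unfold_locales)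
  fix x y :: 'a and k :: nat
  assume x: "x \<in> carrier B"
  then have xR: "x \<in> carrier R" using Rplus_carrier by simp
  show "0 \<le> N x" "N x = 0 \<longleftrightarrow> x = \<zero>\<^bsub>B\<^esub>" using N_nonneg[OF xR] N_eq_0[OF xR] by simp_all
  show "N x \<le> 1" using x N_le_1 by simp
  show "\<exists>y\<in>carrier B. y [^]\<^bsub>B\<^esub> p = x" using perfect x by (simp add: pow_B)
  { assume "k > 0"
    then show "N (x [^]\<^bsub>B\<^esub> k) = N x ^ k" using N_pow[OF xR] by (simp add: pow_B) }
  { assume y: "y \<in> carrier B"
    then have yR: "y \<in> carrier R" using Rplus_carrier by simp
    show "N (x \<ominus>\<^bsub>B\<^esub> y) \<le> max (N x) (N y)" using N_diff[OF xR yR] minus_B x y by simp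
    show "N (x \<otimes>\<^bsub>B\<^esub> y) \<le> N x * N y" using N_mult[OF xR yR] by simp }
qed (use assms in simp_all)

end

theorem corollary5p6:
  fixes p :: nat and R :: "('a, 'm) ring_scheme" and T :: "'a topology" and Rplus :: "'a set"
    and N :: "'a \<Rightarrow> real" and m :: nat and x :: "nat \<Rightarrow> 'a" and \<rho> :: real
  assumes "Factorial_Ring.prime p"
    and "analytic_perfectoid_pair p R T Rplus"
    and "add_pow R p \<one>\<^bsub>R\<^esub> = \<zero>\<^bsub>R\<^esub>"
    and "banach_ring_norm R N" and "power_multiplicative_norm R N" and "norm_topology R N = T"
    and "\<forall>i\<le>m. x i \<in> Rplus"
    and "ideal_of_definition R T Rplus (Idl\<^bsub>restrict_ring R Rplus\<^esub> (x ` {..m}))"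
    and "0 < \<rho>" and "\<rho> < 1"
  shows "let B = restrict_ring R Rplus; W = witt_ring p B; G = gauss_norm p B N \<rho> in
           Metric_space (carrier W) (norm_dist W G) \<and>
           norm_topology W G =
             adic_topology W
               (Idl\<^bsub>W\<^esub> ({add_pow W p \<one>\<^bsub>W\<^esub>} \<union> (\<lambda>i. teichmuller B (x i)) ` {..m}))"
proof -
  interpret P: normed_perfectoid_pair p R T Rplus N
    using assms(1-6) by unfold_locales
  interpret G: perfect_normed_ring "restrict_ring R Rplus" p N \<rho>
    by (rule P.perfect_normed_ring_B[OF assms(9,10)])
  let ?I = "Idl\<^bsub>restrict_ring R Rplus\<^esub> (x ` {..m})"
  have x: "\<And>i. i \<le> m \<Longrightarrow> x i \<in> carrier (restrict_ring R Rplus)" using assms(7) by simp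
  have id: "ideal ?I (restrict_ring R Rplus)" by (rule P.ideal_of_definition_ideal[OF assms(8)])
  \<comment> \<open>Powers of a generator lie in powers of the ideal of definition and become small;
    power-multiplicativity carries this back to the generator.\<close>
  have small: "N (x i) < 1" if i: "i \<le> m" for i
  proof -
    obtain n where n: "\<And>w. w \<in> P.B.ideal_power ?I n \<Longrightarrow> N w < 1"
      by (rule P.ideal_of_definition_power_small[OF assms(8) zero_less_one]) blast
    have "x i \<in> ?I" using P.B.genideal_self[of "x ` {..m}"] x i by blast
    \<comment> \<open>The exponent \<open>Suc n\<close> is positive, as power-multiplicativity
      demands, and costs nothing because the ideal powers decrease.\<close>
    then have "x i [^]\<^bsub>restrict_ring R Rplus\<^esub> Suc n \<in> P.B.ideal_power ?I (Suc n)"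
      by (rule P.B.pow_mem_ideal_power[OF id])
    then have "N (x i [^]\<^bsub>restrict_ring R Rplus\<^esub> Suc n) < 1"
      using n P.B.ideal_power_Suc_subset[OF id, of n] by blast
    then have "N (x i) ^ Suc n < 1" using G.N_pow[OF x[OF i], of "Suc n"] by (simp only: zero_less_Suc)
    then show ?thesis using one_le_power[of "N (x i)" "Suc n"] by (meson not_le)
  qed
  obtain \<delta> where \<delta>: "\<delta> > 0" "\<And>b. b \<in> Rplus \<Longrightarrow> N b < \<delta> \<Longrightarrow> b \<in> ?I"
    by (rule P.ideal_of_definition_ball[OF assms(8)]) blast
  show ?thesis
    unfolding Let_def
    using G.Metric_space_gauss_norm G.gauss_norm_topology_eq[of m x, OF x small \<delta>(1)] \<delta>(2) by simp
qed

end
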